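(* Let $\mathcal A$ be a finite abelian group and let $F:\mathcal A^{\mathbb Z}\to\mathcal A^{\mathbb Z}$ be an abelian cellular automaton. The following are equivalent: (i) $F$ randomizes in density any harmonically mixing measure; (ii) $F$ has no soliton; (iii) $F$ is diffusive in density; (iv) for some strongly nonuniform Bernoulli measure $\mu$ on $\mathcal A^{\mathbb Z}$, the sequence $(F^t\mu)_{t\in\mathbb N}$ admits the uniform Bernoulli measure $\lambda$ as an accumulation point (for the weak-$*$ topology).
   Context: $(\mathcal A,+)$ is a finite abelian group with neutral element $0$; $\mathcal A^{\mathbb Z}$ has the product topology and the componentwise group structure. The shift is $\sigma(x)=(x_{i+1})_{i\in\mathbb Z}$. A cellular automaton (CA) is a continuous map $F:\mathcal A^{\mathbb Z}\to\mathcal A^{\mathbb Z}$ commuting with $\sigma$; it is abelian if $F(x+y)=F(x)+F(y)$ for all $x,y$. A finite configuration is $x\in\mathcal A^{\mathbb Z}$ with $x_i=0$ for all but finitely many $i$; $\mathrm{supp}(x)=\{i: x_i\neq 0\}$ and $\mathrm{rank}(x)=|\mathrm{supp}(x)|$. A soliton of $F$ is a nonzero finite configuration $c$ such that the diameter of the set of nonzero cells of $F^t(c)$ is bounded independently of $t\in\mathbb N$ (the empty set having diameter $0$). The lower density of $X\subseteq\mathbb N$ is $\liminf_n |\{i\in X: i\le n\}|/n$. $F$ is diffusive in density if for every nonzero finite configuration $c$ there is an increasing sequence of times $(\varphi(t))_t$, whose set of values has lower density $1$, along which $\mathrm{rank}(F^{\varphi(t)}(c))\to\infty$. For a Borel probability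 measure $\mu$ on $\mathcal A^{\mathbb Z}$, $F\mu(U)=\mu(F^{-1}U)$. $\lambda$ is the uniform Bernoulli measure (i.i.d. cells, each uniform on $\mathcal A$). $F$ randomizes $\mu$ in density if there is an increasing sequence $(\varphi(t))_t$ of lower density $1$ with $F^{\varphi(t)}\mu\to\lambda$ in the weak-$*$ topology. A character of $\mathcal A^{\mathbb Z}$ is a continuous homomorphism $\chi$ to the unit circle group; it writes uniquely as $\chi(x)=\prod_{k\in\mathbb Z}\chi_k(x_k)$ with $\chi_k$ characters of $\mathcal A$, all but finitely many trivial; $\mathrm{rank}(\chi)=|\{k:\chi_k\ne \mathbf 1\}|$. Set $\widehat\mu[\chi]=\int\chi\,d\mu$. $\mu$ is harmonically mixing if for all $\varepsilon>0$ there is $R>0$ such that $\mathrm{rank}(\chi)>R$ implies $|\widehat\mu[\chi]|<\varepsilon$. $\mu$ is strongly nonuniform if $\widehat\mu[\chi]\neq0$ for all characters $\chi$. A Bernoulli measure is a product measure $\bigotimes_{\mathbb Z}\beta$ with $\beta$ a probability measure on $\mathcal A$. *)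

theory Defs
  imports "HOL-Probability.Probability" "HOL-Library.Function_Algebras"
begin

text \<open>
  The finite abelian group is a type \<open>'a\<close> of sort \<open>{finite, ab_group_add}\<close>. Addition of
  configurations is the pointwise addition of functions.
\<close>

type_synonym 'a config = "int \<Rightarrow> 'a"

definition config_topology :: "'a config topology" where
  "config_topology = product_topology (\<lambda>_. discrete_topology UNIV) UNIV"

definition shift :: "'a config \<Rightarrow> 'a config" where
  "shift x = (\<lambda>i. x (i + 1))"

definition cellular_automaton :: "('a config \<Rightarrow> 'a config) \<Rightarrow> bool" where
  "cellular_automaton F \<longleftrightarrow>
     continuous_map config_topology config_topology F \<and> (\<forall>x. F (shift x) = shift (F x))"

definition abelian_map :: "('a::ab_group_add config \<Rightarrow> 'a config) \<Rightarrow> bool" where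
  "abelian_map F \<longleftrightarrow> (\<forall>x y. F (x + y) = F x + F y)"

definition supp :: "'a::zero config \<Rightarrow> int set" where
  "supp x = {i. x i \<noteq> 0}"

definition finite_config :: "'a::zero config \<Rightarrow> bool" where
  "finite_config x \<longleftrightarrow> finite (supp x)"

definition config_rank :: "'a::zero config \<Rightarrow> nat" where
  "config_rank x = card (supp x)"

text \<open>
  Library \<open>diameter\<close> is \<open>0\<close> on the empty set, and on a nonempty finite set it is the largest
  distance between two points.
\<close>

definition soliton :: "('a::zero config \<Rightarrow> 'a config) \<Rightarrow> 'a config \<Rightarrow> bool" where
  "soliton F c \<longleftrightarrow> c \<noteq> 0 \<and> finite_config c \<and>
     (\<exists>D. \<forall>t. diameter (real_of_int ` supp ((F ^^ t) c)) \<le> D)"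

definition lower_density :: "nat set \<Rightarrow> ereal" where
  "lower_density X = liminf (\<lambda>n. ereal (real (card {i \<in> X. i \<le> n}) / real n))"

definition diffusive_in_density :: "('a::zero config \<Rightarrow> 'a config) \<Rightarrow> bool" where
  "diffusive_in_density F \<longleftrightarrow>
     (\<forall>c. c \<noteq> 0 \<and> finite_config c \<longrightarrow>
        (\<exists>\<phi> :: nat \<Rightarrow> nat. strict_mono \<phi> \<and> lower_density (range \<phi>) = 1 \<and>
           filterlim (\<lambda>t. config_rank ((F ^^ \<phi> t) c)) at_top sequentially))"

definition config_borel :: "'a config measure" where
  "config_borel = sigma UNIV {U. openin config_topology U}"

definition prob_measures :: "'a config measure set" where
  "prob_measures = {\<mu>. prob_space \<mu> \<and> sets \<mu> = sets config_borel}"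

definition push :: "('a config \<Rightarrow> 'a config) \<Rightarrow> 'a config measure \<Rightarrow> 'a config measure" where
  "push G \<mu> = distr \<mu> config_borel G"

text \<open>
  The coarsest topology on the Borel probability measures for which integration against each
  continuous function is continuous. For finite \<open>'a\<close> configuration space is compact, so these
  functions are bounded.
\<close>

definition weak_star_topology :: "'a config measure topology" where
  "weak_star_topology = topology_generated_by
     {{\<mu> \<in> prob_measures. (\<integral>x. f x \<partial>\<mu>) \<in> U} | (f :: 'a config \<Rightarrow> real) U.
        continuous_map config_topology euclideanreal f \<and> open U}"

definition bernoulli_measure :: "'a pmf \<Rightarrow> 'a config measure" where
  "bernoulli_measure \<beta> = (\<Pi>\<^sub>M i\<in>UNIV. measure_pmf \<beta>)"

definition uniform_bernoulli :: "'a::finite config measure" where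
  "uniform_bernoulli = bernoulli_measure (pmf_of_set UNIV)"

definition randomizes_in_density ::
    "('a::finite config \<Rightarrow> 'a config) \<Rightarrow> 'a config measure \<Rightarrow> bool" where
  "randomizes_in_density F \<mu> \<longleftrightarrow>
     (\<exists>\<phi> :: nat \<Rightarrow> nat. strict_mono \<phi> \<and> lower_density (range \<phi>) = 1 \<and>
        limitin weak_star_topology (\<lambda>t. push (F ^^ \<phi> t) \<mu>) uniform_bernoulli sequentially)"

definition accumulation_point_of :: "'b topology \<Rightarrow> (nat \<Rightarrow> 'b) \<Rightarrow> 'b \<Rightarrow> bool" where
  "accumulation_point_of T s l \<longleftrightarrow>
     l \<in> topspace T \<and> (\<forall>U. openin T U \<and> l \<in> U \<longrightarrow> (\<exists>\<^sub>\<infinity>t. s t \<in> U))"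

definition character :: "('a::ab_group_add config \<Rightarrow> complex) \<Rightarrow> bool" where
  "character \<xi> \<longleftrightarrow> continuous_map config_topology euclidean \<xi> \<and>
     (\<forall>x. norm (\<xi> x) = 1) \<and> (\<forall>x y. \<xi> (x + y) = \<xi> x * \<xi> y)"

definition single :: "int \<Rightarrow> 'a::zero \<Rightarrow> 'a config" where
  "single k a = (\<lambda>i. if i = k then a else 0)"

text \<open>
  \<open>char_at \<xi> k\<close> is the factor of \<open>\<xi>\<close> at the cell \<open>k\<close>; the lemmas \<open>character_eq_prod\<close> and
  \<open>character_factors_unique\<close> below show that these are the factors in the unique
  decomposition of a character as a finite product over the cells.
\<close>

definition char_at :: "('a::zero config \<Rightarrow> complex) \<Rightarrow> int \<Rightarrow> 'a \<Rightarrow> complex" where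
  "char_at \<xi> k = (\<lambda>a. \<xi> (single k a))"

definition char_supp :: "('a::zero config \<Rightarrow> complex) \<Rightarrow> int set" where
  "char_supp \<xi> = {k. char_at \<xi> k \<noteq> (\<lambda>_. 1)}"

definition char_rank :: "('a::zero config \<Rightarrow> complex) \<Rightarrow> nat" where
  "char_rank \<xi> = card (char_supp \<xi>)"

definition fourier_coeff :: "'a config measure \<Rightarrow> ('a config \<Rightarrow> complex) \<Rightarrow> complex" where
  "fourier_coeff \<mu> \<xi> = (\<integral>x. \<xi> x \<partial>\<mu>)"

definition harmonically_mixing :: "'a::ab_group_add config measure \<Rightarrow> bool" where
  "harmonically_mixing \<mu> \<longleftrightarrow>
     (\<forall>\<epsilon>>0. \<exists>R>0::real. \<forall>\<xi>. character \<xi> \<and> real (char_rank \<xi>) > R \<longrightarrow>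
        norm (fourier_coeff \<mu> \<xi>) < \<epsilon>)"

definition strongly_nonuniform :: "'a::ab_group_add config measure \<Rightarrow> bool" where
  "strongly_nonuniform \<mu> \<longleftrightarrow> (\<forall>\<xi>. character \<xi> \<longrightarrow> fourier_coeff \<mu> \<xi> \<noteq> 0)"

lemma topspace_config_topology [simp]: "topspace config_topology = UNIV"
  by (simp add: config_topology_def)

lemma space_config_borel [simp]: "space config_borel = UNIV"
  by (simp add: config_borel_def space_measure_of_conv)

lemma topspace_weak_star [simp]: "topspace weak_star_topology = prob_measures"
proof -
  have "prob_measures \<in> {{\<mu> \<in> prob_measures. (\<integral>x. f x \<partial>\<mu>) \<in> U} | (f :: 'a config \<Rightarrow> real) U.
        continuous_map config_topology euclideanreal f \<and> open U}"
    by (rule CollectI, rule exI[of _ "\<lambda>_. 0"], rule exI[of _ UNIV]) auto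
  then show ?thesis
    unfolding weak_star_topology_def topology_generated_by_topspace by blast
qed

lemma limitin_weak_star_iff:
  fixes s :: "nat \<Rightarrow> 'a config measure"
  assumes "\<And>n. s n \<in> prob_measures"
  shows "limitin weak_star_topology s l sequentially \<longleftrightarrow> l \<in> prob_measures \<and>
    (\<forall>f :: 'a config \<Rightarrow> real. continuous_map config_topology euclideanreal f \<longrightarrow>
       (\<lambda>n. \<integral>x. f x \<partial>s n) \<longlonglongrightarrow> (\<integral>x. f x \<partial>l))" (is "?L \<longleftrightarrow> ?R")
proof
  assume L: ?L
  show ?R
  proof (intro conjI allI impI)
    show l: "l \<in> prob_measures" using L by (simp add: limitin_def)
    fix f :: "'a config \<Rightarrow> real"
    assume f: "continuous_map config_topology euclideanreal f"
    show "(\<lambda>n. \<integral>x. f x \<partial>s n) \<longlonglongrightarrow> (\<integral>x. f x \<partial>l)"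
    proof (rule topological_tendstoI)
      fix U :: "real set" assume U: "open U" "(\<integral>x. f x \<partial>l) \<in> U"
      have "openin weak_star_topology {\<mu> \<in> prob_measures. (\<integral>x. f x \<partial>\<mu>) \<in> U}"
        unfolding weak_star_topology_def
        by (rule topology_generated_by_Basis) (use f U in blast)
      then have "\<forall>\<^sub>F n in sequentially. s n \<in> {\<mu> \<in> prob_measures. (\<integral>x. f x \<partial>\<mu>) \<in> U}"
        using L l U unfolding limitin_def by auto
      then show "\<forall>\<^sub>F n in sequentially. (\<integral>x. f x \<partial>s n) \<in> U"
        by (rule eventually_mono) auto
    qed
  qed
next
  assume R: ?R
  have "\<forall>\<^sub>F n in sequentially. s n \<in> V"
    if "generate_topology_on {{\<mu> \<in> prob_measures. (\<integral>x. f x \<partial>\<mu>) \<in> U} | (f :: 'a config \<Rightarrow> real) U.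
        continuous_map config_topology euclideanreal f \<and> open U} V" "l \<in> V" for V
    using that
  proof (induction rule: generate_topology_on.induct)
    case Empty
    then show ?case by simp
  next
    case (Int a b)
    then show ?case by (auto intro: eventually_conj)
  next
    case (UN K)
    then obtain k where "k \<in> K" "l \<in> k" by auto
    with UN have "\<forall>\<^sub>F n in sequentially. s n \<in> k" by auto
    then show ?case by (rule eventually_mono) (use \<open>k \<in> K\<close> in auto)
  next
    case (Basis V)
    then obtain f :: "'a config \<Rightarrow> real" and U
      where fU: "V = {\<mu> \<in> prob_measures. (\<integral>x. f x \<partial>\<mu>) \<in> U}"
        "continuous_map config_topology euclideanreal f" "open U"
      by blast
    have "\<forall>\<^sub>F n in sequentially. (\<integral>x. f x \<partial>s n) \<in> U"
      using R fU Basis by (intro topological_tendstoD[where f = "\<lambda>n. \<integral>x. f x \<partial>s n"]) auto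
    then show ?case by (rule eventually_mono) (use fU assms in auto)
  qed
  then show ?L
    using R unfolding limitin_def topspace_weak_star
    by (auto simp: weak_star_topology_def openin_topology_generated_by_iff)
qed

lemma prob_space_bernoulli_measure: "prob_space (bernoulli_measure \<beta>)"
  unfolding bernoulli_measure_def by (intro prob_space_PiM prob_space_measure_pmf)

text \<open>On a finite alphabet the product sigma-algebra is the Borel sigma-algebra.\<close>

lemma sets_bernoulli_measure:
  "sets (bernoulli_measure \<beta> :: 'a::finite config measure) = sets config_borel"
proof -
  let ?P = "\<Pi>\<^sub>M i\<in>(UNIV::int set). (count_space UNIV :: 'a measure)"
  let ?B = "{(\<Pi>\<^sub>E i\<in>UNIV. X i) | X :: int \<Rightarrow> 'a set. finite {i. X i \<noteq> UNIV}}"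
  have P: "sets (bernoulli_measure \<beta> :: 'a config measure) = sets ?P"
    unfolding bernoulli_measure_def by (intro sets_PiM_cong) auto
  have countB: "countable ?B"
  proof -
    have "?B \<subseteq> (\<lambda>(K, g :: int \<Rightarrow> 'a set). {x. \<forall>i\<in>K. x i \<in> g i}) `
                 (SIGMA K:{K. finite K}. (\<Pi>\<^sub>E i\<in>K. UNIV))"
    proof
      fix V assume "V \<in> ?B"
      then obtain X :: "int \<Rightarrow> 'a set"
        where X: "V = (\<Pi>\<^sub>E i\<in>UNIV. X i)" "finite {i. X i \<noteq> UNIV}" by blast
      let ?K = "{i. X i \<noteq> UNIV}"
      have "V = {x. \<forall>i\<in>?K. x i \<in> restrict X ?K i}" by (auto simp: X(1) PiE_iff)
      then show "V \<in> (\<lambda>(K, g :: int \<Rightarrow> 'a set). {x. \<forall>i\<in>K. x i \<in> g i}) `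
                 (SIGMA K:{K. finite K}. (\<Pi>\<^sub>E i\<in>K. UNIV))"
        by (intro image_eqI[of _ _ "(?K, restrict X ?K)"]) (use X in auto)
    qed
    moreover have "countable (SIGMA K:{K :: int set. finite K}. (\<Pi>\<^sub>E i\<in>K. (UNIV :: 'a set set)))"
      by (intro countable_SIGMA countable_PiE) (auto intro: countable_Collect_finite)
    ultimately show ?thesis by (meson countable_image countable_subset)
  qed
  have BP: "?B \<subseteq> sets ?P"
  proof
    fix V assume "V \<in> ?B"
    then obtain X :: "int \<Rightarrow> 'a set" where X: "V = (\<Pi>\<^sub>E i\<in>UNIV. X i)" by blast
    show "V \<in> sets ?P" unfolding X by (rule sets_PiM_I_countable) auto
  qed
  have "U \<in> sets ?P" if U: "openin config_topology U" for U :: "'a config set"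
  proof -
    have "U = \<Union>{V \<in> ?B. V \<subseteq> U}"
    proof (rule antisym; rule subsetI)
      fix x assume "x \<in> U"
      then obtain X :: "int \<Rightarrow> 'a set"
        where X: "finite {i. X i \<noteq> UNIV}" "x \<in> (\<Pi>\<^sub>E i\<in>UNIV. X i)" "(\<Pi>\<^sub>E i\<in>UNIV. X i) \<subseteq> U"
        using U unfolding config_topology_def openin_product_topology_alt by auto
      then show "x \<in> \<Union>{V \<in> ?B. V \<subseteq> U}" by blast
    qed blast
    moreover have "\<Union>{V \<in> ?B. V \<subseteq> U} \<in> sets ?P"
      using countB BP by (intro sets.countable_Union) (auto intro: countable_subset[OF _ countB])
    ultimately show ?thesis by simp
  qed
  then have 1: "sets (config_borel :: 'a config measure) \<subseteq> sets ?P"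
    unfolding config_borel_def
    using sets.sigma_sets_subset[of "{U. openin config_topology U}" ?P]
    by (auto simp: sets_measure_of space_PiM)
  have "{f. f i \<in> A} \<in> sets config_borel" for i and A :: "'a set"
  proof -
    have "openin config_topology {f :: 'a config. f i \<in> A}"
      using openin_continuous_map_preimage[OF continuous_map_product_projection,
          of i UNIV "\<lambda>_. discrete_topology (UNIV :: 'a set)" A]
      by (simp add: config_topology_def)
    then show ?thesis unfolding config_borel_def by (simp add: sets_measure_of)
  qed
  then have "sets ?P \<subseteq> sets (config_borel :: 'a config measure)"
    unfolding sets_PiM_single
    using sets.top[of "config_borel :: 'a config measure"]
    by (intro sets.sigma_sets_subset'[where M = config_borel, simplified])
       (auto simp: PiE_def)
  with 1 P show ?thesis by simp
qed

lemma bernoulli_measure_in_prob_measures: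
  "bernoulli_measure \<beta> \<in> (prob_measures :: 'a::finite config measure set)"
  by (simp add: prob_measures_def prob_space_bernoulli_measure sets_bernoulli_measure)

lemma push_in_prob_measures:
  assumes "continuous_map config_topology config_topology G" "\<mu> \<in> prob_measures"
  shows "push G \<mu> \<in> prob_measures"
proof -
  have "G \<in> measurable config_borel config_borel"
    unfolding config_borel_def
  proof (rule measurable_sigma_sets)
    show "sets (sigma UNIV {U. openin config_topology U})
        = sigma_sets UNIV {U. openin config_topology U}"
      by (simp add: sets_measure_of)
    fix U :: "'a config set" assume "U \<in> {U. openin config_topology U}"
    then have "openin config_topology (G -` U)"
      using openin_continuous_map_preimage[OF assms(1), of U] by (simp add: vimage_def)
    then show "G -` U \<inter> space (sigma UNIV {U. openin config_topology U})
        \<in> sets (sigma UNIV {U. openin config_topology U})"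
      by (simp add: space_measure_of_conv sets_measure_of)
  qed (auto simp: space_measure_of_conv)
  then have "G \<in> measurable \<mu> config_borel"
    using assms(2) by (simp add: prob_measures_def cong: measurable_cong_sets)
  then show ?thesis
    using assms(2) by (auto simp: prob_measures_def push_def intro: prob_space.prob_space_distr)
qed

lemma unit_power_near_one:
  fixes z :: complex
  assumes "\<And>n. norm (z ^ n - 1) < 1/2"
  shows "z = 1"
proof (rule ccontr)
  assume "z \<noteq> 1"
  have grow: "(3/2) ^ n * norm (z - 1) \<le> norm (z ^ (2 ^ n) - 1)" for n
  proof (induction n)
    case (Suc n)
    let ?w = "z ^ (2 ^ n)"
    have "z ^ (2 ^ Suc n) - 1 = (?w + 1) * (?w - 1)"
      by (simp add: power_mult power2_eq_square algebra_simps flip: power_mult_distrib)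
    then have eq: "norm (z ^ (2 ^ Suc n) - 1) = norm (?w + 1) * norm (?w - 1)"
      by (simp add: norm_mult)
    have "norm (2::complex) \<le> norm (?w + 1) + norm (?w - 1)"
      using norm_triangle_ineq4[of "?w + 1" "?w - 1"] by simp
    then have "3/2 \<le> norm (?w + 1)" using assms[of "2 ^ n"] by simp
    then have "3/2 * ((3/2) ^ n * norm (z - 1)) \<le> norm (?w + 1) * norm (?w - 1)"
      by (intro mult_mono Suc.IH) auto
    then show ?case unfolding eq by simp
  qed simp
  obtain n where "1 / norm (z - 1) < (3/2::real) ^ n"
    using real_arch_pow[of "3/2" "1 / norm (z - 1)"] by auto
  then have "1 < (3/2) ^ n * norm (z - 1)"
    using \<open>z \<noteq> 1\<close> by (simp add: field_simps)
  then show False using grow[of n] assms[of "2 ^ n"] by linarith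
qed

lemma character_zero:
  assumes "character \<xi>" shows "\<xi> 0 = 1"
proof -
  have "\<xi> (0 + 0) = \<xi> 0 * \<xi> 0" "norm (\<xi> 0) = 1"
    using assms unfolding character_def by blast+
  then show ?thesis by auto
qed

lemma single_zero: "single k 0 = 0"
  by (auto simp: single_def fun_eq_iff)

lemma character_restrict:
  fixes \<xi> :: "'a::ab_group_add config \<Rightarrow> complex"
  assumes "character \<xi>"
  obtains K where "finite K" "\<And>x. (\<And>k. k \<in> K \<Longrightarrow> x k = 0) \<Longrightarrow> \<xi> x = 1"
proof -
  let ?U = "{x. \<xi> x \<in> ball 1 (1/2)}"
  have "openin config_topology ?U"
    using openin_continuous_map_preimage[of config_topology euclidean \<xi> "ball 1 (1/2)"] assms
    by (simp add: character_def)
  moreover have "0 \<in> ?U" using character_zero[OF assms] by simp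
  ultimately obtain X :: "int \<Rightarrow> 'a set" where X: "finite {i. X i \<noteq> UNIV}"
      "0 \<in> (\<Pi>\<^sub>E i\<in>UNIV. X i)" "(\<Pi>\<^sub>E i\<in>UNIV. X i) \<subseteq> ?U"
    unfolding config_topology_def openin_product_topology_alt by force
  show ?thesis
  proof (rule that[OF X(1)])
    fix x :: "'a config" assume x: "\<And>k. k \<in> {i. X i \<noteq> UNIV} \<Longrightarrow> x k = 0"
    have pw: "\<exists>y. (\<forall>k. x k = 0 \<longrightarrow> y k = 0) \<and> \<xi> y = \<xi> x ^ n" for n
    proof (induction n)
      case 0
      show ?case by (metis character_zero[OF assms] power_0 zero_fun_apply)
    next
      case (Suc n)
      then obtain y where "\<forall>k. x k = 0 \<longrightarrow> y k = 0" "\<xi> y = \<xi> x ^ n" by blast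
      then have "(\<forall>k. x k = 0 \<longrightarrow> (x + y) k = 0) \<and> \<xi> (x + y) = \<xi> x ^ Suc n"
        using assms by (simp add: character_def)
      then show ?case by blast
    qed
    show "\<xi> x = 1"
    proof (rule unit_power_near_one)
      fix n
      obtain y where y: "\<forall>k. x k = 0 \<longrightarrow> y k = 0" "\<xi> y = \<xi> x ^ n" using pw by blast
      have "y k \<in> X k" for k
      proof (cases "X k = UNIV")
        case False
        then have "y k = 0" using x y(1) by simp
        then show ?thesis using X(2) by (auto simp: PiE_iff)
      qed simp
      then have "y \<in> (\<Pi>\<^sub>E i\<in>UNIV. X i)" by (simp add: PiE_iff)
      then have "y \<in> ?U" using X(3) by blast
      then show "norm (\<xi> x ^ n - 1) < 1/2" by (simp add: y(2) dist_norm norm_minus_commute)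
    qed
  qed
qed

lemma character_finite_part:
  assumes "character \<xi>" "finite K"
  shows "\<xi> (\<lambda>i. if i \<in> K then x i else 0) = (\<Prod>k\<in>K. char_at \<xi> k (x k))"
  using assms(2)
proof (induction K rule: finite_induct)
  case empty
  have "(\<lambda>i. if i \<in> {} then x i else 0) = 0" by (simp add: fun_eq_iff)
  then show ?case by (simp only: character_zero[OF assms(1)] prod.empty)
next
  case (insert k K)
  have "(\<lambda>i. if i \<in> insert k K then x i else 0)
      = single k (x k) + (\<lambda>i. if i \<in> K then x i else 0)"
    using insert(2) by (auto simp: single_def fun_eq_iff)
  then show ?case using insert assms(1) by (simp add: character_def char_at_def)
qed

lemma finite_char_supp:
  assumes "character \<xi>" shows "finite (char_supp \<xi>)"
proof -
  obtain K where K: "finite K" "\<And>x. (\<And>k. k \<in> K \<Longrightarrow> x k = 0) \<Longrightarrow> \<xi> x = 1"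
    using character_restrict[OF assms] by blast
  have "char_supp \<xi> \<subseteq> K"
  proof
    fix k assume "k \<in> char_supp \<xi>"
    then obtain a where "\<xi> (single k a) \<noteq> 1"
      by (auto simp: char_supp_def char_at_def fun_eq_iff)
    then show "k \<in> K" using K(2)[of "single k a"] by (metis single_def)
  qed
  then show ?thesis using K(1) finite_subset by blast
qed

lemma character_eq_prod:
  assumes "character \<xi>"
  shows "\<xi> x = (\<Prod>k\<in>char_supp \<xi>. char_at \<xi> k (x k))"
proof -
  obtain K where K: "finite K" "\<And>x. (\<And>k. k \<in> K \<Longrightarrow> x k = 0) \<Longrightarrow> \<xi> x = 1"
    using character_restrict[OF assms] by blast
  define L where "L = K \<union> char_supp \<xi>"
  have L: "finite L" "char_supp \<xi> \<subseteq> L" "K \<subseteq> L"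
    using K(1) finite_char_supp[OF assms] by (auto simp: L_def)
  let ?y = "\<lambda>i. if i \<in> L then x i else 0" and ?z = "\<lambda>i. if i \<in> L then 0 else x i"
  have "x = ?y + ?z" by (auto simp: fun_eq_iff)
  then have "\<xi> x = \<xi> ?y * \<xi> ?z" using assms unfolding character_def by metis
  also have "\<xi> ?z = 1" using L(3) by (intro K(2)) auto
  also have "\<xi> ?y = (\<Prod>k\<in>L. char_at \<xi> k (x k))" by (rule character_finite_part[OF assms L(1)])
  also have "\<dots> = (\<Prod>k\<in>char_supp \<xi>. char_at \<xi> k (x k))"
    using L by (intro prod.mono_neutral_right) (auto simp: char_supp_def)
  finally show ?thesis by simp
qed

lemma char_at_character:
  assumes "character \<xi>"
  shows "norm (char_at \<xi> k a) = 1" "char_at \<xi> k (a + b) = char_at \<xi> k a * char_at \<xi> k b"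
proof -
  have "single k (a + b) = single k a + single k b" by (auto simp: single_def fun_eq_iff)
  then show "norm (char_at \<xi> k a) = 1" "char_at \<xi> k (a + b) = char_at \<xi> k a * char_at \<xi> k b"
    using assms by (simp_all add: char_at_def character_def)
qed

lemma character_factors_unique:
  fixes \<psi> :: "int \<Rightarrow> 'a::ab_group_add \<Rightarrow> complex"
  assumes "finite {k. \<psi> k \<noteq> (\<lambda>_. 1)}"
    and "\<And>k a. norm (\<psi> k a) = 1" "\<And>k a b. \<psi> k (a + b) = \<psi> k a * \<psi> k b"
    and "\<And>x. \<xi> x = (\<Prod>k\<in>{k. \<psi> k \<noteq> (\<lambda>_. 1)}. \<psi> k (x k))"
  shows "\<psi> = char_at \<xi>"
proof (intro ext)
  fix k a
  let ?S = "{k. \<psi> k \<noteq> (\<lambda>_. 1)}"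
  have zero: "\<psi> j 0 = 1" for j
    using assms(2)[of j 0] assms(3)[of j 0 0] by auto
  have "char_at \<xi> k a = (\<Prod>j\<in>?S. \<psi> j (single k a j))" by (simp add: char_at_def assms(4))
  also have "\<dots> = (\<Prod>j\<in>insert k ?S. \<psi> j (single k a j))"
    using assms(1) by (intro prod.mono_neutral_left) auto
  also have "\<dots> = (\<Prod>j\<in>{k}. \<psi> j (single k a j))"
    using assms(1) by (intro prod.mono_neutral_right) (auto simp: single_def zero)
  also have "\<dots> = \<psi> k a" by (simp add: single_def)
  finally show "\<psi> k a = char_at \<xi> k a" by simp
qed

end

theory Submission
  imports Defs
begin

text \<open>
  If the rank of \<open>F\<^sup>t c\<close> is at most \<open>k\<close> for a set of times \<open>t\<close> of positive upper density, then at
  such a time the support splits, at one of boundedly many length scales \<open>R\<close>, into clusters of radius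
  \<open>R\<close> that are so far apart that they evolve independently for a time much longer than the number of
  configurations of radius \<open>R\<close>. Along times with the same scale and the same number of clusters
  (again of positive upper density) every cluster remains a single cluster, so by the pigeonhole
  principle some cluster reappears translated: it is a soliton. Hence the absence of solitons implies
  diffusion in density. The argument only uses locality and quiescence, so it applies as well to the
  dual system \<open>\<chi> \<mapsto> \<chi> \<circ> F\<close> on characters.

  A soliton yields a nonzero finite configuration in the kernel of \<open>G = F\<^sup>q - \<sigma>\<^sup>s\<close> or of
  \<open>G = F\<^sup>q\<close>, and a soliton of the dual system yields a nontrivial character that is trivial on the
  range of such a \<open>G\<close>. By the Garden of Eden theorem \<open>G\<close> is injective on finite configurations iff it
  is surjective, so \<open>F\<close> has a soliton iff its dual has one. If there is none, then the rank of
  \<open>\<chi> \<circ> F\<^sup>t\<close> tends to infinity in density for all nontrivial \<open>\<chi>\<close>, and the Fourier coefficients of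
  harmonically mixing measures tend to \<open>0\<close>. If there is one, then for some nontrivial \<open>\<chi>\<close> the
  coefficients \<open>\<mu>[\<chi> \<circ> F\<^sup>t]\<close> of a strongly nonuniform Bernoulli measure \<open>\<mu>\<close> take finitely many
  nonzero values, which excludes the uniform measure as an accumulation point.
\<close>

subsection \<open>Densities of sets of times\<close>

definition translate :: "int \<Rightarrow> 'a config \<Rightarrow> 'a config" where
  "translate s x = (\<lambda>i. x (i + s))"

definition restr :: "int set \<Rightarrow> 'a::zero config \<Rightarrow> 'a config" where
  "restr I x = (\<lambda>i. if i \<in> I then x i else 0)"

text \<open>The count over the \<open>n + 1\<close> times up to \<open>n\<close> is divided by
  \<open>n\<close>, to match \<open>lower_density\<close>; the limit is the same.\<close>

definition zero_density :: "nat set \<Rightarrow> bool" where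
  "zero_density Z \<longleftrightarrow> (\<lambda>n. real (card (Z \<inter> {..n})) / real n) \<longlonglongrightarrow> 0"

abbreviation iball :: "int \<Rightarrow> nat \<Rightarrow> int set" where
  "iball p R \<equiv> {p - int R..p + int R}"

lemma supp_restr: "supp (restr I x) = supp x \<inter> I"
  by (auto simp: supp_def restr_def)

lemma supp_empty_iff: "supp x = {} \<longleftrightarrow> x = 0"
  by (auto simp: supp_def fun_eq_iff)

lemma translate_translate [simp]: "translate a (translate b x) = translate (a + b) x"
  by (simp add: translate_def algebra_simps)

lemma translate_0 [simp]: "translate 0 x = x"
  by (simp add: translate_def)

lemma supp_translate: "supp (translate s x) = (\<lambda>i. i - s) ` supp x"
proof -
  have "i \<in> (\<lambda>i. i - s) ` supp x" if "x (i + s) \<noteq> 0" for i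
    using that by (intro image_eqI[of _ _ "i + s"]) (auto simp: supp_def)
  then show ?thesis by (auto simp: supp_def translate_def)
qed

lemma zero_density_subset:
  assumes "zero_density Z" "Y \<subseteq> Z"
  shows "zero_density Y"
  unfolding zero_density_def
proof (rule tendsto_sandwich[OF _ _ tendsto_const assms(1)[unfolded zero_density_def]])
  show "\<forall>\<^sub>F n in sequentially. real (card (Y \<inter> {..n})) / real n \<le> real (card (Z \<inter> {..n})) / real n"
    using assms(2) by (intro always_eventually allI divide_right_mono of_nat_mono card_mono) auto
qed (auto intro!: always_eventually)

lemma zero_density_Un:
  assumes "zero_density Y" "zero_density Z"
  shows "zero_density (Y \<union> Z)"
proof -
  have lim: "(\<lambda>n. real (card (Y \<inter> {..n})) / real n + real (card (Z \<inter> {..n})) / real n) \<longlonglongrightarrow> 0"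
    using tendsto_add[OF assms[unfolded zero_density_def]] by simp
  have "real (card ((Y \<union> Z) \<inter> {..n})) / real n
      \<le> real (card (Y \<inter> {..n})) / real n + real (card (Z \<inter> {..n})) / real n" for n
  proof -
    have "card ((Y \<union> Z) \<inter> {..n}) \<le> card (Y \<inter> {..n}) + card (Z \<inter> {..n})"
      unfolding Int_Un_distrib2 by (rule card_Un_le)
    then show ?thesis by (simp flip: add_divide_distrib of_nat_add add: divide_right_mono)
  qed
  then show ?thesis
    unfolding zero_density_def
    by (intro tendsto_sandwich[OF _ _ tendsto_const lim]) (auto intro!: always_eventually)
qed

lemma zero_density_finite:
  assumes "finite Z"
  shows "zero_density Z"
  unfolding zero_density_def
proof (rule tendsto_sandwich[OF _ _ tendsto_const lim_const_over_n])
  show "\<forall>\<^sub>F n in sequentially. real (card (Z \<inter> {..n})) / real n \<le> real (card Z) / real n"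
    using assms by (intro always_eventually allI divide_right_mono of_nat_mono card_mono) auto
qed (auto intro!: always_eventually)

lemma zero_density_UN_atMost:
  assumes "\<And>m. zero_density (B m)"
  shows "zero_density (\<Union>l\<le>m::nat. B l)"
proof (induction m)
  case (Suc m)
  then show ?case using zero_density_Un[OF assms[of "Suc m"]] by (simp add: atMost_Suc)
qed (simp add: assms)

lemma lower_density_Compl:
  assumes "zero_density Z"
  shows "lower_density (- Z) = 1"
proof -
  have "real (card {i \<in> - Z. i \<le> n}) / real n
      = real (Suc n) / real n - real (card (Z \<inter> {..n})) / real n" for n
  proof -
    have "{i \<in> - Z. i \<le> n} = {..n} - (Z \<inter> {..n})" by auto
    then have "card {i \<in> - Z. i \<le> n} = Suc n - card (Z \<inter> {..n})"
      by (simp add: card_Diff_subset)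
    moreover have "card (Z \<inter> {..n}) \<le> Suc n" using card_mono[of "{..n}" "Z \<inter> {..n}"] by simp
    ultimately show ?thesis by (simp add: diff_divide_distrib of_nat_diff)
  qed
  moreover have "(\<lambda>n. real (Suc n) / real n - real (card (Z \<inter> {..n})) / real n) \<longlonglongrightarrow> 1 - 0"
    using assms unfolding zero_density_def
    by (intro tendsto_diff LIMSEQ_Suc_n_over_n)
  ultimately have "(\<lambda>n. ereal (real (card {i \<in> - Z. i \<le> n}) / real n)) \<longlonglongrightarrow> ereal 1"
    by (simp add: tendsto_ereal)
  then show ?thesis
    unfolding lower_density_def by (simp add: lim_imp_Liminf one_ereal_def)
qed

lemma not_zero_densityE:
  assumes "\<not> zero_density Z"
  obtains \<delta> where "\<delta> > 0" "\<And>N. \<exists>n\<ge>N. \<delta> * real n < real (card (Z \<inter> {..n}))"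
proof -
  obtain \<delta> where \<delta>: "\<delta> > 0" "\<And>N. \<exists>n\<ge>N. \<delta> \<le> real (card (Z \<inter> {..n})) / real n"
    using assms unfolding zero_density_def lim_sequentially by (auto simp: not_less)
  show ?thesis
  \<comment> \<open>Halving makes the inequality strict, which requires \<open>n > 0\<close>; hence
    the bound \<open>Suc N\<close> below.\<close>
  proof (rule that[of "\<delta>/2"])
    fix N
    obtain n where n: "n \<ge> Suc N" "\<delta> \<le> real (card (Z \<inter> {..n})) / real n" using \<delta>(2) by blast
    then have "\<delta> * real n \<le> real (card (Z \<inter> {..n}))" by (simp add: field_simps)
    moreover have "\<delta>/2 * real n < \<delta> * real n" using \<delta>(1) n(1) by simp
    ultimately show "\<exists>n\<ge>N. \<delta>/2 * real n < real (card (Z \<inter> {..n}))" using n(1)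
      by (intro exI[of _ n]) linarith
  qed (use \<delta> in auto)
qed

text \<open>A diagonal argument for countably many conditions, each failing only with density zero.
  The failure sets are accumulated into an increasing sequence \<open>C m\<close>, and
  \<open>C m\<close> is discarded only from a time \<open>N m\<close> on, after which its frequency
  stays below \<open>1 / (m + 1)\<close>.\<close>

lemma density_one_diagonal:
  fixes P :: "nat \<Rightarrow> nat \<Rightarrow> bool"
  assumes "\<And>m. zero_density {t. \<not> P m t}"
  obtains \<phi> :: "nat \<Rightarrow> nat" where "strict_mono \<phi>" "lower_density (range \<phi>) = 1"
    "\<And>m. \<forall>\<^sub>F t in sequentially. P m (\<phi> t)"
proof -
  define C where "C m = (\<Union>l\<le>m. {t. \<not> P l t})" for m
  have C: "zero_density (C m)" for m
    unfolding C_def by (rule zero_density_UN_atMost) (rule assms)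
  have "\<forall>m. \<exists>N>0. \<forall>n\<ge>N. real (card (C m \<inter> {..n})) / real n < 1 / real (Suc m)"
  proof
    fix m
    have "\<forall>\<^sub>F n in sequentially. real (card (C m \<inter> {..n})) / real n < 1 / real (Suc m)"
      using C[of m] unfolding zero_density_def by (rule order_tendstoD) simp
    then obtain N where "\<forall>n\<ge>N. real (card (C m \<inter> {..n})) / real n < 1 / real (Suc m)"
      unfolding eventually_sequentially by blast
    then show "\<exists>N>0. \<forall>n\<ge>N. real (card (C m \<inter> {..n})) / real n < 1 / real (Suc m)"
      by (intro exI[of _ "Suc N"]) auto
  qed
  then obtain N where N: "\<And>m n. N m \<le> n \<Longrightarrow> real (card (C m \<inter> {..n})) / real n < 1 / real (Suc m)"
    by metis
  \<comment> \<open>The clause \<open>m \<le> t\<close> leaves finitely many active indices at each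
    time, so that a largest one exists.\<close>
  define Z where "Z = {t. \<exists>m\<le>t. N m \<le> t \<and> t \<in> C m}"
  have Z: "zero_density Z"
    unfolding zero_density_def
  proof (rule LIMSEQ_I)
    fix e :: real assume "e > 0"
    then obtain M where M: "1 / real (Suc M) < e" using nat_approx_posE by blast
    have "norm (real (card (Z \<inter> {..n})) / real n - 0) < e" if n: "n \<ge> max M (N M)" for n
    proof -
      \<comment> \<open>\<open>m\<close> is the largest index active by time \<open>n\<close>. As
        the sets \<open>C m\<close> increase, \<open>C m\<close> contains everything discarded up to
        \<open>n\<close>.\<close>
      define m where "m = Max {m. m \<le> n \<and> N m \<le> n}"
      have fin: "finite {m. m \<le> n \<and> N m \<le> n}" by simp
      have "M \<in> {m. m \<le> n \<and> N m \<le> n}" using n by simp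
      then have m: "m \<in> {m. m \<le> n \<and> N m \<le> n}" "M \<le> m"
        unfolding m_def using Max_in[OF fin] Max_ge[OF fin] by blast+
      have "Z \<inter> {..n} \<subseteq> C m \<inter> {..n}"
      proof
        fix t assume "t \<in> Z \<inter> {..n}"
        then obtain m' where m': "m' \<le> t" "N m' \<le> t" "t \<in> C m'" "t \<le> n" by (auto simp: Z_def)
        then have "m' \<le> m" unfolding m_def using Max_ge[OF fin, of m'] by simp
        then show "t \<in> C m \<inter> {..n}" using m' unfolding C_def by fastforce
      qed
      then have "real (card (Z \<inter> {..n})) / real n \<le> real (card (C m \<inter> {..n})) / real n"
        by (intro divide_right_mono of_nat_mono card_mono) auto
      also have "\<dots> < 1 / real (Suc m)" using N m(1) by simp
      also have "\<dots> \<le> 1 / real (Suc M)" using m(2) by (simp add: frac_le)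
      finally show ?thesis using M by simp
    qed
    then show "\<exists>n0. \<forall>n\<ge>n0. norm (real (card (Z \<inter> {..n})) / real n - 0) < e" by blast
  qed
  have inf: "infinite (- Z)"
  proof
    assume "finite (- Z)"
    then have "zero_density (- Z)" by (rule zero_density_finite)
    from lower_density_Compl[OF zero_density_Un[OF Z this]] show False
      by (simp add: lower_density_def Liminf_const one_ereal_def zero_ereal_def)
  qed
  show ?thesis
  proof (rule that[of "enumerate (- Z)"])
    show "strict_mono (enumerate (- Z))" using inf by (rule strict_mono_enumerate)
    then have le: "t \<le> enumerate (- Z) t" for t by (rule strict_mono_imp_increasing)
    show "lower_density (range (enumerate (- Z))) = 1"
      using inf lower_density_Compl[OF Z] by (simp add: range_enumerate)
    fix m
    show "\<forall>\<^sub>F t in sequentially. P m (enumerate (- Z) t)"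
    proof (rule eventually_sequentiallyI[of "max m (N m)"])
      fix t assume "max m (N m) \<le> t"
      moreover have "enumerate (- Z) t \<in> - Z" using inf by (rule enumerate_in_set)
      ultimately show "P m (enumerate (- Z) t)" using le[of t]
        unfolding Z_def C_def by (auto dest!: spec[of _ m])
    qed
  qed
qed

subsection \<open>Isolated clusters\<close>

lemma translate_eq_iff: "translate a x = translate b y \<longleftrightarrow> x = translate (b - a) y"
proof
  assume "translate a x = translate b y"
  then have "translate (- a) (translate a x) = translate (- a) (translate b y)" by simp
  then show "x = translate (b - a) y" by simp
qed simp

lemma funpow_diff_apply:
  assumes "m \<le> n"
  shows "(f ^^ (n - m)) ((f ^^ m) x) = (f ^^ n) x"
  using assms by (metis comp_apply funpow_add le_add_diff_inverse2)

lemma finite_configs_bounded: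
  assumes "finite W" "finite B"
  shows "finite {z :: 'b::zero config. supp z \<subseteq> W \<and> (\<forall>i. z i \<in> B)}"
proof (rule finite_subset)
  show "finite {z. \<forall>i. (i \<in> W \<longrightarrow> z i \<in> B) \<and> (i \<notin> W \<longrightarrow> z i = (0::'b))}"
    by (rule finite_set_of_finite_funs[OF assms])
qed (auto simp: supp_def)

section \<open>Covering a finite set by few well separated balls\<close>

text \<open>Two centres at distance at most \<open>sep R\<close> are merged by dropping one of them
  and enlarging the radius to \<open>R + sep R\<close>. These are the radii that successive merges
  produce from radius 0.\<close>

primrec scale :: "(nat \<Rightarrow> nat) \<Rightarrow> nat \<Rightarrow> nat" where
  "scale sep 0 = 0"
| "scale sep (Suc j) = scale sep j + sep (scale sep j)"

text \<open>Either the centres are already separated or two of them can be merged. Each merge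
  advances the scale by one and loses a centre, so there are at most \<open>card P\<close>
  merges.\<close>

lemma separated_cover_aux:
  fixes P :: "int set"
  assumes "finite P" "P \<noteq> {}" "X \<subseteq> (\<Union>p\<in>P. iball p (scale sep j))"
  shows "\<exists>j'\<le>j + card P. \<exists>P'. P' \<subseteq> P \<and> P' \<noteq> {} \<and> card P' \<le> card P \<and>
    X \<subseteq> (\<Union>p\<in>P'. iball p (scale sep j')) \<and>
    (\<forall>p\<in>P'. \<forall>q\<in>P'. p \<noteq> q \<longrightarrow> int (sep (scale sep j')) < \<bar>p - q\<bar>)"
  using assms
proof (induction "card P" arbitrary: P j rule: less_induct)
  case less
  show ?case
  proof (cases "\<forall>p\<in>P. \<forall>q\<in>P. p \<noteq> q \<longrightarrow> int (sep (scale sep j)) < \<bar>p - q\<bar>")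
    case True
    then show ?thesis using less.prems by (intro exI[of _ j] conjI exI[of _ P]) auto
  next
    case False
    then obtain p q where pq: "p \<in> P" "q \<in> P" "p \<noteq> q" "\<bar>p - q\<bar> \<le> int (sep (scale sep j))"
      by (auto simp: not_less)
    let ?P = "P - {q}"
    have c: "card P = Suc (card ?P)" using pq(2) less.prems(1) by (metis card_Suc_Diff1)
    have "X \<subseteq> (\<Union>p\<in>?P. iball p (scale sep (Suc j)))"
    proof
      fix i assume "i \<in> X"
      then obtain u where u: "u \<in> P" "i \<in> iball u (scale sep j)" using less.prems(3) by blast
      show "i \<in> (\<Union>p\<in>?P. iball p (scale sep (Suc j)))"
      proof (cases "u = q")
        case True
        then have "i \<in> iball p (scale sep (Suc j))" using u pq(4) by auto
        then show ?thesis using pq by blast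
      next
        case False
        then have "u \<in> ?P" "i \<in> iball u (scale sep (Suc j))" using u by auto
        then show ?thesis by blast
      qed
    qed
    moreover have "?P \<noteq> {}" "finite ?P" using pq less.prems(1) by auto
    ultimately obtain j' P' where "j' \<le> Suc j + card ?P" "P' \<subseteq> ?P" "P' \<noteq> {}" "card P' \<le> card ?P"
      "X \<subseteq> (\<Union>p\<in>P'. iball p (scale sep j'))"
      "\<forall>p\<in>P'. \<forall>q\<in>P'. p \<noteq> q \<longrightarrow> int (sep (scale sep j')) < \<bar>p - q\<bar>"
      using less.hyps[of ?P "Suc j"] c by auto
    then show ?thesis using c by (intro exI[of _ j'] conjI exI[of _ P']) auto
  qed
qed

text \<open>Starting with every point of \<open>X\<close> as a ball of radius 0, the radius at the
  end is one of \<open>k + 1\<close> values that do not depend on \<open>X\<close>. This makes the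
  pigeonhole principle over times applicable.\<close>

lemma separated_cover:
  fixes X :: "int set"
  assumes "finite X" "X \<noteq> {}" "card X \<le> k"
  shows "\<exists>j P. j \<le> k \<and> P \<subseteq> X \<and> P \<noteq> {} \<and> card P \<le> k \<and>
    X \<subseteq> (\<Union>p\<in>P. iball p (scale sep j)) \<and>
    (\<forall>p\<in>P. \<forall>q\<in>P. p \<noteq> q \<longrightarrow> int (sep (scale sep j)) < \<bar>p - q\<bar>)"
proof -
  have "X \<subseteq> (\<Union>p\<in>X. iball p (scale sep 0))" by auto
  from separated_cover_aux[OF assms(1,2) this] obtain j P where
    "j \<le> card X" "P \<subseteq> X" "P \<noteq> {}" "card P \<le> card X" "X \<subseteq> (\<Union>p\<in>P. iball p (scale sep j))"
    "\<forall>p\<in>P. \<forall>q\<in>P. p \<noteq> q \<longrightarrow> int (sep (scale sep j)) < \<bar>p - q\<bar>"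
    by (auto simp only: add_0)
  then show ?thesis using assms(3) by (intro exI[of _ j] exI[of _ P]) simp
qed

section \<open>Local dynamics and isolated clusters\<close>

text \<open>This covers both finite configurations and encoded characters. The latter have values in
  an infinite type and form a proper subset of all configurations, so the axioms concern only a set
  \<open>M\<close>, whose elements take values in a common finite set. Closure under
  \<open>restr\<close> allows clusters to be cut out.\<close>

locale local_system =
  fixes F :: "'b::zero config \<Rightarrow> 'b config" and M :: "'b config set" and r :: nat
  assumes closed: "x \<in> M \<Longrightarrow> F x \<in> M"
    and finite_supp: "x \<in> M \<Longrightarrow> finite (supp x)"
    and restr: "x \<in> M \<Longrightarrow> restr I x \<in> M"
    and local: "\<lbrakk>x \<in> M; y \<in> M; \<And>j. j \<in> iball i r \<Longrightarrow> x j = y j\<rbrakk> \<Longrightarrow> F x i = F y i"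
    and map_0: "F 0 = 0"
    and finite_values: "\<exists>B. finite B \<and> (\<forall>x\<in>M. \<forall>i. x i \<in> B)"
begin

lemma iter_closed: "x \<in> M \<Longrightarrow> (F ^^ n) x \<in> M"
  by (induction n) (auto intro: closed)

lemma iter_0: "(F ^^ n) 0 = 0"
  by (induction n) (simp_all only: funpow.simps id_apply comp_apply map_0)

lemma iter_local:
  assumes "x \<in> M" "y \<in> M" "\<And>j. j \<in> iball i (r * n) \<Longrightarrow> x j = y j"
  shows "(F ^^ n) x i = (F ^^ n) y i"
  using assms(3)
proof (induction n arbitrary: i)
  case (Suc n)
  have "F ((F ^^ n) x) i = F ((F ^^ n) y) i"
  proof (rule local)
    fix j assume j: "j \<in> iball i r"
    show "(F ^^ n) x j = (F ^^ n) y j"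
    proof (rule Suc.IH)
      fix l assume "l \<in> iball j (r * n)"
      then show "x l = y l" using j by (intro Suc.prems) (auto simp: algebra_simps)
    qed
  qed (use assms iter_closed in auto)
  then show ?case by simp
qed simp

text \<open>A light cone estimate: within \<open>h\<close> steps, a cell at distance at most
  \<open>R + r * h\<close> from \<open>p\<close> sees only cells at distance at most
  \<open>R + 2 * r * h\<close>, and the separation keeps the other balls of radius \<open>R\<close>
  out of that range.\<close>

lemma iter_piece_inside:
  assumes x: "x \<in> M" "supp x \<subseteq> (\<Union>p\<in>P. iball p R)" and p: "p \<in> P"
    and sep: "\<And>q. q \<in> P \<Longrightarrow> q \<noteq> p \<Longrightarrow> int (2 * R + 2 * (r * h)) < \<bar>p - q\<bar>"
    and i: "i \<in> iball p (R + r * h)"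
  shows "(F ^^ h) (restr (iball p R) x) i = (F ^^ h) x i"
proof (rule iter_local)
  fix j assume j: "j \<in> iball i (r * h)"
  show "restr (iball p R) x j = x j"
  proof (cases "j \<in> iball p R")
    case False
    have "x j = 0"
    proof (rule ccontr)
      assume "x j \<noteq> 0"
      then obtain q where q: "q \<in> P" "j \<in> iball q R" using x(2) by (auto simp: supp_def)
      then have "q \<noteq> p" using False by blast
      from sep[OF q(1) this] show False using q(2) i j by auto
    qed
    then show ?thesis using False by (simp add: restr_def)
  qed (simp add: restr_def)
qed (use x restr in auto)

lemma supp_iter_piece:
  assumes "x \<in> M"
  shows "supp ((F ^^ h) (restr (iball p R) x)) \<subseteq> iball p (R + r * h)"
proof
  fix i assume i: "i \<in> supp ((F ^^ h) (restr (iball p R) x))"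
  show "i \<in> iball p (R + r * h)"
  proof (rule ccontr)
    assume n: "i \<notin> iball p (R + r * h)"
    \<comment> \<open>Locality compares only elements of \<open>M\<close>, so \<open>0\<close> has
      to be exhibited as one.\<close>
    have "restr {} x = 0" by (simp add: restr_def fun_eq_iff)
    then have "0 \<in> M" using restr[OF assms] by metis
    then have "(F ^^ h) (restr (iball p R) x) i = (F ^^ h) 0 i"
      using n by (intro iter_local restr assms) (auto simp: restr_def)
    then show False using i by (simp add: iter_0 supp_def)
  qed
qed

text \<open>
  Far apart clusters evolve independently and never die, so if the number of clusters does not grow
  then each of them is still a single cluster.
\<close>

lemma cluster_remains_cluster:
  assumes x: "x \<in> M" "supp x \<subseteq> (\<Union>p\<in>P. iball p R)" and P: "finite P" "p \<in> P"
    and sep: "\<And>p q. p \<in> P \<Longrightarrow> q \<in> P \<Longrightarrow> p \<noteq> q \<Longrightarrow> int (4 * R + 2 * (r * h)) < \<bar>p - q\<bar>"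
    and nz: "\<And>p. p \<in> P \<Longrightarrow> (F ^^ h) (restr (iball p R) x) \<noteq> 0"
    and P': "finite P'" "card P' \<le> card P" "supp ((F ^^ h) x) \<subseteq> (\<Union>p\<in>P'. iball p R)"
  shows "\<exists>p'. supp ((F ^^ h) (restr (iball p R) x)) \<subseteq> iball p' R"
proof -
  let ?g = "\<lambda>p. (F ^^ h) (restr (iball p R) x)"
  have near: "supp (?g p) \<subseteq> iball p (R + r * h)" for p by (rule supp_iter_piece[OF x(1)])
  have sub: "supp (?g p) \<subseteq> supp ((F ^^ h) x)" if "p \<in> P" for p
  proof
    fix i assume i: "i \<in> supp (?g p)"
    have "?g p i = (F ^^ h) x i"
    proof (rule iter_piece_inside[OF x that])
      fix q assume "q \<in> P" "q \<noteq> p"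
      then show "int (2 * R + 2 * (r * h)) < \<bar>p - q\<bar>" using sep[OF that, of q] by auto
    qed (use near i in blast)
    then show "i \<in> supp ((F ^^ h) x)" using i by (simp add: supp_def)
  qed
  have "\<forall>p\<in>P. \<exists>i. i \<in> supp (?g p)"
    using nz by (metis ex_in_conv supp_empty_iff)
  then obtain X where X: "\<And>p. p \<in> P \<Longrightarrow> X p \<in> supp (?g p)" by metis
  have "\<forall>p\<in>P. \<exists>p'\<in>P'. X p \<in> iball p' R" using X sub P'(3) by blast
  then obtain f where f: "\<And>p. p \<in> P \<Longrightarrow> f p \<in> P'" "\<And>p. p \<in> P \<Longrightarrow> X p \<in> iball (f p) R" by metis
  \<comment> \<open>Both \<open>i\<close> and \<open>X q\<close> lie in the ball around
    \<open>f q\<close>, hence within \<open>2 * R\<close> of each other, and each lies within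
    \<open>R + r * h\<close> of its own centre. This would give
    \<open>\<bar>p - q\<bar> \<le> 4 * R + 2 * (r * h)\<close>.\<close>
  have far: False if "p \<in> P" "q \<in> P" "p \<noteq> q" "i \<in> supp (?g p)" "i \<in> iball (f q) R" for p q i
  proof -
    have "i \<in> iball p (R + r * h)" "X q \<in> iball q (R + r * h)" using near that X by blast+
    then show False using sep[OF that(1-3)] that(5) f(2)[OF that(2)] by auto
  qed
  \<comment> \<open>Distinct clusters use distinct balls of \<open>P'\<close>. As \<open>P'\<close>
    has no more balls than \<open>P\<close>, every ball of \<open>P'\<close> belongs to exactly one
    cluster.\<close>
  have "inj_on f P"
    using far X f(2) by (intro inj_onI) (metis (no_types, lifting))
  then have "f ` P = P'"
    using f(1) P' by (intro card_seteq) (auto simp: card_image)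
  have "supp (?g p) \<subseteq> iball (f p) R"
  proof
    fix i assume i: "i \<in> supp (?g p)"
    then obtain q where "q \<in> P" "i \<in> iball (f q) R"
      using sub[OF P(2)] P'(3) \<open>f ` P = P'\<close> by blast
    then show "i \<in> iball (f p) R" using far[OF P(2) _ _ i] by metis
  qed
  then show ?thesis by blast
qed

text \<open>The conclusion is a recurrence instead of a soliton because a recurrence is an equation,
  and as such it can be carried over from the dual system to configurations.\<close>

theorem low_rank_recurrence:
  assumes x: "x \<in> M" "x \<noteq> 0" and low: "\<not> zero_density {t. config_rank ((F ^^ t) x) \<le> k}"
  shows "\<exists>y\<in>M. y \<noteq> 0 \<and> (\<exists>q>0. (F ^^ q) y = 0 \<or> (\<exists>s. (F ^^ q) y = translate s y))"
proof (cases "\<exists>y\<in>M. y \<noteq> 0 \<and> (\<exists>q>0. (F ^^ q) y = 0)")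
  case False
  have nz: "(F ^^ q) y \<noteq> 0" if "y \<in> M" "y \<noteq> 0" for y q
    using that False by (cases "q = 0") (simp, blast)
  define S where "S = {t. config_rank ((F ^^ t) x) \<le> k}"
  obtain \<delta> where \<delta>: "\<delta> > 0" "\<And>N. \<exists>n\<ge>N. \<delta> * real n < real (card (S \<inter> {..n}))"
    using not_zero_densityE[OF low] unfolding S_def by metis
  obtain B where B: "finite B" "\<And>x i. x \<in> M \<Longrightarrow> x i \<in> B" using finite_values by metis
  define Cf where "Cf R = {z. supp z \<subseteq> iball 0 R \<and> (\<forall>i. z i \<in> B)}" for R
  have finCf: "finite (Cf R)" for R
    unfolding Cf_def by (rule finite_configs_bounded) (use B in auto)
  \<comment> \<open>The number of pairs consisting of a scale index and a number of clusters, both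
    at most \<open>k\<close>.\<close>
  define K where "K = real ((k + 1) * (k + 1))"
  have "K > 0" unfolding K_def of_nat_0_less_iff by simp
  \<comment> \<open>A block length for which a proportion \<open>\<delta> / (2 * K)\<close> of the
    block is at least the number of patterns of radius \<open>R\<close>.\<close>
  define H where "H R = Suc (nat \<lceil>2 * K * real (card (Cf R)) / \<delta>\<rceil>)" for R
  have H: "2 * K * real (card (Cf R)) \<le> \<delta> * real (H R)" for R
  proof -
    have "2 * K * real (card (Cf R)) / \<delta> \<le> real (H R)" unfolding H_def by linarith
    then show ?thesis using \<delta>(1) by (simp add: field_simps)
  qed
  \<comment> \<open>The separation that \<open>cluster_remains_cluster\<close> asks for when up to
    \<open>H R\<close> steps elapse.\<close>
  define sep where "sep R = 4 * R + 2 * (r * H R)" for R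
  define good where "good t j P \<longleftrightarrow> j \<le> k \<and> P \<subseteq> supp ((F ^^ t) x) \<and> P \<noteq> {} \<and> card P \<le> k \<and>
    supp ((F ^^ t) x) \<subseteq> (\<Union>p\<in>P. iball p (scale sep j)) \<and>
    (\<forall>p\<in>P. \<forall>q\<in>P. p \<noteq> q \<longrightarrow> int (sep (scale sep j)) < \<bar>p - q\<bar>)" for t j P
  have "\<forall>t\<in>S. \<exists>j P. good t j P"
  proof
    fix t assume "t \<in> S"
    then show "\<exists>j P. good t j P"
      unfolding good_def using nz[OF x] finite_supp[OF iter_closed[OF x(1)]]
      by (intro separated_cover) (auto simp: S_def config_rank_def supp_empty_iff)
  qed
  then obtain j P where jP: "\<And>t. t \<in> S \<Longrightarrow> good t (j t) (P t)" by metis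
  \<comment> \<open>The radius is chosen only afterwards; summing over all scales ensures
    \<open>H R \<le> n\<close> whichever one it is.\<close>
  obtain n where n: "n \<ge> (\<Sum>i\<le>k. H (scale sep i))" "\<delta> * real n < real (card (S \<inter> {..n}))"
    using \<delta>(2) by blast
  \<comment> \<open>First pigeonhole: fix the scale and the number of clusters, at the cost of a
    factor \<open>K\<close>.\<close>
  have "\<exists>v\<in>{..k} \<times> {..k}. card (S \<inter> {..n})
      \<le> card ((\<lambda>t. (j t, card (P t))) -` {v} \<inter> (S \<inter> {..n})) * card ({..k} \<times> {..k})"
    by (rule pigeonhole_card) (use jP in \<open>auto simp: good_def\<close>)
  then obtain J c where Jc: "J \<le> k" "card (S \<inter> {..n})
      \<le> card ((\<lambda>t. (j t, card (P t))) -` {(J, c)} \<inter> (S \<inter> {..n})) * ((k + 1) * (k + 1))"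
    by auto
  define S' where "S' = (\<lambda>t. (j t, card (P t))) -` {(J, c)} \<inter> (S \<inter> {..n})"
  define R where "R = scale sep J"
  have HR: "0 < H R" by (simp add: H_def)
  have "H R \<le> (\<Sum>i\<le>k. H (scale sep i))"
    unfolding R_def using Jc(1) by (intro member_le_sum) auto
  then have HRn: "H R \<le> n" using n(1) by simp
  \<comment> \<open>Second pigeonhole: divide the times up to \<open>n\<close> into blocks of length
    \<open>H R\<close> and keep a block with many of the selected times.\<close>
  have "\<exists>b\<in>{..n div H R}. card S' \<le> card ((\<lambda>t. t div H R) -` {b} \<inter> S') * card {..n div H R}"
    by (rule pigeonhole_card) (auto simp: S'_def div_le_mono)
  then obtain b where b: "card S' \<le> card ((\<lambda>t. t div H R) -` {b} \<inter> S') * Suc (n div H R)" by auto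
  define U where "U = (\<lambda>t. t div H R) -` {b} \<inter> S'"
  have "real (n div H R) \<le> real n / real (H R)" by (rule of_nat_div_le_of_nat)
  moreover have "1 \<le> real n / real (H R)" using HR HRn by simp
  \<comment> \<open>The factor 2 pays for the incomplete last block.\<close>
  ultimately have blocks: "real (Suc (n div H R)) \<le> 2 * real n / real (H R)" by simp
  have "\<delta> * real n < real (card S') * K"
    using n(2) of_nat_mono[OF Jc(2), where 'a = real] unfolding S'_def K_def of_nat_mult by linarith
  also have "\<dots> \<le> real (card U) * real (Suc (n div H R)) * K"
    using of_nat_mono[OF b, where 'a = real] \<open>K > 0\<close> unfolding U_def of_nat_mult
    by (intro mult_right_mono) (assumption, simp)
  also have "\<dots> \<le> real (card U) * (2 * real n / real (H R)) * K"
    using blocks \<open>K > 0\<close> by (intro mult_right_mono mult_left_mono) auto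
  finally have "\<delta> * real (H R) < 2 * K * real (card U)"
    using HR HRn by (simp add: field_simps)
  then have "2 * K * real (card (Cf R)) < 2 * K * real (card U)" using H[of R] by linarith
  then have cardU: "card (Cf R) < card U" using \<open>K > 0\<close> by simp
  then have U: "finite U" "U \<noteq> {}" using card.infinite by force+
  \<comment> \<open>The configuration at the earliest selected time of the block is cut into
    clusters; the other selected times follow within \<open>H R\<close> steps.\<close>
  define t0 where "t0 = Min U"
  have t0: "t0 \<in> U" "\<And>t. t \<in> U \<Longrightarrow> t0 \<le> t" unfolding t0_def using U by auto
  have gU: "t \<in> S" "j t = J" "card (P t) = c" "t div H R = b" if "t \<in> U" for t
    using that by (auto simp: U_def S'_def)
  define x0 where "x0 = (F ^^ t0) x"
  have x0: "x0 \<in> M" unfolding x0_def by (rule iter_closed[OF x(1)])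
  have P0: "P t0 \<subseteq> supp x0" "P t0 \<noteq> {}" "supp x0 \<subseteq> (\<Union>p\<in>P t0. iball p R)"
    "\<And>p q. p \<in> P t0 \<Longrightarrow> q \<in> P t0 \<Longrightarrow> p \<noteq> q \<Longrightarrow> int (sep R) < \<bar>p - q\<bar>"
    using jP[OF gU(1)[OF t0(1)]] gU(2)[OF t0(1)] by (auto simp: good_def x0_def R_def)
  have finP0: "finite (P t0)" using P0(1) finite_supp[OF x0] by (rule finite_subset)
  define core where "core p = restr (iball p R) x0" for p
  have core: "core p \<in> M" "p \<in> P t0 \<Longrightarrow> core p \<noteq> 0" for p
  proof -
    show "core p \<in> M" unfolding core_def by (rule restr[OF x0])
    assume "p \<in> P t0"
    then have "p \<in> supp (core p)" using P0(1) by (auto simp: core_def supp_restr)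
    then show "core p \<noteq> 0" by (auto simp: supp_def)
  qed
  obtain p where p: "p \<in> P t0" using P0(2) by blast
  have "\<exists>p'. supp ((F ^^ (t - t0)) (core p)) \<subseteq> iball p' R" if t: "t \<in> U" for t
    unfolding core_def
  proof (rule cluster_remains_cluster[OF x0 P0(3) finP0 p])
    have "b * H R \<le> t0" "t < b * H R + H R"
      using gU(4)[OF t0(1)] gU(4)[OF t] HR dividend_less_div_times[of "H R" t]
        div_times_less_eq_dividend[of t0 "H R"] by auto
    then have h: "t - t0 \<le> H R" by simp
    fix p q assume "p \<in> P t0" "q \<in> P t0" "p \<noteq> q"
    then have "int (sep R) < \<bar>p - q\<bar>" by (rule P0(4))
    moreover have "4 * R + 2 * (r * (t - t0)) \<le> sep R" unfolding sep_def using h by simp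
    ultimately show "int (4 * R + 2 * (r * (t - t0))) < \<bar>p - q\<bar>" by linarith
  next
    fix p assume "p \<in> P t0"
    then show "(F ^^ (t - t0)) (restr (iball p R) x0) \<noteq> 0"
      using nz core unfolding core_def by blast
  next
    have "(F ^^ (t - t0)) x0 = (F ^^ t) x"
      unfolding x0_def by (rule funpow_diff_apply[OF t0(2)[OF t]])
    moreover have g: "good t J (P t)" using jP[OF gU(1)[OF t]] gU(2)[OF t] by simp
    ultimately show "supp ((F ^^ (t - t0)) x0) \<subseteq> (\<Union>p\<in>P t. iball p R)"
      by (simp add: good_def R_def)
    show "finite (P t)"
      using g finite_supp[OF iter_closed[OF x(1), of t]] unfolding good_def
      by (elim conjE) (rule finite_subset)
    show "card (P t) \<le> card (P t0)" using gU(3)[OF t] gU(3)[OF t0(1)] by simp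
  qed
  then obtain c' where c': "\<And>t. t \<in> U \<Longrightarrow> supp ((F ^^ (t - t0)) (core p)) \<subseteq> iball (c' t) R" by metis
  \<comment> \<open>Third pigeonhole: the descendant of one fixed cluster, recentred at 0, is one of
    the fewer than \<open>card U\<close> patterns in \<open>Cf R\<close>, so it repeats up to
    translation.\<close>
  define z where "z t = translate (c' t) ((F ^^ (t - t0)) (core p))" for t
  have "z ` U \<subseteq> Cf R"
  proof
    fix w assume "w \<in> z ` U"
    then obtain t where t: "t \<in> U" "w = z t" by blast
    have "supp w \<subseteq> iball 0 R" using c'[OF t(1)] unfolding t(2) z_def supp_translate by force
    moreover have "w i \<in> B" for i
      unfolding t(2) z_def translate_def by (rule B(2)[OF iter_closed[OF core(1)]])
    ultimately show "w \<in> Cf R" by (simp add: Cf_def)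
  qed
  then have "card (z ` U) < card U" using card_mono[OF finCf] cardU by (meson le_less_trans)
  then obtain t t' where t: "t \<in> U" "t' \<in> U" "t < t'" "z t = z t'"
    using pigeonhole[of z U] unfolding inj_on_def by (metis nat_neq_iff)
  define y where "y = (F ^^ (t - t0)) (core p)"
  have "(F ^^ (t' - t)) y = (F ^^ (t' - t0)) (core p)"
  proof -
    have "t' - t = (t' - t0) - (t - t0)" using t0(2)[OF t(1)] t(3) by simp
    moreover have "t - t0 \<le> t' - t0" using t(3) by simp
    ultimately show ?thesis unfolding y_def by (simp only: funpow_diff_apply)
  qed
  also have "\<dots> = translate (c' t - c' t') y"
    using t(4)[symmetric] unfolding z_def y_def by (rule translate_eq_iff[THEN iffD1])
  finally have "(F ^^ (t' - t)) y = translate (c' t - c' t') y" .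
  moreover have "y \<in> M" "y \<noteq> 0" unfolding y_def using iter_closed nz core p by blast+
  ultimately show ?thesis using t(3) by (metis zero_less_diff)
qed blast

end

subsection \<open>Abelian cellular automata and solitons\<close>

lemma openin_cylinder:
  fixes a :: "'a config"
  assumes "finite K"
  shows "openin config_topology {x. \<forall>k\<in>K. x k = a k}"
proof -
  have "{x. \<forall>k\<in>K. x k = a k} = (\<Pi>\<^sub>E k\<in>UNIV. if k \<in> K then {a k} else UNIV)"
    by (auto simp: PiE_iff split: if_splits)
  also have "openin config_topology \<dots>"
    unfolding config_topology_def
  proof (rule product_topology_basis)
    show "finite {i. (if i \<in> K then {a i} else UNIV) \<noteq> topspace (discrete_topology (UNIV :: 'a set))}"
      by (rule finite_subset[OF _ assms]) auto
  qed simp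
  finally show ?thesis .
qed

lemma open_contains_cylinder:
  assumes "openin config_topology U" "x \<in> U"
  obtains K where "finite K" "{y. \<forall>k\<in>K. y k = x k} \<subseteq> U"
proof -
  obtain X where X: "finite {i. X i \<noteq> UNIV}" "x \<in> (\<Pi>\<^sub>E i\<in>UNIV. X i)" "(\<Pi>\<^sub>E i\<in>UNIV. X i) \<subseteq> U"
    using assms unfolding config_topology_def openin_product_topology_alt by force
  have "{y. \<forall>k\<in>{i. X i \<noteq> UNIV}. y k = x k} \<subseteq> U"
  proof
    fix y assume y: "y \<in> {y. \<forall>k\<in>{i. X i \<noteq> UNIV}. y k = x k}"
    have "y i \<in> X i" for i using X(2) y by (cases "X i = UNIV") (auto simp: PiE_iff)
    then show "y \<in> U" using X(3) by (auto simp: PiE_iff)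
  qed
  then show ?thesis using X(1) that by blast
qed

lemma openin_window_determined:
  assumes "finite K" "\<And>x y. x \<in> S \<Longrightarrow> (\<And>k. k \<in> K \<Longrightarrow> y k = x k) \<Longrightarrow> y \<in> S"
  shows "openin config_topology S"
proof (subst openin_subopen, intro ballI exI conjI)
  fix x assume "x \<in> S"
  then show "{y. \<forall>k\<in>K. y k = x k} \<subseteq> S" using assms(2) by blast
  show "openin config_topology {y. \<forall>k\<in>K. y k = x k}" by (rule openin_cylinder[OF assms(1)])
qed simp

lemma continuous_map_window:
  assumes "finite K" "\<And>x y. (\<And>k. k \<in> K \<Longrightarrow> y k = x k) \<Longrightarrow> f y = f x"
  shows "continuous_map config_topology euclidean f"
  unfolding continuous_map
proof (intro conjI allI impI)
  fix U :: "'b set"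
  show "openin config_topology {x \<in> topspace config_topology. f x \<in> U}"
  proof (rule openin_window_determined[OF assms(1)])
    fix x y :: "int \<Rightarrow> 'a"
    assume "x \<in> {x \<in> topspace config_topology. f x \<in> U}" "\<And>k. k \<in> K \<Longrightarrow> y k = x k"
    then show "y \<in> {x \<in> topspace config_topology. f x \<in> U}" using assms(2)[of y x] by simp
  qed
qed simp

text \<open>The Curtis-Hedlund-Lyndon form of an abelian cellular automaton. By additivity and
  equivariance, locality at every cell reduces to the vanishing condition at cell 0; see
  \<open>local\<close>.\<close>

locale additive_ca =
  fixes G :: "'a::ab_group_add config \<Rightarrow> 'a config" and r :: nat
  assumes add: "G (x + y) = G x + G y"
    and equivariant: "G (translate s x) = translate s (G x)"
    and local_0: "(\<And>j. j \<in> iball 0 r \<Longrightarrow> x j = 0) \<Longrightarrow> G x 0 = 0"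
begin

lemma map_zero: "G 0 = 0"
proof -
  have "G 0 + G 0 = G 0 + 0" unfolding add[symmetric] by (simp only: add_0_right)
  then show ?thesis by (rule add_left_imp_eq)
qed

lemma diff: "G (x - y) = G x - G y"
proof -
  have "G x = G (x - y) + G y" unfolding add[symmetric] by (simp only: diff_add_cancel)
  then show ?thesis by (simp only: add_diff_cancel)
qed

lemma map_sum: "G (\<Sum>i\<in>I. f i) = (\<Sum>i\<in>I. G (f i))"
proof (induction I rule: infinite_finite_induct)
  case (insert i I)
  then show ?case by (simp only: sum.insert[OF insert(1,2)] add)
qed (simp_all only: sum.infinite sum.empty map_zero not_False_eq_True)

lemma local:
  assumes "\<And>j. j \<in> iball i r \<Longrightarrow> x j = y j"
  shows "G x i = G y i"
proof -
  have "G (translate i (x - y)) 0 = 0"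
    by (rule local_0) (use assms in \<open>auto simp: translate_def\<close>)
  then have "translate i (G x - G y) 0 = 0" by (simp only: equivariant diff)
  then show ?thesis by (simp add: translate_def)
qed

lemma supp_image:
  assumes "supp x \<subseteq> {a..<b}"
  shows "supp (G x) \<subseteq> {a - int r..<b + int r}"
proof
  fix i assume i: "i \<in> supp (G x)"
  show "i \<in> {a - int r..<b + int r}"
  proof (rule ccontr)
    assume n: "i \<notin> {a - int r..<b + int r}"
    have "G x i = G 0 i"
    proof (rule local)
      fix j assume "j \<in> iball i r"
      then have "j \<notin> {a..<b}" using n by auto
      then show "x j = 0 j" using assms by (auto simp: supp_def)
    qed
    then show False using i by (simp add: map_zero supp_def)
  qed
qed

lemma finite_supp_image:
  assumes "finite (supp x)"
  shows "finite (supp (G x))"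
proof -
  have "supp x \<subseteq> {Min (insert 0 (supp x))..<Max (insert 0 (supp x)) + 1}"
    using assms by (auto intro: Min_le simp: zless_add1_eq le_imp_less_or_eq)
  from supp_image[OF this] show ?thesis by (rule finite_subset) simp
qed

lemma mono_radius:
  assumes "r \<le> r'"
  shows "additive_ca G r'"
proof
  show "G x 0 = 0" if "\<And>j. j \<in> iball 0 r' \<Longrightarrow> x j = 0" for x
    by (rule local_0, rule that) (use assms in auto)
qed (fact add equivariant)+

lemma continuous: "continuous_map config_topology config_topology G"
proof -
  have "continuous_map config_topology (discrete_topology UNIV) (\<lambda>x. G x i)" for i
    unfolding continuous_map
  proof (intro conjI allI impI)
    fix U :: "'a set"
    show "openin config_topology {x \<in> topspace config_topology. G x i \<in> U}"
    proof (rule openin_window_determined[of "iball i r"])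
      fix x y :: "'a config"
      assume "x \<in> {x \<in> topspace config_topology. G x i \<in> U}" "\<And>k. k \<in> iball i r \<Longrightarrow> y k = x k"
      then show "y \<in> {x \<in> topspace config_topology. G x i \<in> U}" using local[of i y x] by simp
    qed simp
  qed simp
  then show ?thesis
    unfolding config_topology_def continuous_map_componentwise by (auto simp: PiE_iff)
qed

end

lemma additive_ca_translate: "additive_ca (translate s) (nat \<bar>s\<bar>)"
proof
  show "translate s x 0 = 0" if "\<And>j. j \<in> iball 0 (nat \<bar>s\<bar>) \<Longrightarrow> x j = 0" for x :: "'a::ab_group_add config"
  proof -
    have "x s = 0" by (rule that) auto
    then show ?thesis by (simp add: translate_def)
  qed
qed (auto simp: translate_def algebra_simps)

lemma additive_ca_comp:
  fixes G H :: "'a::ab_group_add config \<Rightarrow> 'a config"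
  assumes "additive_ca G r" "additive_ca H r'"
  shows "additive_ca (\<lambda>x. G (H x)) (r + r')"
proof -
  interpret G: additive_ca G r by fact
  interpret H: additive_ca H r' by fact
  show ?thesis
  proof
    fix x :: "'a config"
    assume x: "\<And>j. j \<in> iball 0 (r + r') \<Longrightarrow> x j = 0"
    have "H x j = 0" if "j \<in> iball 0 r" for j
    proof -
      have "H x j = H 0 j" using that by (intro H.local) (auto intro!: x)
      then show ?thesis by (simp add: H.map_zero)
    qed
    then show "G (H x) 0 = 0" by (rule G.local_0)
  qed (simp_all add: G.add H.add G.equivariant H.equivariant)
qed

lemma additive_ca_diff:
  fixes G H :: "'a::ab_group_add config \<Rightarrow> 'a config"
  assumes "additive_ca G r" "additive_ca H r"
  shows "additive_ca (\<lambda>x. G x - H x) r"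
proof -
  interpret G: additive_ca G r by fact
  interpret H: additive_ca H r by fact
  show ?thesis
  proof
    fix x :: "'a config"
    assume "\<And>j. j \<in> iball 0 r \<Longrightarrow> x j = 0"
    then show "(G x - H x) 0 = 0" using G.local_0 H.local_0 by simp
  next
    show "G (x + y) - H (x + y) = G x - H x + (G y - H y)" for x y
      unfolding G.add H.add by (rule add_diff_add)
    show "G (translate s x) - H (translate s x) = translate s (G x - H x)" for s x
      unfolding G.equivariant H.equivariant by (simp add: translate_def fun_eq_iff)
  qed
qed

lemma additive_ca_funpow:
  assumes "additive_ca G r"
  shows "additive_ca (G ^^ n) (r * n)"
proof (induction n)
  case 0
  show ?case by unfold_locales auto
next
  case (Suc n)
  have "(G ^^ Suc n) = (\<lambda>x. G ((G ^^ n) x))" by (simp add: fun_eq_iff)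
  then show ?case using additive_ca_comp[OF assms Suc] by (simp only: mult_Suc_right)
qed

text \<open>The radius comes from continuity at the zero configuration: the preimage of the cylinder
  of configurations vanishing at 0 contains a cylinder around \<open>0\<close>, whose window bounds
  the radius.\<close>

lemma additive_ca_of_cellular_automaton:
  fixes F :: "'a::ab_group_add config \<Rightarrow> 'a config"
  assumes "cellular_automaton F" "abelian_map F"
  obtains r where "additive_ca F r"
proof -
  have add: "F (x + y) = F x + F y" for x y using assms(2) unfolding abelian_map_def by blast
  have zero: "F 0 = 0"
  proof -
    have "F 0 + F 0 = F 0 + 0" unfolding add[symmetric] by (simp only: add_0_right)
    then show ?thesis by (rule add_left_imp_eq)
  qed
  have pos: "F (translate (int n) x) = translate (int n) (F x)" for n x
  proof (induction n arbitrary: x)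
    case (Suc n)
    have s: "translate (int (Suc n)) y = shift (translate (int n) y)" for y :: "'a config"
      by (simp add: translate_def shift_def algebra_simps fun_eq_iff)
    show ?case using assms(1) unfolding s cellular_automaton_def by (simp add: Suc)
  qed simp
  \<comment> \<open>For negative \<open>s\<close>, the translation by \<open>- s\<close> is moved
    through \<open>F\<close> and then cancelled.\<close>
  have equiv: "F (translate s x) = translate s (F x)" for s x
  proof (cases "s \<ge> 0")
    case True
    then show ?thesis using pos[of "nat s" x] by simp
  next
    case False
    have "translate (- s) (F (translate s x)) = F (translate (- s) (translate s x))"
      using pos[of "nat (- s)" "translate s x"] False by simp
    then have "translate (- s) (F (translate s x)) = translate (- s) (translate s (F x))" by simp
    then show ?thesis unfolding translate_eq_iff by simp
  qed
  have "openin config_topology {y :: 'a config. \<forall>k\<in>{0}. y k = 0 k}" by (rule openin_cylinder) simp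
  then have "openin config_topology {x. F x \<in> {y. \<forall>k\<in>{0}. y k = 0 k}}"
    using assms(1) unfolding cellular_automaton_def continuous_map by auto
  moreover have "0 \<in> {x. F x \<in> {y. \<forall>k\<in>{0}. y k = 0 k}}" using zero by simp
  ultimately obtain K where K: "finite K" "{y. \<forall>k\<in>K. y k = 0 k} \<subseteq> {x. F x \<in> {y. \<forall>k\<in>{0}. y k = 0 k}}"
    by (rule open_contains_cylinder)
  define r where "r = nat (Max (abs ` insert 0 K))"
  have r: "k \<in> iball 0 r" if "k \<in> K" for k
  proof -
    have "\<bar>k\<bar> \<le> Max (abs ` insert 0 K)" using K(1) that by (intro Max_ge) auto
    then show ?thesis by (auto simp: r_def)
  qed
  have "additive_ca F r"
  proof
    fix x :: "'a config"
    assume "\<And>j. j \<in> iball 0 r \<Longrightarrow> x j = 0"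
    then have "x \<in> {y. \<forall>k\<in>K. y k = 0 k}" using r by simp
    then show "F x 0 = 0" using K(2) by auto
  qed (fact add equiv)+
  then show ?thesis by (rule that)
qed

section \<open>Solitons and recurrence up to translation\<close>

lemma diameter_translation:
  fixes S :: "real set"
  shows "diameter ((+) a ` S) = diameter S"
proof -
  have "(+) a ` S \<times> (+) a ` S = map_prod ((+) a) ((+) a) ` (S \<times> S)" by auto
  then have "(\<lambda>(x, y). dist x y) ` ((+) a ` S \<times> (+) a ` S) = (\<lambda>(x, y). dist x y) ` (S \<times> S)"
    by (simp add: image_image case_prod_unfold)
  then show ?thesis by (simp add: diameter_def)
qed

text \<open>Diameters are invariant under translation, so every diameter along the orbit is 0 or
  occurs among the first \<open>q\<close> times.\<close>

lemma soliton_if_recurrent: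
  fixes F :: "'a::ab_group_add config \<Rightarrow> 'a config"
  assumes "additive_ca F r" "finite (supp y)" "y \<noteq> 0" "q > 0"
    and rec: "(F ^^ q) y = 0 \<or> (F ^^ q) y = translate s y"
  shows "soliton F y"
proof -
  interpret F: additive_ca F r by fact
  let ?d = "\<lambda>x :: 'a config. diameter (real_of_int ` supp x)"
  have fin: "finite (supp ((F ^^ t) y))" for t
    by (induction t) (auto intro: F.finite_supp_image assms(2))
  have d0: "?d 0 = 0" by (simp add: supp_def)
  have iter0: "(F ^^ n) 0 = 0" for n using additive_ca.map_zero[OF additive_ca_funpow[OF assms(1)]] .
  have dtrans: "?d (translate s x) = ?d x" for x s
  proof -
    have "real_of_int ` supp (translate s x) = (+) (- real_of_int s) ` real_of_int ` supp x"
      unfolding supp_translate image_image by (intro image_cong) auto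
    then show ?thesis by (simp only: diameter_translation)
  qed
  have "\<exists>i<q. ?d ((F ^^ t) y) = ?d ((F ^^ i) y) \<or> ?d ((F ^^ t) y) = 0" for t
  proof (induction t rule: less_induct)
    case (less t)
    show ?case
    proof (cases "t < q")
      case False
      then have t: "(F ^^ t) y = (F ^^ (t - q)) ((F ^^ q) y)"
        by (metis comp_apply funpow_add le_add_diff_inverse2 not_less)
      from rec show ?thesis
      proof
        assume "(F ^^ q) y = 0"
        then have "?d ((F ^^ t) y) = 0" by (simp only: t iter0 d0)
        then show ?thesis using assms(4) by blast
      next
        assume "(F ^^ q) y = translate s y"
        then have "(F ^^ t) y = translate s ((F ^^ (t - q)) y)"
          by (simp only: t additive_ca.equivariant[OF additive_ca_funpow[OF assms(1)]])
        then have "?d ((F ^^ t) y) = ?d ((F ^^ (t - q)) y)" by (simp only: dtrans)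
        moreover have "t - q < t" using False assms(4) by simp
        ultimately show ?thesis using less[of "t - q"] by (simp only:)
      qed
    qed auto
  qed
  note per = this
  have "?d ((F ^^ t) y) \<le> Max (insert 0 ((\<lambda>i. ?d ((F ^^ i) y)) ` {..<q}))" for t
  proof -
    obtain i where i: "i < q" "?d ((F ^^ t) y) = ?d ((F ^^ i) y) \<or> ?d ((F ^^ t) y) = 0"
      using per by blast
    then have "?d ((F ^^ t) y) \<in> insert 0 ((\<lambda>i. ?d ((F ^^ i) y)) ` {..<q})" by auto
    then show ?thesis by (intro Max_ge) auto
  qed
  then show ?thesis using assms(2,3) unfolding soliton_def finite_config_def by blast
qed

text \<open>If the orbit never vanishes, move the leftmost nonzero cell to 0. The bounded diameter
  leaves finitely many patterns, so two times show translates of the same configuration.\<close>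

lemma recurrent_if_soliton:
  fixes F :: "'a::{finite, ab_group_add} config \<Rightarrow> 'a config"
  assumes "additive_ca F r" "soliton F c"
  obtains y q s where "finite (supp y)" "y \<noteq> 0" "q > 0"
    "(F ^^ q) y = 0 \<or> (F ^^ q) y = translate s y"
proof (cases "\<exists>t. (F ^^ t) c = 0")
  case True
  then obtain t where t: "(F ^^ t) c = 0" by blast
  have c: "c \<noteq> 0" "finite (supp c)" using assms(2) by (auto simp: soliton_def finite_config_def)
  then have "t > 0" using t by (cases t) auto
  then show ?thesis using that[of c t] c t by blast
next
  case False
  interpret F: additive_ca F r by fact
  have c: "c \<noteq> 0" "finite (supp c)" using assms(2) by (auto simp: soliton_def finite_config_def)
  obtain D where D: "\<And>t. diameter (real_of_int ` supp ((F ^^ t) c)) \<le> D"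
    using assms(2) unfolding soliton_def by blast
  have fin: "finite (supp ((F ^^ t) c))" for t
    by (induction t) (auto intro: F.finite_supp_image c(2))
  define m where "m t = Min (supp ((F ^^ t) c))" for t
  define z where "z t = translate (m t) ((F ^^ t) c)" for t
  have "range z \<subseteq> {z. supp z \<subseteq> {0..\<lceil>D\<rceil>} \<and> (\<forall>i. z i \<in> UNIV)}"
  proof safe
    fix t i assume i: "i \<in> supp (z t)"
    then have im: "i + m t \<in> supp ((F ^^ t) c)" by (simp add: z_def translate_def supp_def)
    then have m: "m t \<in> supp ((F ^^ t) c)" "m t \<le> i + m t"
      using Min_in[OF fin[of t]] Min_le[OF fin im] im by (auto simp: m_def[symmetric])
    have "dist (real_of_int (i + m t)) (real_of_int (m t)) \<le> diameter (real_of_int ` supp ((F ^^ t) c))"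
      using im m(1) by (intro diameter_bounded_bound finite_imp_bounded finite_imageI fin imageI)
    also have "\<dots> \<le> D" by (rule D)
    finally have "real_of_int i \<le> D" using m(2) by (simp add: dist_real_def)
    then show "i \<in> {0..\<lceil>D\<rceil>}" using m(2) by simp linarith
  qed simp
  moreover have "finite {z :: 'a config. supp z \<subseteq> {0..\<lceil>D\<rceil>} \<and> (\<forall>i. z i \<in> UNIV)}"
    by (rule finite_configs_bounded) auto
  ultimately have "finite (range z)" by (rule finite_subset)
  then have "\<not> inj z" using finite_imageD infinite_UNIV_nat by blast
  then obtain t t' where t: "t < t'" "z t = z t'" unfolding inj_on_def by (metis nat_neq_iff)
  show ?thesis
  proof (rule that[of "(F ^^ t) c" "t' - t" "m t - m t'"])
    show "(F ^^ (t' - t)) ((F ^^ t) c) = 0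
        \<or> (F ^^ (t' - t)) ((F ^^ t) c) = translate (m t - m t') ((F ^^ t) c)"
      using t(2)[symmetric] t(1) unfolding z_def translate_eq_iff by (simp add: funpow_diff_apply)
  qed (use fin False t(1) in auto)
qed

subsection \<open>The Garden of Eden theorem\<close>

definition window :: "int set \<Rightarrow> 'a::zero config set" where
  "window I = {x. supp x \<subseteq> I}"

lemma restr_in_window: "restr I x \<in> window I"
  by (simp add: window_def supp_restr)

lemma restr_window: "x \<in> window I \<Longrightarrow> restr I x = x"
  by (auto simp: window_def supp_def restr_def fun_eq_iff)

lemma window_add:
  fixes x y :: "'a::comm_monoid_add config"
  assumes "x \<in> window I" "y \<in> window I"
  shows "x + y \<in> window I"
proof -
  have "supp (x + y) \<subseteq> supp x \<union> supp y" by (auto simp: supp_def)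
  then show ?thesis using assms by (auto simp: window_def)
qed

lemma finite_window: "finite I \<Longrightarrow> finite (window I :: 'a::{finite, zero} config set)"
  using finite_configs_bounded[of I "UNIV :: 'a set"] by (simp add: window_def)

lemma card_window:
  assumes "finite I"
  shows "card (window I :: 'a::{finite, zero} config set) = CARD('a) ^ card I"
proof -
  have "bij_betw (\<lambda>x. restrict x I) (window I) (\<Pi>\<^sub>E i\<in>I. (UNIV :: 'a set))"
  proof (rule bij_betw_byWitness[where f' = "restr I"])
    show "\<forall>x\<in>window I. restr I (restrict x I) = x"
      by (auto simp: restr_def window_def supp_def fun_eq_iff)
    show "\<forall>x\<in>\<Pi>\<^sub>E i\<in>I. UNIV. restrict (restr I x) I = x"
      by (auto simp: restr_def fun_eq_iff PiE_iff extensional_def)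
    show "restr I ` (\<Pi>\<^sub>E i\<in>I. UNIV) \<subseteq> window I" using restr_in_window by blast
  qed auto
  then have "card (window I :: 'a config set) = card (\<Pi>\<^sub>E i\<in>I. (UNIV :: 'a set))"
    by (rule bij_betw_same_card)
  then show ?thesis using assms by (simp add: card_PiE)
qed

lemma sum_config_apply: "(\<Sum>i\<in>J. f i) k = (\<Sum>i\<in>J. f i k)"
  for f :: "'i \<Rightarrow> 'a::comm_monoid_add config"
  by (induction J rule: infinite_finite_induct) auto

lemma finite_subset_interval:
  fixes S :: "int set"
  assumes "finite S"
  obtains c and m :: nat where "S \<subseteq> {c..<c + int m}"
proof
  let ?M = "Max (insert 0 (abs ` S))"
  have "\<bar>i\<bar> \<le> ?M" if "i \<in> S" for i using assms that by (intro Max_ge) auto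
  then show "S \<subseteq> {- ?M..<- ?M + int (nat (2 * ?M + 1))}" by force
qed

text \<open>
  Both directions count patterns: an output window of length \<open>n\<close> is determined by an input window
  of length \<open>n + 2 * r\<close>, and a loss that is exponential in \<open>n\<close> on either side beats the boundary
  factor \<open>CARD('a) ^ (2 * r)\<close>.
\<close>

lemma moore:
  fixes G :: "'a::{finite, ab_group_add} config \<Rightarrow> 'a config"
  assumes "additive_ca G r" "finite (supp x)" "x \<noteq> 0" "G x = 0"
  shows "\<exists>n. restr {0..<int n} ` range G \<noteq> window {0..<int n}"
proof -
  interpret additive_ca G r by fact
  obtain c m where "supp x \<subseteq> {c..<c + int m}" using finite_subset_interval[OF assms(2)] .
  then have x'0: "supp (translate c x) \<subseteq> {0..<int m}" unfolding supp_translate by force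
  define x' where "x' = translate c x"
  have x': "supp x' \<subseteq> {0..<int m}" using x'0 by (simp add: x'_def)
  have "G x' = translate c 0" unfolding x'_def equivariant assms(4) ..
  then have Gx': "G x' = 0" by (simp add: translate_def fun_eq_iff)
  have "x' \<noteq> 0"
  proof
    assume "x' = 0"
    then have "translate c x = translate c 0" by (simp add: x'_def translate_def fun_eq_iff)
    then show False using assms(3) unfolding translate_eq_iff by simp
  qed
  then obtain k where k: "x' k \<noteq> 0" by (auto simp: fun_eq_iff)
  then have km: "0 \<le> k" "k < int m" using x' by (auto simp: supp_def)
  \<comment> \<open>Each of \<open>j\<close> disjoint blocks may or may not receive a copy of the
    kernel element. The resulting \<open>2 ^ j\<close> choices must outnumber the patterns on the
    boundary.\<close>
  obtain j where j: "real (CARD('a) ^ (2 * r)) < 2 ^ j" using real_arch_pow[of 2] by auto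
  then have j: "CARD('a) ^ (2 * r) < 2 ^ j" by (simp flip: of_nat_less_iff[where 'a = real])
  define n where "n = j * m"
  define S where "S J = (\<Sum>i\<in>J. translate (- int (i * m)) x')" for J
  have GS: "G (S J) = 0" for J
  proof -
    have "G (S J) = (\<Sum>i\<in>J. translate (- int (i * m)) 0)"
      unfolding S_def map_sum equivariant Gx' ..
    then show ?thesis by (simp add: translate_def fun_eq_iff sum_config_apply)
  qed
  \<comment> \<open>The blocks of length \<open>m\<close> do not overlap, so the cell at offset
    \<open>k\<close> in block \<open>i\<close> tells whether \<open>i \<in> J\<close>.\<close>
  have Sk: "S J (k + int (i * m)) = (if i \<in> J then x' k else 0)" if "finite J" for J i
  proof -
    have "x' (k + int (i * m) - int (l * m)) = (if i = l then x' k else 0)" for l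
    proof (cases "i = l")
      case False
      have "x' (k + int (i * m) - int (l * m)) = 0"
      proof (rule ccontr)
        assume "x' (k + int (i * m) - int (l * m)) \<noteq> 0"
        then have *: "0 \<le> k + int (i * m) - int (l * m)" "k + int (i * m) - int (l * m) < int m"
          using x' by (auto simp: supp_def)
        have "i < l \<or> l < i" using False by auto
        then show False
        proof
          assume "i < l"
          then have "Suc i * m \<le> l * m" by (intro mult_le_mono1) simp
          then have "int (i * m) + int m \<le> int (l * m)" unfolding mult_Suc by linarith
          then show False using * km by linarith
        next
          assume "l < i"
          then have "Suc l * m \<le> i * m" by (intro mult_le_mono1) simp
          then have "int (l * m) + int m \<le> int (i * m)" unfolding mult_Suc by linarith
          then show False using * km by linarith
        qed
      qed
      then show ?thesis using False by simp
    qed simp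
    then have "S J (k + int (i * m)) = (\<Sum>l\<in>J. if i = l then x' k else 0)"
      unfolding S_def sum_config_apply translate_def by (simp add: algebra_simps)
    then show ?thesis using that by (simp add: sum.delta')
  qed
  let ?W = "window {- int r..<int n + int r} :: 'a config set"
  have SW: "S J \<in> ?W" if "J \<subseteq> {..<j}" for J
  proof -
    have "S J i = 0" if i: "i \<notin> {- int r..<int n + int r}" for i
    proof -
      have "x' (i - int (l * m)) = 0" if "l \<in> J" for l
      proof (rule ccontr)
        assume "x' (i - int (l * m)) \<noteq> 0"
        then have *: "0 \<le> i - int (l * m)" "i - int (l * m) < int m" using x' by (auto simp: supp_def)
        have "Suc l * m \<le> j * m" using \<open>l \<in> J\<close> \<open>J \<subseteq> {..<j}\<close> by (intro mult_le_mono1) auto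
        then have "int (l * m) + int m \<le> int n" unfolding n_def mult_Suc by linarith
        then have "- int r \<le> i" "i < int n + int r" using * of_nat_0_le_iff[of "l * m"] by linarith+
        then show False using i by simp
      qed
      then show ?thesis unfolding S_def sum_config_apply translate_def by (simp add: sum.neutral)
    qed
    then show ?thesis unfolding window_def supp_def by blast
  qed
  have "restr {0..<int n} ` range G \<noteq> window {0..<int n}"
  proof
    assume eq: "restr {0..<int n} ` range G = window {0..<int n}"
    \<comment> \<open>A preimage can be cut to the input window, which is all that the output window
      sees.\<close>
    have "\<exists>z\<in>?W. restr {0..<int n} (G z) = y" if "y \<in> window {0..<int n}" for y
    proof -
      have "y \<in> restr {0..<int n} ` range G" unfolding eq by (rule that)
      then obtain z where z: "y = restr {0..<int n} (G z)" by (elim imageE) (simp only:)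
      have "restr {0..<int n} (G (restr {- int r..<int n + int r} z)) = restr {0..<int n} (G z)"
      proof
        fix i
        show "restr {0..<int n} (G (restr {- int r..<int n + int r} z)) i = restr {0..<int n} (G z) i"
        proof (cases "i \<in> {0..<int n}")
          case True
          have "G (restr {- int r..<int n + int r} z) i = G z i"
            by (rule local) (use True in \<open>auto simp: restr_def\<close>)
          then show ?thesis unfolding restr_def[of "{0..<int n}"] by (simp only:)
        qed (simp only: restr_def[of "{0..<int n}"] if_False)
      qed
      then show ?thesis using z restr_in_window by metis
    qed
    then obtain rep where rep: "\<And>y. y \<in> window {0..<int n} \<Longrightarrow> rep y \<in> ?W"
      "\<And>y. y \<in> window {0..<int n} \<Longrightarrow> restr {0..<int n} (G (rep y)) = y" by metis
    \<comment> \<open>Applying \<open>G\<close> removes \<open>S J\<close> and recovers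
      \<open>y\<close>; then \<open>rep y\<close> cancels and \<open>S J\<close> recovers
      \<open>J\<close>.\<close>
    have "inj_on (\<lambda>(y, J). rep y + S J) (window {0..<int n} \<times> Pow {..<j})"
    proof (rule inj_onI, clarify)
      fix y y' :: "'a config" and J J' assume y: "y \<in> window {0..<int n}" "y' \<in> window {0..<int n}"
        and J: "J \<subseteq> {..<j}" "J' \<subseteq> {..<j}" and e: "rep y + S J = rep y' + S J'"
      have "G (rep y) = G (rep y')" using arg_cong[OF e, of G] by (simp only: add GS add_0_right)
      then have "restr {0..<int n} (G (rep y)) = restr {0..<int n} (G (rep y'))" by (rule arg_cong)
      then have yy: "y = y'" unfolding rep(2)[OF y(1)] rep(2)[OF y(2)] .
      have SJ: "S J = S J'" using e unfolding yy by (rule add_left_imp_eq)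
      have "i \<in> J \<longleftrightarrow> i \<in> J'" for i
      proof -
        have "finite J" "finite J'" using J finite_subset by blast+
        then have "(if i \<in> J then x' k else 0) = (if i \<in> J' then x' k else 0)"
          using Sk[of J i] Sk[of J' i] SJ by metis
        then show ?thesis using k by (simp split: if_splits)
      qed
      then show "y = y' \<and> J = J'" using yy by blast
    qed
    moreover have "(\<lambda>(y, J). rep y + S J) ` (window {0..<int n} \<times> Pow {..<j}) \<subseteq> ?W"
    proof safe
      fix y :: "'a config" and J assume "y \<in> window {0..<int n}" "J \<subseteq> {..<j}"
      then have "rep y \<in> ?W" "S J \<in> ?W" using rep(1) SW by auto
      then show "rep y + S J \<in> ?W" by (rule window_add)
    qed
    ultimately have "card (window {0..<int n} \<times> Pow {..<j} :: ('a config \<times> _) set) \<le> card ?W"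
      by (rule card_inj_on_le) (rule finite_window, simp)
    moreover have "nat (int n + int r + int r) = n + 2 * r" by simp
    ultimately have "CARD('a) ^ n * 2 ^ j \<le> CARD('a) ^ n * CARD('a) ^ (2 * r)"
      by (simp add: card_cartesian_product card_window card_Pow power_add)
    then show False using j by simp
  qed
  then show ?thesis by blast
qed

lemma myhill:
  fixes G :: "'a::{finite, ab_group_add} config \<Rightarrow> 'a config"
  assumes "additive_ca G r" and nonsurj: "restr {0..<int m} ` range G \<noteq> window {0..<int m}"
  obtains x where "finite (supp x)" "x \<noteq> 0" "G x = 0"
proof -
  interpret additive_ca G r by fact
  define I where "I = restr {0..<int m} ` range G"
  have "I \<subset> window {0..<int m}" using nonsurj restr_in_window unfolding I_def by blast
  then have "card I < CARD('a) ^ m"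
    using psubset_card_mono[OF finite_window[of "{0..<int m}"]] by (simp add: card_window)
  have finI: "finite I"
    using \<open>I \<subset> _\<close> finite_window[of "{0..<int m}"] by (meson finite_atLeastLessThan_int finite_subset psubset_imp_subset)
  have "restr {0..<int m} (G 0) \<in> I" by (simp add: I_def)
  then have "card I > 0" using finI card_gt_0_iff by blast
  define Q where "Q = CARD('a) ^ m"
  have Q: "card I < Q" using \<open>card I < _\<close> by (simp add: Q_def)
  have m: "m > 0" using Q \<open>card I > 0\<close> by (cases m) (auto simp: Q_def)
  have "real Q / real (card I) > 1" using Q \<open>card I > 0\<close> by simp
  \<comment> \<open>Every block loses the factor \<open>Q / card I > 1\<close>; enough blocks
    outweigh the boundary.\<close>
  then obtain j where "real (CARD('a) ^ (2 * r)) < (real Q / real (card I)) ^ j"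
    using real_arch_pow by blast
  then have "real (CARD('a) ^ (2 * r)) * real (card I) ^ j < real Q ^ j"
    using \<open>card I > 0\<close> by (simp add: power_divide field_simps)
  then have "real (CARD('a) ^ (2 * r) * card I ^ j) < real (Q ^ j)" by simp
  then have j: "CARD('a) ^ (2 * r) * card I ^ j < Q ^ j" unfolding of_nat_less_iff .
  define N where "N = j * m"
  \<comment> \<open>The cells outside \<open>{0..<int N}\<close> that an image of a configuration
    supported there can reach.\<close>
  define E where "E = {- int r..<0} \<union> {int N..<int N + int r}"
  \<comment> \<open>The map \<open>f\<close> records the image of \<open>x\<close> on the boundary
    and on each of the \<open>j\<close> blocks. By equivariance every block shows a pattern of
    \<open>I\<close>, so \<open>f\<close> has fewer values than there are inputs. The difference of
    two inputs with equal value lies in the kernel.\<close>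
  define f where "f x = (restr E (G x), \<lambda>i\<in>{..<j}. restr {0..<int m} (translate (int (i * m)) (G x)))" for x
  have "card E = 2 * r"
    unfolding E_def by (subst card_Un_disjoint) auto
  then have "card (window E :: 'a config set) = CARD('a) ^ (2 * r)"
    by (simp add: card_window E_def)
  moreover have "card (window {0..<int N} :: 'a config set) = Q ^ j"
    unfolding card_window[OF finite_atLeastLessThan_int] Q_def N_def
    by (simp add: mult.commute flip: power_mult of_nat_mult del: of_nat_mult)
  ultimately have "card (window E \<times> (\<Pi>\<^sub>E i\<in>{..<j}. I) :: ('a config \<times> _) set)
      < card (window {0..<int N} :: 'a config set)"
    using j by (simp add: card_cartesian_product card_PiE)
  moreover have "f ` window {0..<int N} \<subseteq> window E \<times> (\<Pi>\<^sub>E i\<in>{..<j}. I)"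
    unfolding f_def I_def equivariant[symmetric] using restr_in_window by auto
  moreover have "finite (window E \<times> (\<Pi>\<^sub>E i\<in>{..<j}. I) :: ('a config \<times> _) set)"
    using finI finite_window[of E] by (auto simp: E_def intro: finite_PiE)
  ultimately have "\<not> inj_on f (window {0..<int N})" by (meson card_inj_on_le not_less)
  then obtain x x' where x: "x \<in> window {0..<int N}" "x' \<in> window {0..<int N}" "x \<noteq> x'" "f x = f x'"
    by (auto simp: inj_on_def)
  have "G x i = G x' i" for i
  proof -
    consider "i \<in> E" | "i \<in> {0..<int N}" | "i \<notin> {- int r..<int N + int r}"
      unfolding E_def Un_iff atLeastLessThan_iff by linarith
    then show ?thesis
    proof cases
      case 1
      have "restr E (G x) i = restr E (G x') i" using x(4) by (simp add: f_def)
      then show ?thesis using 1 by (simp add: restr_def)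
    next
      case 2
      define l where "l = nat i div m"
      have l: "l < j" unfolding l_def
        using 2 by (simp add: N_def nat_less_iff less_mult_imp_div_less)
      have i: "i = int (nat i mod m) + int (l * m)"
      proof -
        have "nat i mod m + l * m = nat i" unfolding l_def by (rule mod_div_mult_eq)
        then have "int (nat i mod m) + int (l * m) = int (nat i)" by (simp only: flip: of_nat_add)
        then show ?thesis using 2 by simp
      qed
      have "restr {0..<int m} (translate (int (l * m)) (G x)) = restr {0..<int m} (translate (int (l * m)) (G x'))"
        using x(4) l unfolding f_def by (auto simp: restrict_def fun_eq_iff dest: spec[of _ l])
      then have "restr {0..<int m} (translate (int (l * m)) (G x)) (int (nat i mod m))
        = restr {0..<int m} (translate (int (l * m)) (G x')) (int (nat i mod m))" by simp
      then show ?thesis using m i by (simp add: restr_def translate_def)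
    next
      case 3
      have "G y i = 0" if "y \<in> window {0..<int N}" for y
      proof -
        have "supp (G y) \<subseteq> {- int r..<int N + int r}"
          using supp_image[of y 0 "int N"] that by (simp add: window_def)
        then have "i \<notin> supp (G y)" using 3 by blast
        then show ?thesis by (simp add: supp_def)
      qed
      then show ?thesis using x(1,2) by simp
    qed
  qed
  then have "G x = G x'" by blast
  show ?thesis
  proof (rule that[of "x - x'"])
    have "supp (x - x') \<subseteq> supp x \<union> supp x'" by (auto simp: supp_def)
    then have "supp (x - x') \<subseteq> {0..<int N}" using x(1,2) unfolding window_def by blast
    then show "finite (supp (x - x'))" by (rule finite_subset) simp
    show "x - x' \<noteq> 0" using x(3) unfolding right_minus_eq .
    show "G (x - x') = 0" using \<open>G x = G x'\<close> by (simp only: diff diff_self)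
  qed
qed

subsection \<open>Characters of finite abelian groups\<close>

definition add_subgroup :: "'b::ab_group_add set \<Rightarrow> bool" where
  "add_subgroup H \<longleftrightarrow> 0 \<in> H \<and> (\<forall>x\<in>H. \<forall>y\<in>H. x + y \<in> H) \<and> (\<forall>x\<in>H. - x \<in> H)"

text \<open>Groups are sets here because the same theory serves the alphabet and the group of
  patterns on a window. Values outside \<open>H\<close> are unconstrained.\<close>

definition char_on :: "'b::ab_group_add set \<Rightarrow> ('b \<Rightarrow> complex) \<Rightarrow> bool" where
  "char_on H \<psi> \<longleftrightarrow> (\<forall>x\<in>H. norm (\<psi> x) = 1) \<and> (\<forall>x\<in>H. \<forall>y\<in>H. \<psi> (x + y) = \<psi> x * \<psi> y)"

primrec nat_mult :: "nat \<Rightarrow> 'b::ab_group_add \<Rightarrow> 'b" where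
  "nat_mult 0 x = 0"
| "nat_mult (Suc n) x = x + nat_mult n x"

lemma nat_mult_add: "nat_mult (m + n) x = nat_mult m x + nat_mult n x"
  by (induction m) (auto simp: add.assoc)

lemma nat_mult_mult: "nat_mult (m * n) x = nat_mult m (nat_mult n x)"
  by (induction m) (auto simp: nat_mult_add)

lemma add_subgroup_nat_mult: "add_subgroup H \<Longrightarrow> x \<in> H \<Longrightarrow> nat_mult n x \<in> H"
  by (induction n) (auto simp: add_subgroup_def)

lemma add_subgroup_diff: "add_subgroup H \<Longrightarrow> x \<in> H \<Longrightarrow> y \<in> H \<Longrightarrow> x - y \<in> H"
  unfolding add_subgroup_def by (metis add_uminus_conv_diff)

lemma char_on_0:
  assumes "add_subgroup H" "char_on H \<psi>"
  shows "\<psi> 0 = 1"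
proof -
  have "0 \<in> H" using assms(1) by (simp add: add_subgroup_def)
  then have "\<psi> (0 + 0) = \<psi> 0 * \<psi> 0" "norm (\<psi> 0) = 1" using assms(2) unfolding char_on_def by blast+
  then show ?thesis by auto
qed

lemma char_on_nat_mult:
  assumes "add_subgroup H" "char_on H \<psi>" "x \<in> H"
  shows "\<psi> (nat_mult n x) = \<psi> x ^ n"
proof (induction n)
  case (Suc n)
  have "\<psi> (x + nat_mult n x) = \<psi> x * \<psi> (nat_mult n x)"
    using assms add_subgroup_nat_mult[OF assms(1,3)] unfolding char_on_def by blast
  then show ?case by (simp add: Suc)
qed (simp add: char_on_0[OF assms(1,2)])

lemma nat_mult_in_subgroup:
  assumes "finite G" "add_subgroup G" "add_subgroup H" "g \<in> G"
  shows "\<exists>n>0. nat_mult n g \<in> H"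
proof -
  have "range (\<lambda>n. nat_mult n g) \<subseteq> G" using add_subgroup_nat_mult assms(2,4) by auto
  then have "\<not> inj (\<lambda>n. nat_mult n g)"
    using assms(1) finite_subset finite_imageD infinite_UNIV_nat by blast
  then obtain i j where ij: "i < j" "nat_mult i g = nat_mult j g"
    unfolding inj_on_def by (metis nat_neq_iff)
  have "nat_mult j g = nat_mult (j - i) g + nat_mult i g" using ij(1) by (simp flip: nat_mult_add)
  then have "nat_mult (j - i) g = 0" using ij(2) by simp
  then show ?thesis using ij(1) assms(3) by (intro exI[of _ "j - i"]) (auto simp: add_subgroup_def)
qed

text \<open>
  The value at \<open>g\<close> of an extension can be any root \<open>\<zeta>\<close> of the value prescribed at the first
  multiple of \<open>g\<close> that lies in \<open>H\<close>.
\<close>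

lemma char_on_extend_one:
  assumes H: "add_subgroup H" "char_on H \<psi>"
    and n: "n > 0" "nat_mult n g \<in> H" "\<And>m. 0 < m \<Longrightarrow> m < n \<Longrightarrow> nat_mult m g \<notin> H"
    and \<zeta>: "\<zeta> ^ n = \<psi> (nat_mult n g)"
  defines "H' \<equiv> {h + nat_mult i g | h i. h \<in> H}"
  obtains \<psi>' where "add_subgroup H'" "char_on H' \<psi>'" "\<And>h. h \<in> H \<Longrightarrow> \<psi>' h = \<psi> h" "\<psi>' g = \<zeta>"
proof -
  have mul: "\<psi> (x + y) = \<psi> x * \<psi> y" if "x \<in> H" "y \<in> H" for x y
    using that H(2) unfolding char_on_def by blast
  have H0: "0 \<in> H" and Hadd: "\<And>x y. x \<in> H \<Longrightarrow> y \<in> H \<Longrightarrow> x + y \<in> H"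
    and Hneg: "\<And>x. x \<in> H \<Longrightarrow> - x \<in> H"
    using H(1) unfolding add_subgroup_def by blast+
  \<comment> \<open>Well-definedness: two representations differ by a multiple of \<open>g\<close>
    lying in \<open>H\<close>. Dividing its coefficient by \<open>n\<close>, minimality of
    \<open>n\<close> forces remainder 0, so the two values agree by the choice of \<zeta>.\<close>
  have key: "\<psi> h * \<zeta> ^ i = \<psi> h' * \<zeta> ^ j"
    if h: "h \<in> H" "h' \<in> H" and e: "h + nat_mult i g = h' + nat_mult j g" and ij: "i \<le> j" for h h' i j
  proof -
    have "nat_mult j g = nat_mult (j - i) g + nat_mult i g" using ij by (simp flip: nat_mult_add)
    then have hh: "h = h' + nat_mult (j - i) g" using e by (simp add: add.assoc[symmetric])
    then have "nat_mult (j - i) g = h - h'" by simp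
    then have ji: "nat_mult (j - i) g \<in> H" using add_subgroup_diff[OF H(1) h] by simp
    define a b where "a = (j - i) div n" and "b = (j - i) mod n"
    have ab: "j - i = b + a * n" unfolding a_def b_def by simp
    have an: "nat_mult (a * n) g = nat_mult a (nat_mult n g)" by (rule nat_mult_mult)
    have anH: "nat_mult a (nat_mult n g) \<in> H" by (rule add_subgroup_nat_mult[OF H(1) n(2)])
    have "nat_mult b g = nat_mult (j - i) g - nat_mult a (nat_mult n g)"
      unfolding ab nat_mult_add an by simp
    then have "nat_mult b g \<in> H" using add_subgroup_diff[OF H(1) ji anH] by simp
    moreover have "b < n" unfolding b_def using n(1) by simp
    ultimately have "b = 0" using n(3) by (cases "b = 0") auto
    then have "h = h' + nat_mult a (nat_mult n g)" using hh unfolding ab an[symmetric] by simp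
    then have "\<psi> h = \<psi> h' * \<psi> (nat_mult n g) ^ a"
      using mul[OF h(2) anH] char_on_nat_mult[OF H n(2), of a] by simp
    then have "\<psi> h = \<psi> h' * \<zeta> ^ (j - i)"
      unfolding \<zeta>[symmetric] ab \<open>b = 0\<close> by (simp add: mult.commute flip: power_mult)
    then show ?thesis using ij by (simp flip: power_add)
  qed
  define \<psi>' where "\<psi>' y = (SOME z. \<exists>h\<in>H. \<exists>i. y = h + nat_mult i g \<and> z = \<psi> h * \<zeta> ^ i)" for y
  have \<psi>': "\<psi>' (h + nat_mult i g) = \<psi> h * \<zeta> ^ i" if "h \<in> H" for h i
    unfolding \<psi>'_def
  proof (rule some_equality)
    show "\<exists>h'\<in>H. \<exists>j. h + nat_mult i g = h' + nat_mult j g \<and> \<psi> h * \<zeta> ^ i = \<psi> h' * \<zeta> ^ j"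
      using that by blast
    fix z assume "\<exists>h'\<in>H. \<exists>j. h + nat_mult i g = h' + nat_mult j g \<and> z = \<psi> h' * \<zeta> ^ j"
    then obtain h' j where "h' \<in> H" "h + nat_mult i g = h' + nat_mult j g" "z = \<psi> h' * \<zeta> ^ j" by blast
    then show "z = \<psi> h * \<zeta> ^ i"
      using key[OF that, of h' i j] key[of h' h j i] that by (cases "i \<le> j") auto
  qed
  have n\<zeta>: "norm \<zeta> = 1"
  proof -
    have "norm \<zeta> ^ n = 1" using \<zeta> H(2) n(2) unfolding char_on_def by (metis norm_power)
    then show ?thesis using n(1) power_eq_imp_eq_base[of "norm \<zeta>" n 1] by simp
  qed
  have plus: "(h + nat_mult i g) + (h' + nat_mult j g) = (h + h') + nat_mult (i + j) g" for h h' i j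
    by (simp add: nat_mult_add algebra_simps)
  show ?thesis
  proof (rule that[of \<psi>'])
    show "char_on H' \<psi>'"
      unfolding char_on_def
    proof (intro conjI ballI)
      fix x assume "x \<in> H'"
      then obtain h i where "x = h + nat_mult i g" "h \<in> H" by (auto simp: H'_def)
      then show "norm (\<psi>' x) = 1"
        using \<psi>' n\<zeta> H(2) by (simp add: norm_mult norm_power char_on_def)
    next
      fix x y assume "x \<in> H'" "y \<in> H'"
      then obtain h i h' j where "x = h + nat_mult i g" "h \<in> H" "y = h' + nat_mult j g" "h' \<in> H"
        by (auto simp: H'_def)
      then show "\<psi>' (x + y) = \<psi>' x * \<psi>' y" using \<psi>' Hadd mul by (simp add: plus power_add)
    qed
    show "\<psi>' h = \<psi> h" if "h \<in> H" for h using \<psi>'[OF that, of 0] by simp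
    show "\<psi>' g = \<zeta>" using \<psi>'[OF H0, of 1] char_on_0[OF H] by simp
    show "add_subgroup H'"
      unfolding add_subgroup_def
    proof (intro conjI ballI)
      have "0 + nat_mult 0 g \<in> H'" unfolding H'_def using H0 by blast
      then show "0 \<in> H'" by simp
      fix x assume "x \<in> H'"
      then obtain h i where x: "x = h + nat_mult i g" "h \<in> H" by (auto simp: H'_def)
      \<comment> \<open>Only natural multiples of \<open>g\<close> occur in \<open>H'\<close>, so
        \<open>- i * g\<close> is rewritten as \<open>- (i * n) * g + i * (n - 1) * g\<close>, whose
        first summand lies in \<open>H\<close>.\<close>
      have "nat_mult (i * n) g = nat_mult (i * (n - 1)) g + nat_mult i g"
        unfolding nat_mult_add[symmetric] using n(1) by (cases n) (auto simp: algebra_simps)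
      then have "- x = (- h - nat_mult i (nat_mult n g)) + nat_mult (i * (n - 1)) g"
        unfolding x nat_mult_mult[symmetric] by (simp add: algebra_simps)
      moreover have "- h - nat_mult i (nat_mult n g) \<in> H"
        by (rule add_subgroup_diff[OF H(1) Hneg[OF x(2)] add_subgroup_nat_mult[OF H(1) n(2)]])
      ultimately show "- x \<in> H'" unfolding H'_def by blast
      fix y assume "y \<in> H'"
      then obtain h' j where "y = h' + nat_mult j g" "h' \<in> H" by (auto simp: H'_def)
      then have "x + y = (h + h') + nat_mult (i + j) g" "h + h' \<in> H" using x plus Hadd by auto
      then show "x + y \<in> H'" unfolding H'_def by blast
    qed
  qed
qed

lemma exists_root:
  fixes w :: complex
  assumes "n > 0" "w \<noteq> 0"
  obtains \<zeta> where "\<zeta> ^ n = w"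
proof
  show "exp (Ln w / of_nat n) ^ n = w" using assms by (simp flip: exp_of_nat_mult)
qed

text \<open>Elements are adjoined one at a time; each extension succeeds because nonzero complex
  numbers have roots of every positive order.\<close>

lemma char_on_extend:
  assumes G: "finite G" "add_subgroup G" and H: "add_subgroup H" "H \<subseteq> G" "char_on H \<psi>"
  shows "\<exists>\<psi>'. char_on G \<psi>' \<and> (\<forall>h\<in>H. \<psi>' h = \<psi> h)"
  using H
proof (induction "card (G - H)" arbitrary: H \<psi> rule: less_induct)
  case less
  show ?case
  proof (cases "G = H")
    case False
    then obtain g where g: "g \<in> G" "g \<notin> H" using less.prems(2) by blast
    define n where "n = (LEAST n. n > 0 \<and> nat_mult n g \<in> H)"
    have n: "n > 0" "nat_mult n g \<in> H"
      using LeastI_ex[OF nat_mult_in_subgroup[OF G less.prems(1) g(1)]] unfolding n_def by blast+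
    have least: "nat_mult m g \<notin> H" if "0 < m" "m < n" for m
      using not_less_Least[of m "\<lambda>n. n > 0 \<and> nat_mult n g \<in> H"] that unfolding n_def by blast
    have "\<psi> (nat_mult n g) \<noteq> 0"
      using less.prems(3) n(2) unfolding char_on_def by (metis norm_zero zero_neq_one)
    then obtain \<zeta> where \<zeta>: "\<zeta> ^ n = \<psi> (nat_mult n g)" using exists_root[OF n(1)] by blast
    let ?H = "{h + nat_mult i g | h i. h \<in> H}"
    obtain \<psi>1 where \<psi>1: "add_subgroup ?H" "char_on ?H \<psi>1" "\<And>h. h \<in> H \<Longrightarrow> \<psi>1 h = \<psi> h"
      using char_on_extend_one[OF less.prems(1,3) n least \<zeta>] by blast
    have sub: "?H \<subseteq> G"
      using G(2) less.prems(2) add_subgroup_nat_mult[OF G(2) g(1)] unfolding add_subgroup_def by blast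
    have HH: "H \<subseteq> ?H"
    proof
      fix h assume "h \<in> H"
      then have "h + nat_mult 0 g \<in> ?H" by blast
      then show "h \<in> ?H" by simp
    qed
    have "0 + nat_mult 1 g \<in> ?H" using less.prems(1) unfolding add_subgroup_def by blast
    then have "g \<in> ?H" by simp
    then have "G - ?H \<subset> G - H" using g HH by blast
    then have "card (G - ?H) < card (G - H)" using G(1) by (intro psubset_card_mono) auto
    from less.hyps[OF this \<psi>1(1) sub \<psi>1(2)] obtain \<psi>' where
      \<psi>': "char_on G \<psi>'" "\<forall>h\<in>?H. \<psi>' h = \<psi>1 h" by blast
    have "\<psi>' h = \<psi> h" if "h \<in> H" for h
      using \<psi>'(2) subsetD[OF HH that] \<psi>1(3)[OF that] by (simp only:)
    then show ?thesis using \<psi>'(1) by blast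
  qed (use less.prems in blast)
qed

text \<open>Extend the trivial character of \<open>H\<close>, giving \<open>b\<close> as value a
  primitive root of unity whose order is the order of \<open>b\<close> modulo \<open>H\<close>. This
  order is at least 2 because \<open>b\<close> is not in \<open>H\<close>.\<close>

lemma char_on_separates:
  assumes G: "finite G" "add_subgroup G" and H: "add_subgroup H" "H \<subseteq> G" and b: "b \<in> G" "b \<notin> H"
  obtains \<psi> where "char_on G \<psi>" "\<And>h. h \<in> H \<Longrightarrow> \<psi> h = 1" "\<psi> b \<noteq> 1"
proof -
  define n where "n = (LEAST n. n > 0 \<and> nat_mult n b \<in> H)"
  have n: "n > 0" "nat_mult n b \<in> H"
    using LeastI_ex[OF nat_mult_in_subgroup[OF G H(1) b(1)]] unfolding n_def by blast+
  have least: "nat_mult m b \<notin> H" if "0 < m" "m < n" for m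
    using not_less_Least[of m "\<lambda>n. n > 0 \<and> nat_mult n b \<in> H"] that unfolding n_def by blast
  have "n \<noteq> 1" using n b(2) by auto
  then have n2: "n \<ge> 2" using n(1) by simp
  define \<zeta> where "\<zeta> = cis (2 * pi / n)"
  have \<zeta>: "\<zeta> ^ n = 1" unfolding \<zeta>_def Complex.DeMoivre using n(1) by simp
  have "\<zeta> \<noteq> 1"
  proof
    assume "\<zeta> = 1"
    then have "cos (2 * pi / n) = 1" unfolding \<zeta>_def by (metis cis.sel(1) one_complex.sel(1))
    moreover have "2 * pi / n \<le> pi" "0 < 2 * pi / n" using n2 by (auto simp: field_simps)
    ultimately show False using cos_monotone_0_pi[of 0 "2 * pi / n"] by simp
  qed
  have one: "char_on H (\<lambda>_. 1)" by (simp add: char_on_def)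
  let ?H = "{h + nat_mult i b | h i. h \<in> H}"
  obtain \<psi>1 where \<psi>1: "add_subgroup ?H" "char_on ?H \<psi>1" "\<And>h. h \<in> H \<Longrightarrow> \<psi>1 h = 1" "\<psi>1 b = \<zeta>"
    using char_on_extend_one[OF H(1) one n least \<zeta>] by blast
  have "?H \<subseteq> G"
    using G(2) H(2) add_subgroup_nat_mult[OF G(2) b(1)] unfolding add_subgroup_def by blast
  from char_on_extend[OF G \<psi>1(1) this \<psi>1(2)] obtain \<psi> where \<psi>: "char_on G \<psi>" "\<forall>h\<in>?H. \<psi> h = \<psi>1 h"
    by blast
  have "h + nat_mult 0 b \<in> ?H" if "h \<in> H" for h using that by blast
  then have "h \<in> ?H" if "h \<in> H" for h using that by simp
  moreover have "0 + nat_mult 1 b \<in> ?H" using H(1) unfolding add_subgroup_def by blast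
  then have "b \<in> ?H" by simp
  ultimately show ?thesis using \<psi> \<psi>1(3,4) \<open>\<zeta> \<noteq> 1\<close> by (intro that[of \<psi>]) auto
qed

section \<open>The dual of the alphabet and the orthogonality relations\<close>

definition dual_group :: "('a::ab_group_add \<Rightarrow> complex) set" where
  "dual_group = {\<psi>. char_on UNIV \<psi>}"

lemma add_subgroup_UNIV: "add_subgroup UNIV"
  by (simp add: add_subgroup_def)

text \<open>All values are roots of unity of order dividing \<open>CARD('a)\<close>: compare the
  product of all values with the same product reindexed by a translation.\<close>

lemma finite_dual_group: "finite (dual_group :: ('a::{finite, ab_group_add} \<Rightarrow> complex) set)"
proof -
  have root: "\<psi> a ^ CARD('a) = 1" if "\<psi> \<in> dual_group" for \<psi> and a :: 'a
  proof -
    have mul: "\<psi> (x + y) = \<psi> x * \<psi> y" and nz: "norm (\<psi> x) = 1" for x y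
      using that by (auto simp: dual_group_def char_on_def)
    have "(\<Prod>x\<in>UNIV. \<psi> x) = (\<Prod>x\<in>UNIV. \<psi> (a + x))"
      by (rule prod.reindex_bij_betw[symmetric]) (rule bij_plus)
    also have "\<dots> = \<psi> a ^ CARD('a) * (\<Prod>x\<in>UNIV. \<psi> x)" by (simp add: mul prod.distrib)
    finally have "(\<psi> a ^ CARD('a) - 1) * (\<Prod>x\<in>UNIV. \<psi> x) = 0" by (simp add: algebra_simps)
    moreover have "(\<Prod>x\<in>UNIV. \<psi> x) \<noteq> 0"
    proof -
      have "\<psi> x \<noteq> 0" for x using nz[of x] by auto
      then show ?thesis by simp
    qed
    ultimately show ?thesis by simp
  qed
  have "dual_group \<subseteq> {\<psi>. \<forall>a :: 'a. \<psi> a \<in> {z. z ^ CARD('a) = 1}}" using root by blast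
  moreover have "finite {\<psi>. \<forall>a :: 'a. \<psi> a \<in> {z :: complex. z ^ CARD('a) = 1}}"
  proof -
    have "finite {z :: complex. z ^ CARD('a) = 1}"
      by (rule card_ge_0_finite) (simp add: card_complex_roots_unity Suc_leI)
    then show ?thesis
      using finite_set_of_finite_funs[of "UNIV :: 'a set" "{z :: complex. z ^ CARD('a) = 1}" undefined] by simp
  qed
  ultimately show ?thesis by (rule finite_subset)
qed

text \<open>Reindexing by a translation multiplies the sum by a value different from 1.\<close>

lemma sum_nontrivial_character:
  fixes \<psi> :: "'a::{finite, ab_group_add} \<Rightarrow> complex"
  assumes "\<psi> \<in> dual_group" "\<psi> \<noteq> (\<lambda>_. 1)"
  shows "(\<Sum>a\<in>UNIV. \<psi> a) = 0"
proof -
  obtain b where b: "\<psi> b \<noteq> 1" using assms(2) by blast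
  have "(\<Sum>a\<in>UNIV. \<psi> a) = (\<Sum>a\<in>UNIV. \<psi> (b + a))"
    by (rule sum.reindex_bij_betw[symmetric]) (rule bij_plus)
  also have "\<dots> = \<psi> b * (\<Sum>a\<in>UNIV. \<psi> a)"
    using assms(1) by (simp add: dual_group_def char_on_def sum_distrib_left)
  finally have "(\<psi> b - 1) * (\<Sum>a\<in>UNIV. \<psi> a) = 0" by (simp add: algebra_simps)
  then show ?thesis using b by simp
qed

text \<open>For \<open>a \<noteq> 0\<close>, multiplication by a character that separates
  \<open>a\<close> from 0 permutes the dual group and scales the sum. The total is kept as the size
  of the dual group, by which \<open>window_function_expansion\<close> divides.\<close>

lemma sum_dual_group:
  fixes a :: "'a::{finite, ab_group_add}"
  shows "(\<Sum>\<psi>\<in>dual_group. \<psi> a) = (if a = 0 then of_nat (card (dual_group :: ('a \<Rightarrow> complex) set)) else 0)"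
proof (cases "a = 0")
  case True
  have "\<psi> 0 = 1" if "\<psi> \<in> dual_group" for \<psi> :: "'a \<Rightarrow> complex"
    using that char_on_0[OF add_subgroup_UNIV] by (simp add: dual_group_def)
  then have "(\<Sum>\<psi>\<in>dual_group. \<psi> a) = (\<Sum>\<psi>\<in>(dual_group :: ('a \<Rightarrow> complex) set). 1)"
    using True by (intro sum.cong) auto
  then show ?thesis using True by simp
next
  case False
  have "add_subgroup {0 :: 'a}" by (simp add: add_subgroup_def)
  then obtain \<theta> where \<theta>: "\<theta> \<in> dual_group" "\<theta> a \<noteq> 1"
    using char_on_separates[OF finite_class.finite_UNIV add_subgroup_UNIV, of "{0}" a] False
    by (auto simp: dual_group_def)
  have \<theta>n: "norm (\<theta> x) = 1" for x using \<theta>(1) by (auto simp: dual_group_def char_on_def)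
  have \<theta>0: "\<theta> x \<noteq> 0" for x using \<theta>n[of x] by auto
  have "bij_betw (\<lambda>\<psi> x. \<theta> x * \<psi> x) dual_group dual_group"
  proof (rule bij_betw_byWitness[where f' = "\<lambda>\<psi> x. \<psi> x / \<theta> x"])
    show "(\<lambda>\<psi> x. \<theta> x * \<psi> x) ` dual_group \<subseteq> dual_group" "(\<lambda>\<psi> x. \<psi> x / \<theta> x) ` dual_group \<subseteq> dual_group"
      using \<theta>(1) \<theta>n by (auto simp: dual_group_def char_on_def norm_mult norm_divide)
  qed (auto simp: \<theta>0)
  then have "(\<Sum>\<psi>\<in>dual_group. \<psi> a) = (\<Sum>\<psi>\<in>dual_group. \<theta> a * \<psi> a)"
    by (rule sum.reindex_bij_betw[where g = "\<lambda>\<psi>. \<psi> a", symmetric])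
  also have "\<dots> = \<theta> a * (\<Sum>\<psi>\<in>dual_group. \<psi> a)" by (simp only: sum_distrib_left)
  finally have "(\<theta> a - 1) * (\<Sum>\<psi>\<in>dual_group. \<psi> a) = 0" by (simp add: left_diff_distrib)
  then show ?thesis using \<theta>(2) False by simp
qed

lemma card_dual_group_pos: "card (dual_group :: ('a::{finite, ab_group_add} \<Rightarrow> complex) set) > 0"
proof -
  have "(\<lambda>_. 1) \<in> (dual_group :: ('a \<Rightarrow> complex) set)" by (simp add: dual_group_def char_on_def)
  then show ?thesis using finite_dual_group card_gt_0_iff by blast
qed

subsection \<open>The dual system\<close>

lemma characterI:
  fixes \<xi> :: "'a::ab_group_add config \<Rightarrow> complex"
  assumes "\<And>x. norm (\<xi> x) = 1" "\<And>x y. \<xi> (x + y) = \<xi> x * \<xi> y"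
    and "finite K" "\<And>x. (\<And>k. k \<in> K \<Longrightarrow> x k = 0) \<Longrightarrow> \<xi> x = 1"
  shows "character \<xi>"
  unfolding character_def
proof (intro conjI allI)
  show "continuous_map config_topology euclidean \<xi>"
  proof (rule continuous_map_window[OF assms(3)])
    fix x y :: "'a config" assume "\<And>k. k \<in> K \<Longrightarrow> y k = x k"
    then have "\<xi> (y - x) = 1" by (intro assms(4)) simp
    then have "\<xi> (y - x + x) = \<xi> x" by (simp only: assms(2) mult_1)
    then show "\<xi> y = \<xi> x" by (simp only: diff_add_cancel)
  qed
qed (use assms in auto)

lemma character_comp:
  assumes "character \<xi>" "additive_ca G r"
  shows "character (\<lambda>x. \<xi> (G x))"
proof -
  interpret additive_ca G r by fact
  have "continuous_map config_topology euclidean (\<xi> \<circ> G)"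
    using assms(1) continuous continuous_map_compose unfolding character_def by blast
  moreover have "\<xi> (G (x + y)) = \<xi> (G x) * \<xi> (G y)" for x y
    using assms(1) unfolding character_def add by blast
  ultimately show ?thesis using assms(1) unfolding character_def comp_def by blast
qed

lemma character_translate:
  fixes \<xi> :: "'a::ab_group_add config \<Rightarrow> complex"
  assumes "character \<xi>"
  shows "character (\<lambda>x. \<xi> (translate s x))"
  by (rule character_comp[OF assms additive_ca_translate])

lemma char_at_in_dual_group:
  assumes "character \<xi>"
  shows "char_at \<xi> k \<in> dual_group"
  using char_at_character[OF assms] by (simp add: dual_group_def char_on_def)

lemma restr_single: "restr I (single k a) = (if k \<in> I then single k a else 0)"
  by (auto simp: restr_def single_def fun_eq_iff)

lemma char_supp_empty_iff:
  assumes "character \<xi>"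
  shows "char_supp \<xi> = {} \<longleftrightarrow> \<xi> = (\<lambda>_. 1)"
proof
  assume "char_supp \<xi> = {}"
  then show "\<xi> = (\<lambda>_. 1)" using character_eq_prod[OF assms] by (simp add: fun_eq_iff)
qed (simp add: char_supp_def char_at_def)

text \<open>
  A character is encoded as the finite configuration of its factors, shifted by \<open>1\<close> so that trivial
  factors become zeros. On these configurations \<open>\<xi> \<mapsto> \<xi> \<circ> F\<close> is again a local, quiescent and
  translation-invariant system.
\<close>

definition encode :: "('a::ab_group_add config \<Rightarrow> complex) \<Rightarrow> ('a \<Rightarrow> complex) config" where
  "encode \<xi> = (\<lambda>k a. char_at \<xi> k a - 1)"

definition decode :: "('a::ab_group_add \<Rightarrow> complex) config \<Rightarrow> 'a config \<Rightarrow> complex" where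
  "decode d x = (\<Prod>k\<in>supp d. d k (x k) + 1)"

definition dual_map :: "('a::ab_group_add config \<Rightarrow> 'a config) \<Rightarrow>
    ('a \<Rightarrow> complex) config \<Rightarrow> ('a \<Rightarrow> complex) config" where
  "dual_map F d = encode (\<lambda>x. decode d (F x))"

lemma supp_encode: "supp (encode \<xi>) = char_supp \<xi>"
  by (auto simp: supp_def char_supp_def encode_def fun_eq_iff)

lemma decode_encode: "character \<xi> \<Longrightarrow> decode (encode \<xi>) = \<xi>"
  unfolding fun_eq_iff decode_def supp_encode by (simp add: encode_def character_eq_prod)

lemma encode_inject: "character \<xi> \<Longrightarrow> character \<xi>' \<Longrightarrow> encode \<xi> = encode \<xi>' \<Longrightarrow> \<xi> = \<xi>'"
  by (metis decode_encode)

lemma character_trivial: "character (\<lambda>_. 1)"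
  by (rule characterI[where K = "{}"]) auto

lemma encode_trivial: "encode (\<lambda>_. 1) = 0"
  by (simp add: encode_def char_at_def fun_eq_iff)

lemma dual_map_encode:
  assumes "character \<xi>"
  shows "dual_map F (encode \<xi>) = encode (\<lambda>x. \<xi> (F x))"
  by (simp add: dual_map_def decode_encode[OF assms])

lemma dual_map_funpow:
  assumes "additive_ca F r" "character \<xi>"
  shows "(dual_map F ^^ n) (encode \<xi>) = encode (\<lambda>x. \<xi> ((F ^^ n) x))"
  using assms(2)
proof (induction n arbitrary: \<xi>)
  case (Suc n)
  have "(dual_map F ^^ Suc n) (encode \<xi>) = (dual_map F ^^ n) (encode (\<lambda>x. \<xi> (F x)))"
    by (simp only: funpow_Suc_right comp_apply dual_map_encode[OF Suc.prems])
  also have "\<dots> = encode (\<lambda>x. \<xi> (F ((F ^^ n) x)))"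
    by (rule Suc.IH) (rule character_comp[OF Suc.prems assms(1)])
  finally show ?case by simp
qed simp

text \<open>The sign changes because \<open>translate s\<close> moves the probe
  \<open>single k a\<close> to cell \<open>k - s\<close>.\<close>

lemma encode_translate: "encode (\<lambda>x. \<xi> (translate s x)) = translate (- s) (encode \<xi>)"
proof -
  have "translate s (single k a) = single (k - s) a" for k and a :: 'a
    by (auto simp: translate_def single_def fun_eq_iff)
  then show ?thesis by (simp add: encode_def char_at_def translate_def fun_eq_iff)
qed

text \<open>The factor of \<open>\<xi> \<circ> F\<close> at cell \<open>i\<close> is found by
  evaluating \<xi> on \<open>F (single i a)\<close>, which is supported within distance
  \<open>r\<close> of \<open>i\<close>; so only the factors of \<xi> there matter. Restricting an
  encoding corresponds to composing with \<open>restr I\<close>, and the common finite set of values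
  comes from the finite dual group.\<close>

lemma local_system_dual:
  fixes F :: "'a::{finite, ab_group_add} config \<Rightarrow> 'a config"
  assumes "additive_ca F r"
  shows "local_system (dual_map F) (encode ` {\<xi>. character \<xi>}) r"
proof -
  interpret F: additive_ca F r by fact
  show ?thesis
  proof
    fix d :: "('a \<Rightarrow> complex) config" assume "d \<in> encode ` {\<xi>. character \<xi>}"
    then obtain \<xi> where \<xi>: "d = encode \<xi>" "character \<xi>" by blast
    show "dual_map F d \<in> encode ` {\<xi>. character \<xi>}"
      using \<xi>(2) character_comp[OF \<xi>(2) assms] unfolding \<xi>(1) dual_map_encode[OF \<xi>(2)] by blast
    show "finite (supp d)" unfolding \<xi>(1) supp_encode by (rule finite_char_supp[OF \<xi>(2)])
    fix I
    have mul: "\<xi> (x + y) = \<xi> x * \<xi> y" for x y using \<xi>(2) unfolding character_def by blast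
    have "restr I (x + y) = restr I x + restr I y" for x y :: "'a config"
      by (auto simp: restr_def fun_eq_iff)
    then have "character (\<lambda>x. \<xi> (restr I x))"
      using \<xi>(2) mul
    proof (intro characterI[where K = "char_supp \<xi>"])
      fix x :: "'a config" assume x: "\<And>k. k \<in> char_supp \<xi> \<Longrightarrow> x k = 0"
      have "char_at \<xi> k 0 = 1" for k
        using character_zero[OF \<xi>(2)] by (simp only: char_at_def single_zero)
      then show "\<xi> (restr I x) = 1"
        unfolding character_eq_prod[OF \<xi>(2), of "restr I x"]
        by (intro prod.neutral ballI) (simp add: restr_def x)
    qed (auto simp: finite_char_supp character_def)
    moreover have "restr I (encode \<xi>) = encode (\<lambda>x. \<xi> (restr I x))"
    proof (intro ext)
      fix k a
      have "\<xi> (restr I (single k a)) = (if k \<in> I then \<xi> (single k a) else 1)"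
        unfolding restr_single using character_zero[OF \<xi>(2)] by (cases "k \<in> I") (simp_all only: if_True if_False)
      then show "restr I (encode \<xi>) k a = encode (\<lambda>x. \<xi> (restr I x)) k a"
        by (simp add: encode_def char_at_def restr_def)
    qed
    ultimately show "restr I d \<in> encode ` {\<xi>. character \<xi>}" unfolding \<xi>(1) by blast
    fix e :: "('a \<Rightarrow> complex) config" and i
    assume "e \<in> encode ` {\<xi>. character \<xi>}" and eq: "\<And>j. j \<in> iball i r \<Longrightarrow> d j = e j"
    then obtain \<xi>' where \<xi>': "e = encode \<xi>'" "character \<xi>'" by blast
    have at: "char_at \<xi> j b = char_at \<xi>' j b" if "j \<in> iball i r" for j b
      using fun_cong[OF eq[OF that], of b] unfolding \<xi>(1) \<xi>'(1) encode_def by simp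
    have "\<xi> (F (single i a)) = \<xi>' (F (single i a))" for a
    proof -
      have "supp (F (single i a)) \<subseteq> {i - int r..<i + 1 + int r}"
        by (rule F.supp_image) (auto simp: supp_def single_def split: if_splits)
      then have supp: "F (single i a) j = 0" if "j \<notin> iball i r" for j
        using that by (auto simp: supp_def)
      have "(\<lambda>j. if j \<in> iball i r then F (single i a) j else 0) = F (single i a)"
      proof
        fix j
        show "(if j \<in> iball i r then F (single i a) j else 0) = F (single i a) j"
          using supp[of j] by (cases "j \<in> iball i r") (simp_all only: if_True if_False not_False_eq_True)
      qed
      then have "\<xi> (F (single i a)) = (\<Prod>j\<in>iball i r. char_at \<xi> j (F (single i a) j))"
        "\<xi>' (F (single i a)) = (\<Prod>j\<in>iball i r. char_at \<xi>' j (F (single i a) j))"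
        using character_finite_part[OF \<xi>(2), of "iball i r" "F (single i a)"]
          character_finite_part[OF \<xi>'(2), of "iball i r" "F (single i a)"] by simp_all
      then show ?thesis using at by (simp only: cong: prod.cong)
    qed
    then show "dual_map F d i = dual_map F e i"
      unfolding \<xi>(1) \<xi>'(1) dual_map_encode[OF \<xi>(2)] dual_map_encode[OF \<xi>'(2)]
      by (simp add: encode_def char_at_def)
  next
    show "dual_map F 0 = 0"
      using dual_map_encode[OF character_trivial, of F] by (simp only: encode_trivial)
    let ?B = "(\<lambda>\<psi> a. \<psi> a - 1) ` (dual_group :: ('a \<Rightarrow> complex) set)"
    have "\<forall>d\<in>encode ` {\<xi> :: 'a config \<Rightarrow> complex. character \<xi>}. \<forall>i. d i \<in> ?B"
      using char_at_in_dual_group by (auto simp: encode_def)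
    then show "\<exists>B. finite B \<and> (\<forall>d\<in>encode ` {\<xi> :: 'a config \<Rightarrow> complex. character \<xi>}. \<forall>i. d i \<in> B)"
      using finite_dual_group by blast
  qed
qed

lemma local_system_finite_configs:
  fixes F :: "'a::{finite, ab_group_add} config \<Rightarrow> 'a config"
  assumes "additive_ca F r"
  shows "local_system F {x. finite (supp x)} r"
proof -
  interpret F: additive_ca F r by fact
  show ?thesis
  proof
    show "\<exists>B. finite B \<and> (\<forall>x\<in>{x :: 'a config. finite (supp x)}. \<forall>i. x i \<in> B)"
      by (rule exI[of _ UNIV]) simp
  qed (auto simp: F.finite_supp_image supp_restr F.map_zero intro: F.local)
qed

text \<open>
  The next two lemmas, applied to \<open>F\<^sup>q - \<sigma>\<^sup>s\<close> and \<open>F\<^sup>q\<close>, transfer recurrence between finite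
  configurations and characters; this replaces an identification of the alphabet with its dual.
\<close>

lemma annihilated_config_of_character:
  fixes G :: "'a::{finite, ab_group_add} config \<Rightarrow> 'a config"
  assumes "additive_ca G r" "character \<xi>" "\<xi> \<noteq> (\<lambda>_. 1)" "\<And>x. \<xi> (G x) = 1"
  obtains x where "finite (supp x)" "x \<noteq> 0" "G x = 0"
proof -
  interpret additive_ca G r by fact
  obtain c m where cm: "char_supp \<xi> \<subseteq> {c..<c + int m}"
    using finite_subset_interval[OF finite_char_supp[OF assms(2)]] .
  have win: "\<xi> (restr {c..<c + int m} x) = \<xi> x" for x
    unfolding character_eq_prod[OF assms(2), of "restr {c..<c + int m} x"]
      character_eq_prod[OF assms(2), of x]
  proof (rule prod.cong[OF refl])
    fix k assume "k \<in> char_supp \<xi>"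
    then have "k \<in> {c..<c + int m}" using cm by blast
    then show "char_at \<xi> k (restr {c..<c + int m} x k) = char_at \<xi> k (x k)" by (simp add: restr_def)
  qed
  \<comment> \<open>If every pattern on a window containing the support of \<xi> occurred in the
    range of \<open>G\<close>, then \<xi> would be trivial.\<close>
  have "restr {0..<int m} ` range G \<noteq> window {0..<int m}"
  proof
    assume eq: "restr {0..<int m} ` range G = window {0..<int m}"
    have "\<xi> z = 1" for z
    proof -
      have "restr {0..<int m} (translate c z) \<in> restr {0..<int m} ` range G"
        unfolding eq by (rule restr_in_window)
      then obtain y where y: "restr {0..<int m} (translate c z) = restr {0..<int m} (G y)"
        by (elim imageE) (simp only:)
      have tr: "translate (- c) (restr {0..<int m} x) = restr {c..<c + int m} (translate (- c) x)"
        for x :: "'a config"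
        by (auto simp: translate_def restr_def fun_eq_iff)
      have "restr {c..<c + int m} z = restr {c..<c + int m} (G (translate (- c) y))"
        using arg_cong[OF y, of "translate (- c)"] unfolding tr equivariant by simp
      then have "\<xi> z = \<xi> (G (translate (- c) y))" by (metis win)
      then show ?thesis by (simp only: assms(4))
    qed
    then show False using assms(3) by blast
  qed
  from myhill[OF assms(1) this] show ?thesis using that by blast
qed

lemma annihilating_character_of_config:
  fixes G :: "'a::{finite, ab_group_add} config \<Rightarrow> 'a config"
  assumes "additive_ca G r" "finite (supp x)" "x \<noteq> 0" "G x = 0"
  obtains \<xi> where "character \<xi>" "\<xi> \<noteq> (\<lambda>_. 1)" "\<And>x. \<xi> (G x) = 1"
proof -
  interpret additive_ca G r by fact
  obtain n where n: "restr {0..<int n} ` range G \<noteq> window {0..<int n}" using moore[OF assms] by blast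
  let ?I = "{0..<int n}"
  have radd: "restr I (x + y) = restr I x + restr I y" for I and x y :: "'a config"
    by (auto simp: restr_def fun_eq_iff)
  have rneg: "restr I (- x) = - restr I x" for I and x :: "'a config"
    by (auto simp: restr_def fun_eq_iff)
  have r0: "restr I 0 = (0 :: 'a config)" for I by (auto simp: restr_def fun_eq_iff)
  have Gneg: "G (- x) = - G x" for x using diff[of 0 x] by (simp only: map_zero diff_0)
  have H: "add_subgroup (restr ?I ` range G)"
    unfolding add_subgroup_def
  proof (intro conjI ballI)
    have "0 = restr ?I (G 0)" by (simp only: map_zero r0)
    then show "0 \<in> restr ?I ` range G" by blast
    fix x assume "x \<in> restr ?I ` range G"
    then obtain u where u: "x = restr ?I (G u)" by (elim imageE) (simp only:)
    then have "- x = restr ?I (G (- u))" by (simp only: rneg Gneg)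
    then show "- x \<in> restr ?I ` range G" by blast
    fix y assume "y \<in> restr ?I ` range G"
    then obtain v where "y = restr ?I (G v)" by (elim imageE) (simp only:)
    then have "x + y = restr ?I (G (u + v))" by (simp only: u radd add)
    then show "x + y \<in> restr ?I ` range G" by blast
  qed
  have W: "add_subgroup (window ?I :: 'a config set)"
    unfolding add_subgroup_def
  proof (intro conjI ballI)
    show "0 \<in> window ?I" by (simp add: window_def supp_def)
    show "- x \<in> window ?I" if "x \<in> window ?I" for x :: "'a config"
      using that by (simp add: window_def supp_def)
  qed (rule window_add)
  have sub: "restr ?I ` range G \<subseteq> window ?I" using restr_in_window by blast
  then obtain b where b: "b \<in> window ?I" "b \<notin> restr ?I ` range G" using n by blast
  \<comment> \<open>The patterns of the range form a proper subgroup of the window group; a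
    character separating a missing pattern from it is read as a character of configurations.\<close>
  obtain \<psi> where \<psi>: "char_on (window ?I) \<psi>" "\<And>h. h \<in> restr ?I ` range G \<Longrightarrow> \<psi> h = 1" "\<psi> b \<noteq> 1"
    using char_on_separates[OF finite_window[OF finite_atLeastLessThan_int] W H sub b] by blast
  show ?thesis
  proof (rule that[of "\<lambda>x. \<psi> (restr ?I x)"])
    show "character (\<lambda>x. \<psi> (restr ?I x))"
    proof (rule characterI[where K = "?I"])
      fix x y :: "'a config"
      show "norm (\<psi> (restr ?I x)) = 1" "\<psi> (restr ?I (x + y)) = \<psi> (restr ?I x) * \<psi> (restr ?I y)"
        using \<psi>(1) restr_in_window unfolding char_on_def radd by blast+
    next
      fix x :: "'a config" assume "\<And>k. k \<in> ?I \<Longrightarrow> x k = 0"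
      then have "restr ?I x = 0" by (auto simp: restr_def fun_eq_iff)
      then show "\<psi> (restr ?I x) = 1" using char_on_0[OF W \<psi>(1)] by simp
    qed simp
    show "(\<lambda>x. \<psi> (restr ?I x)) \<noteq> (\<lambda>_. 1)" using \<psi>(3) restr_window[OF b(1)] by metis
    show "\<psi> (restr ?I (G x)) = 1" for x by (rule \<psi>(2)) blast
  qed
qed

section \<open>Recurrence as a kernel condition, and diffusion in density\<close>

lemma translate_0_right [simp]: "translate s 0 = 0"
  by (simp add: translate_def fun_eq_iff)

lemma recurrence_as_kernel:
  fixes F :: "'a::ab_group_add config \<Rightarrow> 'a config"
  assumes "additive_ca F r"
  shows "\<exists>r'. additive_ca (\<lambda>x. (F ^^ q) x - translate s x) r'"
proof -
  let ?r = "max (r * q) (nat \<bar>s\<bar>)"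
  have "additive_ca (F ^^ q) ?r"
    by (rule additive_ca.mono_radius[OF additive_ca_funpow[OF assms]]) simp
  moreover have "additive_ca (translate s :: 'a config \<Rightarrow> _) ?r"
    by (rule additive_ca.mono_radius[OF additive_ca_translate]) simp
  ultimately show ?thesis using additive_ca_diff by blast
qed

lemma character_diff_eq_1_iff:
  assumes "character \<xi>"
  shows "\<xi> (x - y) = 1 \<longleftrightarrow> \<xi> x = \<xi> y"
proof -
  have "\<xi> (x - y + y) = \<xi> (x - y) * \<xi> y" "norm (\<xi> y) = 1" using assms unfolding character_def by blast+
  then have "\<xi> x = \<xi> (x - y) * \<xi> y" "\<xi> y \<noteq> 0" by (auto simp only: diff_add_cancel norm_zero zero_neq_one)
  then show ?thesis by simp
qed

theorem diffusion_of_configs: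
  fixes F :: "'a::{finite, ab_group_add} config \<Rightarrow> 'a config"
  assumes "additive_ca F r" "\<nexists>c. soliton F c" "finite (supp c)" "c \<noteq> 0"
  shows "zero_density {t. config_rank ((F ^^ t) c) \<le> k}"
proof (rule ccontr)
  assume "\<not> zero_density {t. config_rank ((F ^^ t) c) \<le> k}"
  with local_system.low_rank_recurrence[OF local_system_finite_configs[OF assms(1)], of c k] assms(3,4)
  obtain y q where "finite (supp y)" "y \<noteq> 0" "q > 0" "(F ^^ q) y = 0 \<or> (\<exists>s. (F ^^ q) y = translate s y)"
    by auto
  then show False using soliton_if_recurrent[OF assms(1)] assms(2) by blast
qed

theorem diffusion_of_characters:
  fixes F :: "'a::{finite, ab_group_add} config \<Rightarrow> 'a config"
  assumes "additive_ca F r" "\<nexists>c. soliton F c" "character \<xi>" "\<xi> \<noteq> (\<lambda>_. 1)"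
  shows "zero_density {t. char_rank (\<lambda>x. \<xi> ((F ^^ t) x)) \<le> k}"
proof (rule ccontr)
  assume nz: "\<not> zero_density {t. char_rank (\<lambda>x. \<xi> ((F ^^ t) x)) \<le> k}"
  have rank: "config_rank ((dual_map F ^^ t) (encode \<xi>)) = char_rank (\<lambda>x. \<xi> ((F ^^ t) x))" for t
    by (simp only: dual_map_funpow[OF assms(1,3)] config_rank_def char_rank_def supp_encode)
  have "encode \<xi> \<noteq> 0" using encode_inject[OF assms(3) character_trivial] assms(4) encode_trivial by metis
  with local_system.low_rank_recurrence[OF local_system_dual[OF assms(1)], of "encode \<xi>" k] nz assms(3)
  obtain \<theta> q where \<theta>: "character \<theta>" "encode \<theta> \<noteq> 0" "q > 0"
    and rec: "(dual_map F ^^ q) (encode \<theta>) = 0 \<or> (\<exists>s. (dual_map F ^^ q) (encode \<theta>) = translate s (encode \<theta>))"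
    unfolding rank by auto
  have ch: "character (\<lambda>x. \<theta> ((F ^^ q) x))"
    by (rule character_comp[OF \<theta>(1) additive_ca_funpow[OF assms(1)]])
  have nt: "\<theta> \<noteq> (\<lambda>_. 1)" using \<theta>(2) encode_trivial by metis
  from rec obtain y s where "finite (supp y)" "y \<noteq> 0" "(F ^^ q) y = 0 \<or> (F ^^ q) y = translate s y"
  proof
    assume "(dual_map F ^^ q) (encode \<theta>) = 0"
    then have "(\<lambda>x. \<theta> ((F ^^ q) x)) = (\<lambda>_. 1)"
      unfolding dual_map_funpow[OF assms(1) \<theta>(1)] encode_trivial[symmetric]
      by (rule encode_inject[OF ch character_trivial])
    then have "\<theta> ((F ^^ q) x) = 1" for x by (rule fun_cong)
    then show ?thesis
      using annihilated_config_of_character[OF additive_ca_funpow[OF assms(1)] \<theta>(1) nt] that by metis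
  next
    assume "\<exists>s. (dual_map F ^^ q) (encode \<theta>) = translate s (encode \<theta>)"
    \<comment> \<open>The double negation prepares for \<open>encode_translate\<close>, which
      reverses the sign.\<close>
    then obtain s where "(dual_map F ^^ q) (encode \<theta>) = translate (- (- s)) (encode \<theta>)" by auto
    then have "(\<lambda>x. \<theta> ((F ^^ q) x)) = (\<lambda>x. \<theta> (translate (- s) x))"
      unfolding dual_map_funpow[OF assms(1) \<theta>(1)] encode_translate[symmetric]
      by (rule encode_inject[OF ch character_translate[OF \<theta>(1)]])
    then have "\<theta> ((F ^^ q) x - translate (- s) x) = 1" for x
      unfolding character_diff_eq_1_iff[OF \<theta>(1)] by (rule fun_cong)
    moreover obtain r' where "additive_ca (\<lambda>x. (F ^^ q) x - translate (- s) x) r'"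
      using recurrence_as_kernel[OF assms(1)] by blast
    ultimately obtain y where "finite (supp y)" "y \<noteq> 0" "(F ^^ q) y - translate (- s) y = 0"
      using annihilated_config_of_character[OF _ \<theta>(1) nt] by blast
    then show ?thesis using that[of y "- s"] by simp
  qed
  then show False using soliton_if_recurrent[OF assms(1) _ _ \<theta>(3)] assms(2) by blast
qed

theorem recurrent_character_of_soliton:
  fixes F :: "'a::{finite, ab_group_add} config \<Rightarrow> 'a config"
  assumes "additive_ca F r" "soliton F c"
  obtains \<xi> q s where "character \<xi>" "\<xi> \<noteq> (\<lambda>_. 1)" "q > 0"
    "(\<forall>x. \<xi> ((F ^^ q) x) = 1) \<or> (\<forall>x. \<xi> ((F ^^ q) x) = \<xi> (translate s x))"
proof -
  obtain y q s where y: "finite (supp y)" "y \<noteq> 0" "q > 0"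
    and rec: "(F ^^ q) y = 0 \<or> (F ^^ q) y = translate s y"
    using recurrent_if_soliton[OF assms] by blast
  from rec show ?thesis
  proof
    assume "(F ^^ q) y = 0"
    from annihilating_character_of_config[OF additive_ca_funpow[OF assms(1)] y(1,2) this]
    show ?thesis using that y(3) by metis
  next
    assume e: "(F ^^ q) y = translate s y"
    obtain r' where r': "additive_ca (\<lambda>x. (F ^^ q) x - translate s x) r'"
      using recurrence_as_kernel[OF assms(1)] by blast
    obtain \<xi> where \<xi>: "character \<xi>" "\<xi> \<noteq> (\<lambda>_. 1)" "\<And>x. \<xi> ((F ^^ q) x - translate s x) = 1"
      using annihilating_character_of_config[OF r' y(1,2)] e by auto
    then show ?thesis using that[OF \<xi>(1,2) y(3)] character_diff_eq_1_iff[OF \<xi>(1)] by metis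
  qed
qed

subsection \<open>Fourier coefficients and weak convergence\<close>

lemma space_prob_measures: "\<mu> \<in> prob_measures \<Longrightarrow> space \<mu> = UNIV"
  using sets_eq_imp_space_eq[of \<mu> config_borel] by (simp add: prob_measures_def)

lemma openin_imp_sets: "\<mu> \<in> prob_measures \<Longrightarrow> openin config_topology U \<Longrightarrow> U \<in> sets \<mu>"
  by (simp add: prob_measures_def config_borel_def sets_measure_of)

lemma continuous_imp_borel_measurable:
  fixes f :: "'a config \<Rightarrow> 'b::topological_space"
  assumes "continuous_map config_topology euclidean f" "\<mu> \<in> prob_measures"
  shows "f \<in> borel_measurable \<mu>"
proof (rule borel_measurableI)
  fix S :: "'b set" assume "open S"
  then have "openin config_topology (f -` S)"
    using openin_continuous_map_preimage[OF assms(1), of S] by (simp add: vimage_def)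
  then show "f -` S \<inter> space \<mu> \<in> sets \<mu>"
    using openin_imp_sets[OF assms(2)] by (simp add: space_prob_measures[OF assms(2)])
qed

lemma continuous_imp_measurable_config_borel:
  assumes "continuous_map config_topology config_topology G" "\<mu> \<in> prob_measures"
  shows "G \<in> measurable \<mu> config_borel"
  unfolding config_borel_def
proof (rule measurable_measure_of)
  fix U :: "'b config set" assume "U \<in> {U. openin config_topology U}"
  then have "openin config_topology (G -` U)"
    using openin_continuous_map_preimage[OF assms(1), of U] by (simp add: vimage_def)
  then show "G -` U \<inter> space \<mu> \<in> sets \<mu>"
    using openin_imp_sets[OF assms(2)] by (simp add: space_prob_measures[OF assms(2)])
qed auto

lemma compact_space_config: "compact_space (config_topology :: 'a::finite config topology)"
  unfolding config_topology_def compact_space_product_topology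
  by (simp add: compact_space_discrete_topology)

text \<open>Uniform continuity by compactness: finitely many cylinders on which \<open>f\<close>
  varies little cover the space, and the union of their windows works everywhere.\<close>

lemma window_approximation:
  fixes f :: "'a::finite config \<Rightarrow> 'b::metric_space"
  assumes "continuous_map config_topology euclidean f" "\<epsilon> > 0"
  obtains W where "finite W" "\<And>x y. (\<And>k. k \<in> W \<Longrightarrow> y k = x k) \<Longrightarrow> dist (f y) (f x) < \<epsilon>"
proof -
  have ex: "\<exists>K. finite K \<and> {y. \<forall>k\<in>K. y k = x k} \<subseteq> {y. f y \<in> ball (f x) (\<epsilon>/2)}" for x
  proof -
    have "openin config_topology {y. f y \<in> ball (f x) (\<epsilon>/2)}"
      using openin_continuous_map_preimage[OF assms(1), of "ball (f x) (\<epsilon>/2)"] by simp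
    moreover have "x \<in> {y. f y \<in> ball (f x) (\<epsilon>/2)}" using assms(2) by simp
    ultimately show ?thesis by (rule open_contains_cylinder) blast
  qed
  have "\<exists>K. \<forall>x. finite (K x) \<and> {y. \<forall>k\<in>K x. y k = x k} \<subseteq> {y. f y \<in> ball (f x) (\<epsilon>/2)}"
    by (rule choice) (rule allI, rule ex)
  then obtain K where K0: "\<forall>x. finite (K x) \<and> {y. \<forall>k\<in>K x. y k = x k} \<subseteq> {y. f y \<in> ball (f x) (\<epsilon>/2)}"
    by (rule exE)
  have K: "finite (K x)" "{y. \<forall>k\<in>K x. y k = x k} \<subseteq> {y. f y \<in> ball (f x) (\<epsilon>/2)}" for x
    using K0[rule_format, THEN conjunct1] K0[rule_format, THEN conjunct2] by this
  let ?c = "\<lambda>x. {y. \<forall>k\<in>K x. y k = x k}"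
  have "\<forall>U\<in>range ?c. openin config_topology U" using openin_cylinder[OF K(1)] by blast
  moreover have "topspace config_topology \<subseteq> \<Union>(range ?c)" by auto
  ultimately obtain \<F> where \<F>: "finite \<F>" "\<F> \<subseteq> range ?c" "topspace config_topology \<subseteq> \<Union>\<F>"
    using compact_space_config[unfolded compact_space_alt, rule_format, of "range ?c"] by blast
  obtain X where X: "finite X" "\<F> = ?c ` X" using finite_subset_image[OF \<F>(1,2)] by blast
  show ?thesis
  proof (rule that[of "\<Union>(K ` X)"])
    show "finite (\<Union>(K ` X))" using X(1) K(1) by blast
    fix x y :: "'a config" assume xy: "\<And>k. k \<in> \<Union>(K ` X) \<Longrightarrow> y k = x k"
    have "x \<in> \<Union>(?c ` X)" using \<F>(3) X(2) by auto
    then obtain z where z: "z \<in> X" "x \<in> ?c z" by blast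
    have "y k = z k" if "k \<in> K z" for k
    proof -
      have "y k = x k" by (rule xy) (use that z(1) in blast)
      then show ?thesis using z(2) that by simp
    qed
    then have "y \<in> ?c z" by blast
    then have "f x \<in> ball (f z) (\<epsilon>/2)" "f y \<in> ball (f z) (\<epsilon>/2)" using z(2) K(2)[of z] by blast+
    then show "dist (f y) (f x) < \<epsilon>"
      using dist_triangle[of "f y" "f x" "f z"] by (simp add: dist_commute)
  qed
qed

lemma continuous_bounded:
  fixes f :: "'a::finite config \<Rightarrow> 'b::real_normed_vector"
  assumes "continuous_map config_topology euclidean f"
  obtains B where "\<And>x. norm (f x) \<le> B"
proof -
  have "compactin euclidean (f ` topspace config_topology)"
    using compact_space_config assms image_compactin compact_space_def by blast
  then have "bounded (range f)" by (simp add: compact_imp_bounded)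
  then show ?thesis using that unfolding bounded_iff by auto
qed

lemma continuous_integrable:
  fixes f :: "'a::finite config \<Rightarrow> 'b::{banach, second_countable_topology}"
  assumes "continuous_map config_topology euclidean f" "\<mu> \<in> prob_measures"
  shows "integrable \<mu> f"
proof -
  interpret prob_space \<mu> using assms(2) by (simp add: prob_measures_def)
  obtain B where "\<And>x. norm (f x) \<le> B" using continuous_bounded[OF assms(1)] by blast
  then show ?thesis
    using continuous_imp_borel_measurable[OF assms] by (intro integrable_const_bound[of _ B]) auto
qed

lemma fourier_coeff_push:
  assumes "additive_ca G r" "\<mu> \<in> prob_measures" "character \<xi>"
  shows "fourier_coeff (push G \<mu>) \<xi> = fourier_coeff \<mu> (\<lambda>x. \<xi> (G x))"
proof -
  have "G \<in> measurable \<mu> config_borel"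
    by (rule continuous_imp_measurable_config_borel[OF additive_ca.continuous[OF assms(1)] assms(2)])
  moreover have "\<xi> \<in> borel_measurable config_borel"
  proof (rule borel_measurableI)
    fix S :: "complex set" assume "open S"
    then have "openin config_topology (\<xi> -` S)"
      using openin_continuous_map_preimage[of config_topology euclidean \<xi> S] assms(3)
      by (simp add: character_def vimage_def)
    then show "\<xi> -` S \<inter> space config_borel \<in> sets config_borel"
      by (simp add: config_borel_def sets_measure_of)
  qed
  ultimately show ?thesis unfolding fourier_coeff_def push_def by (rule integral_distr)
qed

text \<open>A character depends on finitely many cells, which are independent, so the integral of
  the product of its factors is the product of their integrals.\<close>

lemma fourier_coeff_bernoulli:
  fixes \<xi> :: "'a::{finite, ab_group_add} config \<Rightarrow> complex"
  assumes "character \<xi>"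
  shows "fourier_coeff (bernoulli_measure \<beta>) \<xi>
    = (\<Prod>k\<in>char_supp \<xi>. \<integral>a. char_at \<xi> k a \<partial>measure_pmf \<beta>)"
proof -
  let ?J = "char_supp \<xi>" and ?M = "\<lambda>_ :: int. measure_pmf \<beta>"
  have J: "finite ?J" by (rule finite_char_supp[OF assms])
  interpret product_prob_space ?M UNIV by unfold_locales
  have "fourier_coeff (bernoulli_measure \<beta>) \<xi>
      = (\<integral>x. (\<Prod>k\<in>?J. char_at \<xi> k (restrict x ?J k)) \<partial>PiM UNIV ?M)"
    unfolding fourier_coeff_def bernoulli_measure_def
    by (intro Bochner_Integration.integral_cong refl) (simp add: character_eq_prod[OF assms])
  also have "\<dots> = (\<integral>y. (\<Prod>k\<in>?J. char_at \<xi> k (y k)) \<partial>distr (PiM UNIV ?M) (PiM ?J ?M) (\<lambda>x. restrict x ?J))"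
  proof (rule integral_distr[symmetric])
    show "(\<lambda>x. restrict x ?J) \<in> measurable (PiM UNIV ?M) (PiM ?J ?M)"
      by (rule measurable_restrict_subset) simp
    show "(\<lambda>y. \<Prod>k\<in>?J. char_at \<xi> k (y k)) \<in> borel_measurable (PiM ?J ?M)"
    proof (rule borel_measurable_prod)
      fix k assume "k \<in> ?J"
      then show "(\<lambda>y. char_at \<xi> k (y k)) \<in> borel_measurable (PiM ?J ?M)"
        by (intro measurable_compose[OF measurable_component_singleton]) auto
    qed
  qed
  also have "\<dots> = (\<integral>y. (\<Prod>k\<in>?J. char_at \<xi> k (y k)) \<partial>PiM ?J ?M)"
    using distr_PiM_restrict_finite[OF J] by simp
  also have "\<dots> = (\<Prod>k\<in>?J. \<integral>a. char_at \<xi> k a \<partial>measure_pmf \<beta>)"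
    using J by (intro product_integral_prod) (auto intro!: integrable_measure_pmf_finite)
  finally show ?thesis .
qed

lemma fourier_coeff_bernoulli_translate:
  fixes \<xi> :: "'a::{finite, ab_group_add} config \<Rightarrow> complex"
  assumes "character \<xi>"
  shows "fourier_coeff (bernoulli_measure \<beta>) (\<lambda>x. \<xi> (translate s x)) = fourier_coeff (bernoulli_measure \<beta>) \<xi>"
proof -
  have at: "char_at (\<lambda>x. \<xi> (translate s x)) k = char_at \<xi> (k - s)" for k
  proof -
    have "translate s (single k a) = single (k - s) a" for a :: 'a
      by (auto simp: translate_def single_def fun_eq_iff)
    then show ?thesis by (simp add: char_at_def)
  qed
  have "bij_betw (\<lambda>k. k - s) (char_supp (\<lambda>x. \<xi> (translate s x))) (char_supp \<xi>)"
    by (rule bij_betw_byWitness[where f' = "\<lambda>k. k + s"]) (auto simp: char_supp_def at)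
  from prod.reindex_bij_betw[OF this, of "\<lambda>k. \<integral>a. char_at \<xi> k a \<partial>measure_pmf \<beta>"]
  show ?thesis
    unfolding fourier_coeff_bernoulli[OF assms] fourier_coeff_bernoulli[OF character_translate[OF assms]] at .
qed

lemma fourier_coeff_trivial:
  assumes "\<mu> \<in> prob_measures"
  shows "fourier_coeff \<mu> (\<lambda>_. 1) = 1"
proof -
  interpret prob_space \<mu> using assms by (simp add: prob_measures_def)
  show ?thesis by (simp add: fourier_coeff_def prob_space)
qed

lemma fourier_coeff_uniform:
  fixes \<xi> :: "'a::{finite, ab_group_add} config \<Rightarrow> complex"
  assumes "character \<xi>" "\<xi> \<noteq> (\<lambda>_. 1)"
  shows "fourier_coeff uniform_bernoulli \<xi> = 0"
proof -
  obtain k where k: "k \<in> char_supp \<xi>" using char_supp_empty_iff[OF assms(1)] assms(2) by blast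
  have "(\<integral>a. char_at \<xi> k a \<partial>measure_pmf (pmf_of_set UNIV)) = (\<Sum>a\<in>UNIV. char_at \<xi> k a / of_nat CARD('a))"
    by (subst integral_measure_pmf[of UNIV]) (auto simp: scaleR_conv_of_real divide_inverse mult.commute)
  also have "\<dots> = 0"
    using sum_nontrivial_character[OF char_at_in_dual_group[OF assms(1)], of k] k
    by (simp add: char_supp_def flip: sum_divide_distrib)
  finally show ?thesis
    unfolding uniform_bernoulli_def fourier_coeff_bernoulli[OF assms(1)]
    using k finite_char_supp[OF assms(1)] by (auto intro: prod_zero)
qed

text \<open>
  The index \<open>(p, \<Psi>)\<close> stands for the \<open>\<Psi>\<close>-term in the Fourier expansion of the indicator of the
  pattern \<open>p\<close>.
\<close>

lemma window_function_expansion: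
  fixes g :: "'a::{finite, ab_group_add} config \<Rightarrow> complex"
  assumes W: "finite W" and g: "\<And>x. g x = g (restr W x)"
  obtains J :: "('a config \<times> (int \<Rightarrow> 'a \<Rightarrow> complex)) set" and c \<xi> where "finite J"
    "\<And>j. j \<in> J \<Longrightarrow> character (\<xi> j)" "\<And>x. g x = (\<Sum>j\<in>J. c j * \<xi> j x)"
proof -
  let ?D = "dual_group :: ('a \<Rightarrow> complex) set"
  have finD: "finite ?D" by (rule finite_dual_group)
  define N where "N = complex_of_nat (card ?D)"
  have N: "N \<noteq> 0" using card_dual_group_pos[where 'a = 'a] by (simp add: N_def)
  define J where "J = (window W :: 'a config set) \<times> (\<Pi>\<^sub>E k\<in>W. ?D)"
  define \<xi> where "\<xi> j x = (\<Prod>k\<in>W. snd j k (x k))"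
    for j :: "'a config \<times> (int \<Rightarrow> 'a \<Rightarrow> complex)" and x :: "'a config"
  define c where "c j = g (fst j) * \<xi> j (- fst j) / N ^ card W" for j
  \<comment> \<open>Orthogonality at each cell of \<open>W\<close> yields the indicator of the
    pattern \<open>p\<close>; expanding the product of sums gives its Fourier expansion.\<close>
  have ind: "(\<Prod>k\<in>W. (\<Sum>\<psi>\<in>?D. \<psi> (x k - p k)) / N) = (if restr W x = p then 1 else 0)"
    if "p \<in> window W" for p x :: "'a config"
  proof (cases "restr W x = p")
    case True
    then have "x k - p k = 0" if "k \<in> W" for k using that by (auto simp: restr_def)
    then show ?thesis using True N by (simp add: sum_dual_group N_def)
  next
    case False
    then obtain k where "restr W x k \<noteq> p k" by (auto simp: fun_eq_iff)
    moreover from this have "k \<in> W" using that by (auto simp: restr_def window_def supp_def)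
    ultimately have "k \<in> W" "x k - p k \<noteq> 0" by (auto simp: restr_def)
    then show ?thesis using False W by (auto simp: sum_dual_group intro!: prod_zero)
  qed
  have mul: "\<psi> (a + b) = \<psi> a * \<psi> b" "norm (\<psi> a) = 1" if "\<psi> \<in> ?D" for \<psi> a b
    using that by (auto simp: dual_group_def char_on_def)
  show ?thesis
  proof (rule that[of J \<xi> c])
    show "finite J" unfolding J_def using W finite_window[OF W] finD
      by (intro finite_cartesian_product finite_PiE) auto
    show "character (\<xi> j)" if j: "j \<in> J" for j
    proof (rule characterI[OF _ _ W])
      have D: "snd j k \<in> ?D" if "k \<in> W" for k using j that by (auto simp: J_def PiE_iff)
      show "norm (\<xi> j x) = 1" for x
        unfolding \<xi>_def prod_norm[symmetric] using D mul(2) by (intro prod.neutral) auto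
      show "\<xi> j (x + y) = \<xi> j x * \<xi> j y" for x y
        unfolding \<xi>_def prod.distrib[symmetric] using D mul(1) by (intro prod.cong) auto
      show "\<xi> j x = 1" if "\<And>k. k \<in> W \<Longrightarrow> x k = 0" for x
        unfolding \<xi>_def using that D char_on_0[OF add_subgroup_UNIV]
        by (intro prod.neutral) (auto simp: dual_group_def)
    qed
    show "g x = (\<Sum>j\<in>J. c j * \<xi> j x)" for x
    proof -
      have "g x = (\<Sum>p\<in>window W. g p * (if restr W x = p then 1 else 0))"
      proof -
        have "(\<Sum>p\<in>window W. g p * (if restr W x = p then 1 else 0))
            = (\<Sum>p\<in>window W. if restr W x = p then g p else 0)"
          by (intro sum.cong) auto
        also have "\<dots> = g (restr W x)" using finite_window[OF W, where 'a = 'a] restr_in_window[of W x] by (simp add: sum.delta')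
        finally show ?thesis using g[of x] by simp
      qed
      also have "\<dots> = (\<Sum>p\<in>window W. g p * (\<Prod>k\<in>W. (\<Sum>\<psi>\<in>?D. \<psi> (x k - p k)) / N))"
        by (intro sum.cong refl) (simp only: ind)
      also have "\<dots> = (\<Sum>p\<in>window W. \<Sum>\<Psi>\<in>(\<Pi>\<^sub>E k\<in>W. ?D). c (p, \<Psi>) * \<xi> (p, \<Psi>) x)"
      proof (intro sum.cong refl)
        fix p :: "'a config"
        have "(\<Prod>k\<in>W. (\<Sum>\<psi>\<in>?D. \<psi> (x k - p k)) / N)
            = (\<Sum>\<Psi>\<in>(\<Pi>\<^sub>E k\<in>W. ?D). \<Prod>k\<in>W. \<Psi> k (x k - p k)) / N ^ card W"
          using prod_sum_PiE[OF W finD, of "\<lambda>k \<psi>. \<psi> (x k - p k)"] by (simp add: prod_dividef)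
        moreover have "(\<Prod>k\<in>W. \<Psi> k (x k - p k)) = \<xi> (p, \<Psi>) (- p) * \<xi> (p, \<Psi>) x"
          if "\<Psi> \<in> (\<Pi>\<^sub>E k\<in>W. ?D)" for \<Psi>
          unfolding \<xi>_def prod.distrib[symmetric]
        proof (intro prod.cong refl)
          fix k assume "k \<in> W"
          then have "\<Psi> k \<in> ?D" using that by (auto simp: PiE_iff)
          from mul(1)[OF this, of "- p k" "x k"]
          show "\<Psi> k (x k - p k) = snd (p, \<Psi>) k ((- p) k) * snd (p, \<Psi>) k (x k)"
            by simp
        qed
        ultimately have "(\<Prod>k\<in>W. (\<Sum>\<psi>\<in>?D. \<psi> (x k - p k)) / N)
            = (\<Sum>\<Psi>\<in>(\<Pi>\<^sub>E k\<in>W. ?D). \<xi> (p, \<Psi>) (- p) * \<xi> (p, \<Psi>) x) / N ^ card W"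
          by simp
        then show "g p * (\<Prod>k\<in>W. (\<Sum>\<psi>\<in>?D. \<psi> (x k - p k)) / N)
            = (\<Sum>\<Psi>\<in>(\<Pi>\<^sub>E k\<in>W. ?D). c (p, \<Psi>) * \<xi> (p, \<Psi>) x)"
          by (simp add: c_def sum_divide_distrib sum_distrib_left mult.assoc)
      qed
      finally show ?thesis by (simp add: J_def sum.cartesian_product split_beta)
    qed
  qed
qed

text \<open>Continuous functions are uniform limits of functions of finitely many cells, and the
  latter are finite linear combinations of characters.\<close>

lemma weak_star_convergence:
  fixes s :: "nat \<Rightarrow> 'a::{finite, ab_group_add} config measure"
  assumes s: "\<And>n. s n \<in> prob_measures" and l: "l \<in> prob_measures"
    and conv: "\<And>\<xi>. character \<xi> \<Longrightarrow> (\<lambda>n. fourier_coeff (s n) \<xi>) \<longlonglongrightarrow> fourier_coeff l \<xi>"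
  shows "limitin weak_star_topology s l sequentially"
  unfolding limitin_weak_star_iff[OF s]
proof (intro conjI allI impI l)
  fix f :: "'a config \<Rightarrow> real" assume f: "continuous_map config_topology euclideanreal f"
  show "(\<lambda>n. \<integral>x. f x \<partial>s n) \<longlonglongrightarrow> (\<integral>x. f x \<partial>l)"
  proof (rule LIMSEQ_I)
    fix \<epsilon> :: real assume \<epsilon>: "\<epsilon> > 0"
    obtain W where W: "finite W" "\<And>x y. (\<And>k. k \<in> W \<Longrightarrow> y k = x k) \<Longrightarrow> dist (f y) (f x) < \<epsilon>/3"
      using window_approximation[OF f, of "\<epsilon>/3"] \<epsilon> by auto
    define g where "g x = f (restr W x)" for x
    have gW: "g x = g y" if "\<And>k. k \<in> W \<Longrightarrow> x k = y k" for x y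
    proof -
      have "restr W x = restr W y" using that by (auto simp: restr_def fun_eq_iff)
      then show ?thesis by (simp add: g_def)
    qed
    have g: "continuous_map config_topology euclideanreal g"
      by (rule continuous_map_window[OF W(1)]) (rule gW)
    have "complex_of_real (g x) = complex_of_real (g (restr W x))" for x
      using gW[of x "restr W x"] by (simp add: restr_def)
    then obtain J :: "('a config \<times> (int \<Rightarrow> 'a \<Rightarrow> complex)) set" and \<xi> c where J: "finite J"
      "\<And>j. j \<in> J \<Longrightarrow> character (\<xi> j)" "\<And>x. complex_of_real (g x) = (\<Sum>j\<in>J. c j * \<xi> j x)"
      by (rule window_function_expansion[of W "\<lambda>x. complex_of_real (g x)", OF W(1)]) (rule that)
    have int: "complex_of_real (\<integral>x. g x \<partial>\<mu>) = (\<Sum>j\<in>J. c j * fourier_coeff \<mu> (\<xi> j))"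
      if "\<mu> \<in> prob_measures" for \<mu>
    proof -
      have "complex_of_real (\<integral>x. g x \<partial>\<mu>) = (\<integral>x. (\<Sum>j\<in>J. c j * \<xi> j x) \<partial>\<mu>)"
        unfolding J(3)[symmetric] by simp
      also have "\<dots> = (\<Sum>j\<in>J. \<integral>x. c j * \<xi> j x \<partial>\<mu>)"
        using J(2) that unfolding character_def
        by (intro Bochner_Integration.integral_sum integrable_mult_right continuous_integrable) auto
      finally show ?thesis by (simp add: fourier_coeff_def)
    qed
    have "(\<lambda>n. \<Sum>j\<in>J. c j * fourier_coeff (s n) (\<xi> j)) \<longlonglongrightarrow> (\<Sum>j\<in>J. c j * fourier_coeff l (\<xi> j))"
      using J(2) by (intro tendsto_sum tendsto_mult tendsto_const conv)
    then have "(\<lambda>n. complex_of_real (\<integral>x. g x \<partial>s n)) \<longlonglongrightarrow> complex_of_real (\<integral>x. g x \<partial>l)"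
      unfolding int[OF s] int[OF l] .
    then have "(\<lambda>n. \<integral>x. g x \<partial>s n) \<longlonglongrightarrow> (\<integral>x. g x \<partial>l)" by (simp only: tendsto_of_real_iff)
    from LIMSEQ_D[OF this, of "\<epsilon>/3"] \<epsilon> obtain n0 where
      n0: "\<And>n. n \<ge> n0 \<Longrightarrow> \<bar>(\<integral>x. g x \<partial>s n) - (\<integral>x. g x \<partial>l)\<bar> < \<epsilon>/3" by auto
    have close: "\<bar>(\<integral>x. f x \<partial>\<mu>) - (\<integral>x. g x \<partial>\<mu>)\<bar> \<le> \<epsilon>/3" if \<mu>: "\<mu> \<in> prob_measures" for \<mu>
    proof -
      interpret prob_space \<mu> using \<mu> by (simp add: prob_measures_def)
      have int_fg: "integrable \<mu> f" "integrable \<mu> g" using continuous_integrable f g \<mu> by blast+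
      have fg: "\<bar>f x - g x\<bar> \<le> \<epsilon>/3" for x
        using W(2)[of x "restr W x"] unfolding g_def by (simp add: dist_real_def restr_def)
      have "\<bar>(\<integral>x. f x \<partial>\<mu>) - (\<integral>x. g x \<partial>\<mu>)\<bar> = \<bar>\<integral>x. f x - g x \<partial>\<mu>\<bar>"
        using int_fg by simp
      also have "\<dots> \<le> (\<integral>x. \<bar>f x - g x\<bar> \<partial>\<mu>)" by (rule integral_abs_bound)
      also have "\<dots> \<le> (\<integral>x. \<epsilon>/3 \<partial>\<mu>)" using int_fg fg by (intro integral_mono) auto
      finally show ?thesis by (simp add: prob_space)
    qed
    have "norm ((\<integral>x. f x \<partial>s n) - (\<integral>x. f x \<partial>l)) < \<epsilon>" if "n \<ge> n0" for n
      using n0[OF that] close[OF s, of n] close[OF l] unfolding real_norm_def by linarith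
    then show "\<exists>no. \<forall>n\<ge>no. norm ((\<integral>x. f x \<partial>s n) - (\<integral>x. f x \<partial>l)) < \<epsilon>" by blast
  qed
qed

text \<open>This allows one sequence of times to serve all characters through
  \<open>density_one_diagonal\<close>.\<close>

lemma countable_characters: "countable {\<xi> :: 'a::{finite, ab_group_add} config \<Rightarrow> complex. character \<xi>}"
proof -
  let ?D = "dual_group :: ('a \<Rightarrow> complex) set"
  have "{\<xi>. character \<xi>} \<subseteq> (\<lambda>(K, \<Psi>) x. \<Prod>k\<in>K. \<Psi> k (x k)) ` (SIGMA K:{K :: int set. finite K}. (\<Pi>\<^sub>E k\<in>K. ?D))"
  proof
    fix \<xi> :: "'a config \<Rightarrow> complex" assume "\<xi> \<in> {\<xi>. character \<xi>}"
    then have \<xi>: "character \<xi>" by simp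
    let ?K = "char_supp \<xi>"
    have "\<xi> = (\<lambda>x. \<Prod>k\<in>?K. restrict (char_at \<xi>) ?K k (x k))"
      by (rule ext) (simp add: character_eq_prod[OF \<xi>])
    moreover have "(?K, restrict (char_at \<xi>) ?K) \<in> (SIGMA K:{K :: int set. finite K}. (\<Pi>\<^sub>E k\<in>K. ?D))"
      using finite_char_supp[OF \<xi>] char_at_in_dual_group[OF \<xi>] by auto
    ultimately show "\<xi> \<in> (\<lambda>(K, \<Psi>) x. \<Prod>k\<in>K. \<Psi> k (x k)) ` (SIGMA K:{K :: int set. finite K}. (\<Pi>\<^sub>E k\<in>K. ?D))"
      by (intro image_eqI[of _ _ "(?K, restrict (char_at \<xi>) ?K)"]) auto
  qed
  moreover have "countable (SIGMA K:{K :: int set. finite K}. (\<Pi>\<^sub>E k\<in>K. ?D))"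
    using finite_dual_group
    by (intro countable_SIGMA countable_PiE) (auto intro: countable_Collect_finite countable_finite)
  ultimately show ?thesis by (meson countable_image countable_subset)
qed

text \<open>An equal mixture of the point mass at 0 and the uniform law. Every nontrivial character
  of the alphabet then has integral exactly 1/2, so Fourier coefficients are nonzero and decay with
  the rank.\<close>

definition half_uniform :: "'a::{finite, ab_group_add} pmf" where
  "half_uniform = bind_pmf (bernoulli_pmf (1/2)) (\<lambda>b. if b then return_pmf 0 else pmf_of_set UNIV)"

lemma half_uniform_character:
  assumes "\<psi> \<in> dual_group" "\<psi> \<noteq> (\<lambda>_. 1)"
  shows "(\<integral>a. \<psi> a \<partial>measure_pmf half_uniform) = 1/2"
proof -
  have "(\<integral>a. \<psi> a \<partial>measure_pmf (pmf_of_set UNIV)) = (\<Sum>a\<in>UNIV. \<psi> a / of_nat CARD('a))"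
    by (subst integral_measure_pmf[of UNIV]) (auto simp: scaleR_conv_of_real divide_inverse mult.commute)
  also have "\<dots> = 0" using sum_nontrivial_character[OF assms] by (simp flip: sum_divide_distrib)
  finally have u: "(\<integral>a. \<psi> a \<partial>measure_pmf (pmf_of_set UNIV)) = 0" .
  have "\<psi> 0 = 1" using assms(1) char_on_0[OF add_subgroup_UNIV] by (simp add: dual_group_def)
  then show ?thesis
    unfolding half_uniform_def
    by (subst pmf_expectation_bind[of UNIV]) (auto simp: UNIV_bool u scaleR_conv_of_real)
qed

lemma fourier_coeff_half_uniform:
  fixes \<xi> :: "'a::{finite, ab_group_add} config \<Rightarrow> complex"
  assumes "character \<xi>"
  shows "fourier_coeff (bernoulli_measure half_uniform) \<xi> = (1/2) ^ char_rank \<xi>"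
proof -
  have "(\<Prod>k\<in>char_supp \<xi>. \<integral>a. char_at \<xi> k a \<partial>measure_pmf half_uniform) = (\<Prod>k\<in>char_supp \<xi>. 1/2)"
    using half_uniform_character[OF char_at_in_dual_group[OF assms]]
    by (intro prod.cong) (auto simp: char_supp_def)
  then show ?thesis by (simp add: fourier_coeff_bernoulli[OF assms] char_rank_def)
qed

subsection \<open>The equivalences\<close>

lemma no_soliton_if_diffusive:
  assumes "diffusive_in_density F"
  shows "\<nexists>c. soliton F c"
proof
  assume "\<exists>c. soliton F c"
  then obtain c D where c: "c \<noteq> 0" "finite_config c"
    and D: "\<And>t. diameter (real_of_int ` supp ((F ^^ t) c)) \<le> D"
    unfolding soliton_def by blast
  have bound: "config_rank ((F ^^ t) c) \<le> nat \<lceil>D\<rceil> + 1" for t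
  \<comment> \<open>In the other case the support is infinite or empty, and \<open>card\<close>
    gives rank 0.\<close>
  proof (cases "finite (supp ((F ^^ t) c)) \<and> supp ((F ^^ t) c) \<noteq> {}")
    case True
    define X m where "X = supp ((F ^^ t) c)" and "m = Min X"
    have X: "finite X" "X \<noteq> {}" "m \<in> X" using True Min_in[of X] by (auto simp: X_def m_def)
    have "X \<subseteq> {m..m + int (nat \<lceil>D\<rceil>)}"
    proof
      fix i assume i: "i \<in> X"
      have "m \<le> i" unfolding m_def by (rule Min_le[OF X(1) i])
      have "dist (real_of_int i) (real_of_int m) \<le> diameter (real_of_int ` X)"
        using X(3) i by (intro diameter_bounded_bound finite_imp_bounded finite_imageI X(1) imageI)
      also have "\<dots> \<le> D" unfolding X_def by (rule D)
      finally have "real_of_int (i - m) \<le> D" using \<open>m \<le> i\<close> by (simp add: dist_real_def)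
      then have "i - m \<le> int (nat \<lceil>D\<rceil>)" using \<open>m \<le> i\<close> by linarith
      then show "i \<in> {m..m + int (nat \<lceil>D\<rceil>)}" using \<open>m \<le> i\<close> by auto
    qed
    then have "card X \<le> card {m..m + int (nat \<lceil>D\<rceil>)}" by (intro card_mono) auto
    moreover have "card {m..m + int d} = d + 1" for d by simp
    ultimately show ?thesis by (simp only: config_rank_def X_def)
  qed (auto simp: config_rank_def)
  obtain \<phi> :: "nat \<Rightarrow> nat" where "filterlim (\<lambda>t. config_rank ((F ^^ \<phi> t) c)) at_top sequentially"
    using assms c unfolding diffusive_in_density_def by blast
  then have "\<forall>\<^sub>F t in sequentially. nat \<lceil>D\<rceil> + 2 \<le> config_rank ((F ^^ \<phi> t) c)"
    unfolding filterlim_at_top by blast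
  then obtain t where "nat \<lceil>D\<rceil> + 2 \<le> config_rank ((F ^^ \<phi> t) c)"
    unfolding eventually_sequentially by blast
  then show False using bound[of "\<phi> t"] by simp
qed

lemma diffusive_if_no_soliton:
  fixes F :: "'a::{finite, ab_group_add} config \<Rightarrow> 'a config"
  assumes "additive_ca F r" "\<nexists>c. soliton F c"
  shows "diffusive_in_density F"
  unfolding diffusive_in_density_def
proof (intro allI impI)
  fix c :: "'a config" assume c: "c \<noteq> 0 \<and> finite_config c"
  have "zero_density {t. \<not> m < config_rank ((F ^^ t) c)}" for m
    using diffusion_of_configs[OF assms, of c m] c by (simp add: finite_config_def not_less)
  then obtain \<phi> :: "nat \<Rightarrow> nat" where "strict_mono \<phi>" "lower_density (range \<phi>) = 1"
    "\<And>m. \<forall>\<^sub>F t in sequentially. m < config_rank ((F ^^ \<phi> t) c)"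
    by (rule density_one_diagonal[of "\<lambda>m t. m < config_rank ((F ^^ t) c)"]) blast
  then show "\<exists>\<phi> :: nat \<Rightarrow> nat. strict_mono \<phi> \<and> lower_density (range \<phi>) = 1 \<and>
      filterlim (\<lambda>t. config_rank ((F ^^ \<phi> t) c)) at_top sequentially"
    unfolding filterlim_at_top by (meson eventually_mono less_imp_le)
qed

text \<open>The dual orbit of a nontrivial character has large rank outside a set of times of
  density zero, and there harmonic mixing makes the coefficient small.\<close>

lemma randomizes_if_no_soliton:
  fixes F :: "'a::{finite, ab_group_add} config \<Rightarrow> 'a config"
  assumes F: "additive_ca F r" "\<nexists>c. soliton F c" and \<mu>: "\<mu> \<in> prob_measures" "harmonically_mixing \<mu>"
  shows "randomizes_in_density F \<mu>"
proof -
  let ?C = "{\<xi> :: 'a config \<Rightarrow> complex. character \<xi>}"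
  define X where "X = from_nat_into ?C"
  have X: "character (X i)" for i
    using from_nat_into[of ?C i] character_trivial unfolding X_def by blast
  \<comment> \<open>The index \<open>m\<close> codes a character and a precision. The trivial
    character is exempt because its coefficient is always 1.\<close>
  define P where "P m t \<longleftrightarrow> X (fst (prod_decode m)) = (\<lambda>_. 1) \<or>
      norm (fourier_coeff \<mu> (\<lambda>x. X (fst (prod_decode m)) ((F ^^ t) x))) < 1 / real (Suc (snd (prod_decode m)))"
    for m t
  have "zero_density {t. \<not> P m t}" for m
  proof (cases "X (fst (prod_decode m)) = (\<lambda>_. 1)")
    case True
    then show ?thesis by (simp add: P_def zero_density_finite)
  next
    case False
    let ?\<xi> = "X (fst (prod_decode m))"
    obtain R where R: "\<And>\<xi>. character \<xi> \<Longrightarrow> real (char_rank \<xi>) > R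
        \<Longrightarrow> norm (fourier_coeff \<mu> \<xi>) < 1 / real (Suc (snd (prod_decode m)))"
      using \<mu>(2) unfolding harmonically_mixing_def
      by (metis of_nat_0_less_iff zero_less_Suc zero_less_divide_1_iff)
    have ch: "character (\<lambda>x. ?\<xi> ((F ^^ t) x))" for t
      by (rule character_comp[OF X additive_ca_funpow[OF F(1)]])
    have "{t. \<not> P m t} \<subseteq> {t. char_rank (\<lambda>x. ?\<xi> ((F ^^ t) x)) \<le> nat \<lceil>R\<rceil>}"
    proof
      fix t assume "t \<in> {t. \<not> P m t}"
      then have "real (char_rank (\<lambda>x. ?\<xi> ((F ^^ t) x))) \<le> R"
        using R[OF ch, of t] unfolding P_def by force
      then show "t \<in> {t. char_rank (\<lambda>x. ?\<xi> ((F ^^ t) x)) \<le> nat \<lceil>R\<rceil>}" by (simp, linarith)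
    qed
    then show ?thesis by (rule zero_density_subset[OF diffusion_of_characters[OF F X False]])
  qed
  then obtain \<phi> :: "nat \<Rightarrow> nat" where \<phi>: "strict_mono \<phi>" "lower_density (range \<phi>) = 1"
    "\<And>m. \<forall>\<^sub>F t in sequentially. P m (\<phi> t)"
    by (rule density_one_diagonal[of P]) (rule that)
  have push: "push (F ^^ n) \<mu> \<in> prob_measures" for n
    by (rule push_in_prob_measures[OF additive_ca.continuous[OF additive_ca_funpow[OF F(1)]] \<mu>(1)])
  have uni: "uniform_bernoulli \<in> (prob_measures :: 'a config measure set)"
    unfolding uniform_bernoulli_def by (rule bernoulli_measure_in_prob_measures)
  have "limitin weak_star_topology (\<lambda>t. push (F ^^ \<phi> t) \<mu>) uniform_bernoulli sequentially"
  proof (rule weak_star_convergence[OF push uni])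
    fix \<xi> :: "'a config \<Rightarrow> complex" assume \<xi>: "character \<xi>"
    show "(\<lambda>n. fourier_coeff (push (F ^^ \<phi> n) \<mu>) \<xi>) \<longlonglongrightarrow> fourier_coeff uniform_bernoulli \<xi>"
    proof (cases "\<xi> = (\<lambda>_. 1)")
      case True
      then show ?thesis by (simp add: fourier_coeff_trivial push uni)
    next
      case False
      obtain i where i: "\<xi> = X i"
        using from_nat_into_surj[OF countable_characters, of \<xi>] \<xi> unfolding X_def by auto
      have "(\<lambda>n. fourier_coeff (push (F ^^ \<phi> n) \<mu>) \<xi>) \<longlonglongrightarrow> 0"
      proof (rule tendstoI)
        fix e :: real assume "e > 0"
        then obtain j where j: "1 / real (Suc j) < e" using nat_approx_posE by blast
        from \<phi>(3)[of "prod_encode (i, j)"]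
        show "\<forall>\<^sub>F n in sequentially. dist (fourier_coeff (push (F ^^ \<phi> n) \<mu>) \<xi>) 0 < e"
        proof (rule eventually_mono)
          fix n assume "P (prod_encode (i, j)) (\<phi> n)"
          then have "norm (fourier_coeff \<mu> (\<lambda>x. \<xi> ((F ^^ \<phi> n) x))) < 1 / real (Suc j)"
            using False unfolding P_def i by simp
          then show "dist (fourier_coeff (push (F ^^ \<phi> n) \<mu>) \<xi>) 0 < e"
            using j fourier_coeff_push[OF additive_ca_funpow[OF F(1)] \<mu>(1) \<xi>] by simp
        qed
      qed
      then show ?thesis by (simp add: fourier_coeff_uniform[OF \<xi> False])
    qed
  qed
  then show ?thesis using \<phi>(1,2) unfolding randomizes_in_density_def by blast
qed

text \<open>The measure with marginal \<open>half_uniform\<close> is both harmonically mixing and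
  strongly nonuniform.\<close>

lemma accumulates_if_randomizes:
  fixes F :: "'a::{finite, ab_group_add} config \<Rightarrow> 'a config"
  assumes "\<forall>\<mu>\<in>prob_measures. harmonically_mixing \<mu> \<longrightarrow> randomizes_in_density F \<mu>"
  shows "\<exists>\<beta>. strongly_nonuniform (bernoulli_measure \<beta>) \<and>
    accumulation_point_of weak_star_topology
      (\<lambda>t. push (F ^^ t) (bernoulli_measure \<beta>)) uniform_bernoulli"
proof -
  let ?\<mu> = "bernoulli_measure half_uniform :: 'a config measure"
  have nonuniform: "strongly_nonuniform ?\<mu>"
    by (simp add: strongly_nonuniform_def fourier_coeff_half_uniform)
  have "harmonically_mixing ?\<mu>"
    unfolding harmonically_mixing_def
  proof (intro allI impI)
    fix \<epsilon> :: real assume "\<epsilon> > 0"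
    then obtain R where R: "(1/2) ^ R < \<epsilon>" using real_arch_pow_inv[of \<epsilon> "1/2"] by auto
    have "norm (fourier_coeff ?\<mu> \<xi>) < \<epsilon>" if "character \<xi>" "real (char_rank \<xi>) > real (Suc R)" for \<xi>
    proof -
      have "norm (fourier_coeff ?\<mu> \<xi>) = (1/2) ^ char_rank \<xi>"
        by (simp add: fourier_coeff_half_uniform[OF that(1)] norm_power norm_divide)
      also have "\<dots> \<le> (1/2) ^ R" using that(2) by (intro power_decreasing) auto
      finally show ?thesis using R by simp
    qed
    then show "\<exists>R>0. \<forall>\<xi>. character \<xi> \<and> real (char_rank \<xi>) > R \<longrightarrow> norm (fourier_coeff ?\<mu> \<xi>) < \<epsilon>"
      by (intro exI[of _ "real (Suc R)"]) auto
  qed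
  then have "randomizes_in_density F ?\<mu>" using assms bernoulli_measure_in_prob_measures by blast
  then obtain \<phi> :: "nat \<Rightarrow> nat" where \<phi>: "strict_mono \<phi>"
    "limitin weak_star_topology (\<lambda>t. push (F ^^ \<phi> t) ?\<mu>) uniform_bernoulli sequentially"
    unfolding randomizes_in_density_def by blast
  have "accumulation_point_of weak_star_topology (\<lambda>t. push (F ^^ t) ?\<mu>) uniform_bernoulli"
    unfolding accumulation_point_of_def
  proof (intro conjI allI impI)
    show "uniform_bernoulli \<in> topspace (weak_star_topology :: 'a config measure topology)"
      using \<phi>(2) unfolding limitin_def by blast
    fix U :: "'a config measure set" assume "openin weak_star_topology U \<and> uniform_bernoulli \<in> U"
    then have "\<forall>\<^sub>F t in sequentially. push (F ^^ \<phi> t) ?\<mu> \<in> U" using \<phi>(2) unfolding limitin_def by blast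
    then obtain n0 where n0: "\<And>t. t \<ge> n0 \<Longrightarrow> push (F ^^ \<phi> t) ?\<mu> \<in> U"
      unfolding eventually_sequentially by blast
    show "\<exists>\<^sub>\<infinity>t. push (F ^^ t) ?\<mu> \<in> U"
      unfolding INFM_nat_le
    proof
      fix m
      have "m \<le> \<phi> (max m n0)" using strict_mono_imp_increasing[OF \<phi>(1), of "max m n0"] by simp
      then show "\<exists>t\<ge>m. push (F ^^ t) ?\<mu> \<in> U" using n0[of "max m n0"] by (intro exI[of _ "\<phi> (max m n0)"]) simp
    qed
  qed
  then show ?thesis using nonuniform by blast
qed

text \<open>A soliton provides a nontrivial character whose coefficients along the orbit stay away
  from 0, whereas its coefficient for the uniform measure is 0.\<close>

lemma no_soliton_if_accumulates:
  fixes F :: "'a::{finite, ab_group_add} config \<Rightarrow> 'a config"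
  assumes F: "additive_ca F r" and \<beta>: "strongly_nonuniform (bernoulli_measure \<beta>)"
    and acc: "accumulation_point_of weak_star_topology
      (\<lambda>t. push (F ^^ t) (bernoulli_measure \<beta>)) uniform_bernoulli"
  shows "\<nexists>c. soliton F c"
proof
  let ?\<mu> = "bernoulli_measure \<beta>"
  assume "\<exists>c. soliton F c"
  then obtain \<xi> q s where \<xi>: "character \<xi>" "\<xi> \<noteq> (\<lambda>_. 1)" "q > 0"
    and rec: "(\<forall>x. \<xi> ((F ^^ q) x) = 1) \<or> (\<forall>x. \<xi> ((F ^^ q) x) = \<xi> (translate s x))"
    using recurrent_character_of_soliton[OF F] by metis
  define a where "a t = fourier_coeff ?\<mu> (\<lambda>x. \<xi> ((F ^^ t) x))" for t
  have ch: "character (\<lambda>x. \<xi> ((F ^^ t) x))" for t by (rule character_comp[OF \<xi>(1) additive_ca_funpow[OF F]])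
  \<comment> \<open>Going back \<open>q\<close> steps replaces the argument by a translate, which
    the Bernoulli measure does not notice; in the other case the character becomes trivial, which
    explains the extra value 1.\<close>
  have range: "a t \<in> insert 1 (a ` {..<q})" for t
  proof (induction t rule: less_induct)
    case (less t)
    show ?case
    proof (cases "t < q")
      case False
      then have t: "(F ^^ t) x = (F ^^ q) ((F ^^ (t - q)) x)" for x
        by (metis comp_apply funpow_add le_add_diff_inverse not_less)
      from rec show ?thesis
      proof
        assume "\<forall>x. \<xi> ((F ^^ q) x) = 1"
        then have "a t = fourier_coeff ?\<mu> (\<lambda>_. 1)" unfolding a_def t by simp
        then show ?thesis by (simp add: fourier_coeff_trivial bernoulli_measure_in_prob_measures)
      next
        assume "\<forall>x. \<xi> ((F ^^ q) x) = \<xi> (translate s x)"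
        then have "\<xi> ((F ^^ t) x) = \<xi> ((F ^^ (t - q)) (translate s x))" for x
          unfolding t by (simp only: additive_ca.equivariant[OF additive_ca_funpow[OF F]])
        then have "a t = a (t - q)"
          unfolding a_def by (simp only: fourier_coeff_bernoulli_translate[OF ch])
        moreover have "t - q < t" using False \<xi>(3) by simp
        ultimately show ?thesis using less[of "t - q"] by (simp only:)
      qed
    qed auto
  qed
  define \<epsilon> where "\<epsilon> = Min (norm ` insert 1 (a ` {..<q}))"
  have "\<epsilon> > 0"
    using \<beta> ch unfolding \<epsilon>_def strongly_nonuniform_def a_def by (subst Min_gr_iff) auto
  have large: "\<epsilon> \<le> norm (a t)" for t
    unfolding \<epsilon>_def by (intro Min_le imageI range) simp
  have coeff: "integrable \<nu> \<xi>" if "\<nu> \<in> prob_measures" for \<nu>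
    using continuous_integrable \<xi>(1) that unfolding character_def by blast
  have cont: "continuous_map config_topology euclideanreal (\<lambda>x. Re (\<xi> x))"
      "continuous_map config_topology euclideanreal (\<lambda>x. Im (\<xi> x))"
  proof -
    have c: "continuous_map config_topology euclidean \<xi>" using \<xi>(1) by (simp add: character_def)
    have "continuous_map euclidean euclideanreal Re" "continuous_map euclidean euclideanreal Im"
      by (auto intro: continuous_intros)
    from this[THEN continuous_map_compose[OF c]]
    show "continuous_map config_topology euclideanreal (\<lambda>x. Re (\<xi> x))"
      "continuous_map config_topology euclideanreal (\<lambda>x. Im (\<xi> x))"
      unfolding comp_def .
  qed
  let ?U = "\<lambda>f. {\<nu> \<in> prob_measures. (\<integral>x. f x \<partial>\<nu>) \<in> ball (0 :: real) (\<epsilon>/2)}"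
  have open_U: "openin weak_star_topology (?U f)"
    if "continuous_map config_topology euclideanreal f" for f
    unfolding weak_star_topology_def by (rule topology_generated_by_Basis) (use that in blast)
  \<comment> \<open>The weak-star topology is generated by real functions, so the real and imaginary
    parts are controlled separately, each by half of \<epsilon>.\<close>
  let ?V = "?U (\<lambda>x. Re (\<xi> x)) \<inter> ?U (\<lambda>x. Im (\<xi> x))"
  have V: "\<nu> \<in> ?V \<longleftrightarrow> \<bar>Re (fourier_coeff \<nu> \<xi>)\<bar> < \<epsilon>/2 \<and> \<bar>Im (fourier_coeff \<nu> \<xi>)\<bar> < \<epsilon>/2"
    if "\<nu> \<in> prob_measures" for \<nu>
    using that coeff[OF that] by (auto simp: fourier_coeff_def)
  have uni: "uniform_bernoulli \<in> (prob_measures :: 'a config measure set)"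
    unfolding uniform_bernoulli_def by (rule bernoulli_measure_in_prob_measures)
  have "uniform_bernoulli \<in> ?V"
    unfolding V[OF uni] fourier_coeff_uniform[OF \<xi>(1,2)] using \<open>\<epsilon> > 0\<close> by simp
  moreover have "openin weak_star_topology ?V" by (intro openin_Int open_U cont)
  ultimately have "\<exists>\<^sub>\<infinity>t. push (F ^^ t) ?\<mu> \<in> ?V" using acc unfolding accumulation_point_of_def by blast
  then obtain t where t: "push (F ^^ t) ?\<mu> \<in> ?V" unfolding INFM_nat_le by blast
  then have p: "push (F ^^ t) ?\<mu> \<in> prob_measures" by blast
  have "norm (a t) < \<epsilon>"
    using t cmod_le[of "a t"] unfolding V[OF p] a_def
      fourier_coeff_push[OF additive_ca_funpow[OF F] bernoulli_measure_in_prob_measures \<xi>(1)] by linarith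
  then show False using large[of t] by simp
qed

theorem theorem2:
  fixes F :: "('a::{finite, ab_group_add}) config \<Rightarrow> 'a config"
  assumes "cellular_automaton F" and "abelian_map F"
  shows
    "((\<forall>\<mu>\<in>prob_measures. harmonically_mixing \<mu> \<longrightarrow> randomizes_in_density F \<mu>)
        \<longleftrightarrow> (\<nexists>c. soliton F c))
     \<and> ((\<nexists>c. soliton F c) \<longleftrightarrow> diffusive_in_density F)
     \<and> (diffusive_in_density F
        \<longleftrightarrow> (\<exists>\<beta>. strongly_nonuniform (bernoulli_measure \<beta>) \<and>
              accumulation_point_of weak_star_topology
                (\<lambda>t. push (F ^^ t) (bernoulli_measure \<beta>)) uniform_bernoulli))"
proof -
  obtain r where F: "additive_ca F r" using additive_ca_of_cellular_automaton[OF assms] .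
  \<comment> \<open>The implications used are (iii) to (ii), (ii) to (iii), (ii) to (i), (i) to (iv)
    and (iv) to (ii).\<close>
  show ?thesis
    using no_soliton_if_diffusive[of F] diffusive_if_no_soliton[OF F] randomizes_if_no_soliton[OF F]
      accumulates_if_randomizes[of F] no_soliton_if_accumulates[OF F] by blast
qed

end
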